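(* Let $k\ge 2$ be an integer, let $I$ be a compact subset of $\mathbb{R}^d$, let $Z=\{Z(t): t\in I\}$ be a random field with values in $\mathbb{R}^d$, and let $u\in\mathbb{R}^d$. Assume that: (A0) $Z$ is Gaussian; (A1) almost surely $t\mapsto Z(t)$ is of class $C^1$; (A$'$2) for pairwise different values $t_1,\dots,t_k\in I$ of the parameter, the distribution of $(Z(t_1),\dots,Z(t_k))$ does not degenerate in $(\mathbb{R}^d)^k$; (A3) $\mathrm{P}\{\exists t\in \dot I:\ Z(t)=u,\ \det(Z'(t))=0\}=0$; (A4) $\lambda(\partial I)=0$. Then $$\mathrm{E}\big[N_u^Z(I)(N_u^Z(I)-1)\cdots(N_u^Z(I)-k+1)\big]$$ $$=\int_{I^k}\mathrm{E}\Big(\prod_{j=1}^k|\det(Z'(t_j))|\,\Big/\,Z(t_1)=\cdots=Z(t_k)=u\Big)\,p_{Z(t_1),\dots,Z(t_k)}(u,\dots,u)\,dt_1\cdots dt_k,$$ where both members may be infinite.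
   Context: $\dot I$ and $\partial I$ denote the interior and the boundary of $I$; $\lambda$ is Lebesgue measure on $\mathbb{R}^d$. $N_u^Z(I)$ is the number of $t\in I$ with $Z(t)=u$. $Z'(t)$ is the derivative (a $d\times d$ matrix). $p_{Z(t_1),\dots,Z(t_k)}$ is the joint density of $(Z(t_1),\dots,Z(t_k))$, which exists for pairwise different $t_1,\dots,t_k$, i.e. for Lebesgue-almost every $(t_1,\dots,t_k)\in I^k$. $\mathrm{E}(\,\cdot\,/\,\cdot\,)$ denotes conditional expectation (the version given by Gaussian regression). *)

theory Defs
  imports "HOL-Probability.Probability"
begin

text \<open>Real Gaussian variables; constants count as Gaussian with variance zero.\<close>

definition gaussian_rv :: "'w measure \<Rightarrow> ('w \<Rightarrow> real) \<Rightarrow> bool" where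
  "gaussian_rv M X \<longleftrightarrow> X \<in> borel_measurable M \<and>
     (\<exists>m s. (0 < s \<and> distributed M lborel X (\<lambda>x. ennreal (normal_density m s x)))
          \<or> (AE w in M. X w = m))"

definition gaussian_field ::
  "'w measure \<Rightarrow> 'a set \<Rightarrow> ('a \<Rightarrow> 'w \<Rightarrow> 'b::euclidean_space) \<Rightarrow> bool" where
  "gaussian_field M T Z \<longleftrightarrow> (\<forall>t\<in>T. Z t \<in> borel_measurable M) \<and>
     (\<forall>F a. finite F \<and> F \<subseteq> T \<longrightarrow> gaussian_rv M (\<lambda>w. \<Sum>t\<in>F. a t \<bullet> Z t w))"

text \<open>A function on a set that need not be open is of class \<open>C\<^sup>1\<close> if it is the restriction
  of a \<open>C\<^sup>1\<close> function on an open neighbourhood.\<close>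

definition C1_on ::
  "'a::euclidean_space set \<Rightarrow> ('a \<Rightarrow> 'b::euclidean_space) \<Rightarrow> bool" where
  "C1_on S f \<longleftrightarrow> (\<exists>U g (g' :: 'a \<Rightarrow> 'a \<Rightarrow>\<^sub>L 'b). open U \<and> S \<subseteq> U \<and> (\<forall>x\<in>S. g x = f x) \<and>
     (\<forall>x\<in>U. (g has_derivative blinfun_apply (g' x)) (at x)) \<and> continuous_on U g')"

definition nondegenerate :: "'w measure \<Rightarrow> ('w \<Rightarrow> 'a::euclidean_space) \<Rightarrow> bool" where
  "nondegenerate M X \<longleftrightarrow> \<not> (\<exists>S. affine S \<and> S \<noteq> UNIV \<and> (AE w in M. X w \<in> S))"

text \<open>The derivative is taken within \<open>I\<close>, so values of \<open>Z\<close> outside \<open>I\<close> are irrelevant.\<close>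

definition field_deriv ::
  "(real^'n) set \<Rightarrow> (real^'n \<Rightarrow> 'w \<Rightarrow> real^'n) \<Rightarrow> real^'n \<Rightarrow> 'w \<Rightarrow> real^'n^'n" where
  "field_deriv I Z t w = jacobian (\<lambda>s. Z s w) (at t within I)"

definition num_roots :: "'a set \<Rightarrow> ('a \<Rightarrow> 'w \<Rightarrow> 'b) \<Rightarrow> 'b \<Rightarrow> 'w \<Rightarrow> ennreal" where
  "num_roots I Z u w = emeasure (count_space UNIV) {t \<in> I. Z t w = u}"

text \<open>The density of \<open>X\<close> in its continuous version, which is unique and so has values at points.\<close>

definition continuous_density :: "'w measure \<Rightarrow> ('w \<Rightarrow> 'a::euclidean_space) \<Rightarrow> 'a \<Rightarrow> real" where
  "continuous_density M X = (THE f. continuous_on UNIV f \<and> (\<forall>x. 0 \<le> f x) \<and>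
     distributed M lborel X (\<lambda>x. ennreal (f x)))"

text \<open>The covariance of \<open>X\<close> and \<open>Y\<close> as the linear map \<open>a \<mapsto> E((a \<bullet> (X - E X)) (Y - E Y))\<close>;
  for \<open>Y = X\<close> it is the covariance operator of \<open>X\<close>. The integrals are with respect to the
  completion because \<open>Y\<close> will be a derivative of paths that are differentiable only almost
  surely: it agrees almost everywhere with a measurable function, but its arbitrary values on
  the exceptional null set might destroy measurability with respect to \<open>M\<close> itself.\<close>

definition covariance_map ::
  "'w measure \<Rightarrow> ('w \<Rightarrow> 'a::euclidean_space) \<Rightarrow> ('w \<Rightarrow> 'b::euclidean_space) \<Rightarrow> 'a \<Rightarrow> 'b" where
  "covariance_map M X Y a =
     (let P = completion M; mX = (\<integral>w. X w \<partial>P); mY = (\<integral>w. Y w \<partial>P)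
      in (\<integral>w. (a \<bullet> (X w - mX)) *\<^sub>R (Y w - mY) \<partial>P))"

definition regression_map ::
  "'w measure \<Rightarrow> ('w \<Rightarrow> 'a::euclidean_space) \<Rightarrow> ('w \<Rightarrow> 'b::euclidean_space) \<Rightarrow> 'a \<Rightarrow> 'b" where
  "regression_map M X Y = covariance_map M X Y \<circ> inv (covariance_map M X X)"

text \<open>\<open>E(f(Y) / X = x)\<close> by Gaussian regression. With \<open>B = Cov(Y,X) Var(X)\<^sup>-\<^sup>1\<close> the residual
  \<open>Y - B X\<close> is uncorrelated with \<open>X\<close>, hence independent of it when \<open>(X,Y)\<close> is Gaussian, and
  conditioning on \<open>X = x\<close> replaces \<open>Y = (Y - B X) + B X\<close> by \<open>(Y - B X) + B x\<close>.\<close>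

definition gaussian_cond_exp ::
  "'w measure \<Rightarrow> ('b::euclidean_space \<Rightarrow> ennreal) \<Rightarrow> ('w \<Rightarrow> 'b) \<Rightarrow> ('w \<Rightarrow> 'a::euclidean_space) \<Rightarrow> 'a \<Rightarrow> ennreal"
  where
  "gaussian_cond_exp M f Y X x =
     (let B = regression_map M X Y in (\<integral>\<^sup>+ w. f ((Y w - B (X w)) + B x) \<partial>M))"

end

theory Submission
  imports Defs
begin

text \<open>The tuples of distinct roots are the roots of the field \<open>X(t) = (Z(t\<^sub>1), \<dots>, Z(t\<^sub>k))\<close> on
  the open set \<open>T\<close> of tuples of distinct interior points, so the factorial moment is the expected
  number of roots of \<open>X\<close> in \<open>T\<close>. Near a point \<open>t\<^sub>0\<close> of \<open>T\<close> write \<open>X(t) = R(t) + C(t) \<xi>\<close> with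
  \<open>\<xi> = X(t\<^sub>0)\<close>, where \<open>C(t)\<close> is the (invertible) regression matrix and \<open>R\<close> is independent of \<open>\<xi>\<close>.
  Then \<open>X(t) = u\<close> means \<open>G(t) = \<xi>\<close> for \<open>G(t) = C(t)\<^sup>-\<^sup>1 (u - R(t))\<close>. Conditionally on \<open>R\<close>, the
  variable \<open>\<xi>\<close> has a density, and the area formula for \<open>G\<close> computes the integral of the number of
  roots of \<open>G(t) = x\<close> against this density. This gives the formula at the level \<open>u\<close> itself rather
  than for almost every level; Gaussian regression identifies the resulting integrand. The same
  decomposition for \<open>Z\<close> shows that \<open>Z\<close> almost surely takes the value \<open>u\<close> nowhere on the null set
  \<open>\<partial>I\<close>, because \<open>G\<close> maps it to a null set.\<close>

section \<open>Characteristic functions\<close>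

text \<open>Conditioning is handled by residuals: the members of a Gaussian space that are
  uncorrelated with \<xi> generate a sigma-algebra independent of \<xi>, and Fubini does the rest.
  Two points shape the proof. First, the derivatives of the paths are only pointwise limits of
  Gaussian variables. For Gaussian variables pointwise convergence forces convergence of means and
  covariances, so the limits stay Gaussian, and regression coefficients inherit continuity,
  Lipschitz bounds and derivatives in t from the paths. Second, the area formula near t_0 yields an
  integrand written with the regression on X(t_0), whereas the claim has the regression on X(t). For
  a bounded continuous weight F both expressions are continuous densities in v of the measure A ->
  E(F(Y(t)); X(t) in A), hence agree at every v, in particular at the level u; truncation removes
  the bound. The matrix C(t) is the identity at t_0 and is inverted only where it is within 1/2 of
  it. The resulting cover of T is cut into disjoint F-sigma pieces, because the area formula
  involves images of the pieces and continuous images of F-sigma sets are Borel.\<close>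

lemma weighted_char_unique:
  fixes V :: "'w \<Rightarrow> real" and V' :: "'v \<Rightarrow> real"
  assumes "prob_space M" "prob_space M'"
    and [measurable]: "q \<in> borel_measurable M" "V \<in> borel_measurable M"
      "q' \<in> borel_measurable M'" "V' \<in> borel_measurable M'"
    and q: "\<And>w. 0 \<le> q w" "\<And>w. q w \<le> c" and q': "\<And>w. 0 \<le> q' w" "\<And>w. q' w \<le> c"
    and eq: "\<And>\<theta>. (CLINT w|M. q w *\<^sub>R iexp (\<theta> * V w)) = (CLINT w|M'. q' w *\<^sub>R iexp (\<theta> * V' w))"
    and A[measurable]: "A \<in> sets borel"
  shows "(\<integral>w. q w * indicator A (V w) \<partial>M) = (\<integral>w. q' w * indicator A (V' w) \<partial>M')"
proof -
  interpret M: prob_space M by fact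
  interpret M': prob_space M' by fact
  have iq: "integrable M q" by (rule M.integrable_const_bound[where B=c]) (use q in auto)
  have iq': "integrable M' q'" by (rule M'.integrable_const_bound[where B=c]) (use q' in auto)
  \<comment> \<open>At \<theta> = 0 the hypothesis says that the two weights have the same total
    mass.\<close>
  have *: "(\<integral>w. complex_of_real (q w) \<partial>M) = (\<integral>w. complex_of_real (q' w) \<partial>M')"
    using eq[of 0] by (simp add: scaleR_conv_of_real)
  have z: "(\<integral>w. q w \<partial>M) = (\<integral>w. q' w \<partial>M')"
    using * by (simp add: integral_complex_of_real)
  define z where "z = (\<integral>w. q w \<partial>M)"
  have z0: "z \<ge> 0" unfolding z_def by (rule Bochner_Integration.integral_nonneg) (use q in auto)
  show ?thesis
  proof (cases "z = 0")
    case True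
    have "AE w in M. q w = 0" using integral_nonneg_eq_0_iff_AE[OF iq] q True by (simp add: z_def)
    then have "(\<integral>w. q w * indicator A (V w) \<partial>M) = 0"
      by (intro integral_eq_zero_AE) auto
    moreover have "AE w in M'. q' w = 0" using integral_nonneg_eq_0_iff_AE[OF iq'] q' True z by (simp add: z_def)
    then have "(\<integral>w. q' w * indicator A (V' w) \<partial>M') = 0"
      by (intro integral_eq_zero_AE) auto
    ultimately show ?thesis by simp
  next
    case False
    then have zp: "z > 0" using z0 by simp
    \<comment> \<open>Dividing the weights by their common mass turns the images under V and V' into
      probability laws on the line, to which Levy's uniqueness theorem applies.\<close>
    define D where "D = distr (density M (\<lambda>w. ennreal (q w / z))) borel V"
    define D' where "D' = distr (density M' (\<lambda>w. ennreal (q' w / z))) borel V'"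
    have p1: "prob_space (density M (\<lambda>w. ennreal (q w / z)))"
    proof
      have "(\<integral>\<^sup>+w. ennreal (q w / z) \<partial>M) = ennreal (\<integral>w. q w / z \<partial>M)"
        by (rule nn_integral_eq_integral) (use iq q zp in auto)
      also have "\<dots> = 1" using zp by (simp add: z_def)
      finally show "emeasure (density M (\<lambda>w. ennreal (q w / z))) (space (density M (\<lambda>w. ennreal (q w / z)))) = 1"
        by (subst emeasure_density) (auto cong: nn_integral_cong)
    qed
    have p1': "prob_space (density M' (\<lambda>w. ennreal (q' w / z)))"
    proof
      have "(\<integral>\<^sup>+w. ennreal (q' w / z) \<partial>M') = ennreal (\<integral>w. q' w / z \<partial>M')"
        by (rule nn_integral_eq_integral) (use iq' q' zp in auto)
      also have "\<dots> = 1" using zp z by (simp add: z_def)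
      finally show "emeasure (density M' (\<lambda>w. ennreal (q' w / z))) (space (density M' (\<lambda>w. ennreal (q' w / z)))) = 1"
        by (subst emeasure_density) (auto cong: nn_integral_cong)
    qed
    have rD: "real_distribution D" "real_distribution D'"
      unfolding D_def D'_def
      using prob_space.real_distribution_distr[OF p1, of V] prob_space.real_distribution_distr[OF p1', of V'] by auto
    have "char D \<theta> = char D' \<theta>" for \<theta>
    proof -
      have "char D \<theta> = (CLINT w|M. (q w / z) *\<^sub>R iexp (\<theta> * V w))"
        unfolding char_def D_def
        by (subst integral_distr, simp, simp, subst integral_density) (use q zp in auto)
      also have "\<dots> = (1/z) *\<^sub>R (CLINT w|M. q w *\<^sub>R iexp (\<theta> * V w))"
        by (subst integral_scaleR_right[symmetric]) simp
      also have "\<dots> = (1/z) *\<^sub>R (CLINT w|M'. q' w *\<^sub>R iexp (\<theta> * V' w))"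
        by (simp only: eq)
      also have "\<dots> = (CLINT w|M'. (q' w / z) *\<^sub>R iexp (\<theta> * V' w))"
        by (subst integral_scaleR_right[symmetric]) simp
      also have "\<dots> = char D' \<theta>"
        unfolding char_def D'_def
        by (subst integral_distr, simp, simp, subst integral_density) (use q' zp in auto)
      finally show ?thesis .
    qed
    then have DD: "D = D'" using Levy_uniqueness[OF rD] by auto
    have "measure D A = (\<integral>w. q w * indicator A (V w) \<partial>M) / z"
    proof -
      have "measure D A = (\<integral>x. indicator A x \<partial>D)" by (simp add: D_def)
      also have "\<dots> = (\<integral>w. (q w / z) *\<^sub>R indicator A (V w) \<partial>M)"
        unfolding D_def by (subst integral_distr, simp, simp, subst integral_density) (use q zp in auto)
      finally show ?thesis by (simp flip: integral_divide_zero)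
    qed
    moreover have "measure D' A = (\<integral>w. q' w * indicator A (V' w) \<partial>M') / z"
    proof -
      have "measure D' A = (\<integral>x. indicator A x \<partial>D')" by (simp add: D'_def)
      also have "\<dots> = (\<integral>w. (q' w / z) *\<^sub>R indicator A (V' w) \<partial>M')"
        unfolding D'_def by (subst integral_distr, simp, simp, subst integral_density) (use q' zp in auto)
      finally show ?thesis by (simp flip: integral_divide_zero)
    qed
    ultimately show ?thesis using DD zp by simp
  qed
qed

text \<open>Induction on J converts one exponential factor after another into an indicator. To
  convert the factor of V j, everything else is treated as a weight and
  \<open>weighted_char_unique\<close> is applied to V j alone. Weights must be nonnegative, so the
  remaining exponential exp(iS) is split into cosine and sine, each shifted by 1.\<close>

lemma char_determines_rectangles_aux:
  fixes V :: "'i \<Rightarrow> 'w \<Rightarrow> real" and V' :: "'i \<Rightarrow> 'v \<Rightarrow> real"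
  assumes M: "prob_space M" and M': "prob_space M'"
    and V[measurable]: "\<And>i. i \<in> L \<Longrightarrow> V i \<in> borel_measurable M"
    and V'[measurable]: "\<And>i. i \<in> L \<Longrightarrow> V' i \<in> borel_measurable M'"
    and eq: "\<And>K a. finite K \<Longrightarrow> K \<subseteq> L \<Longrightarrow>
       (CLINT w|M. iexp (\<Sum>i\<in>K. a i * V i w)) = (CLINT w|M'. iexp (\<Sum>i\<in>K. a i * V' i w))"
    and A: "\<And>i. A i \<in> sets borel"
    and J: "finite J" "J \<subseteq> L"
  shows "finite K \<Longrightarrow> K \<subseteq> L \<Longrightarrow> K \<inter> J = {} \<Longrightarrow>
     (CLINT w|M. (\<Prod>j\<in>J. indicator (A j) (V j w)) *\<^sub>R iexp (\<Sum>i\<in>K. a i * V i w)) =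
     (CLINT w|M'. (\<Prod>j\<in>J. indicator (A j) (V' j w)) *\<^sub>R iexp (\<Sum>i\<in>K. a i * V' i w))"
  using J
proof (induction J arbitrary: K a rule: finite_induct)
  case empty
  then show ?case using eq by simp
next
  case (insert j J)
  interpret M: prob_space M by fact
  interpret M': prob_space M' by fact
  note A[measurable]
  have jL: "j \<in> L" "J \<subseteq> L" "j \<notin> K" "K \<inter> J = {}" using insert.prems by auto
  have [measurable]: "V j \<in> borel_measurable M" "V' j \<in> borel_measurable M'" using jL V V' by auto
  define P where "P w = (\<Prod>j\<in>J. indicator (A j) (V j w) :: real)" for w
  define P' where "P' w = (\<Prod>j\<in>J. indicator (A j) (V' j w) :: real)" for w
  define S where "S w = (\<Sum>i\<in>K. a i * V i w)" for w
  define S' where "S' w = (\<Sum>i\<in>K. a i * V' i w)" for w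
  have [measurable]: "P \<in> borel_measurable M"
    unfolding P_def by (rule borel_measurable_prod) (use jL V in \<open>auto intro!: measurable_compose[OF _ borel_measurable_indicator[OF A]]\<close>)
  have [measurable]: "P' \<in> borel_measurable M'"
    unfolding P'_def by (rule borel_measurable_prod) (use jL V' in \<open>auto intro!: measurable_compose[OF _ borel_measurable_indicator[OF A]]\<close>)
  have [measurable]: "S \<in> borel_measurable M" "S' \<in> borel_measurable M'"
    unfolding S_def S'_def using insert.prems V V' by (auto intro!: borel_measurable_sum)
  have P01: "0 \<le> P w" "P w \<le> 1" "0 \<le> P' w'" "P' w' \<le> 1" for w w'
    unfolding P_def P'_def by (auto intro!: prod_nonneg prod_le_1)
  have IHe: "(CLINT w|M. P w *\<^sub>R iexp (s * S w + \<theta> * V j w)) = (CLINT w|M'. P' w *\<^sub>R iexp (s * S' w + \<theta> * V' j w))" for s \<theta>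
  proof -
    have e: "(\<Sum>i\<in>insert j K. (if i = j then \<theta> else s * a i) * V i w) = s * S w + \<theta> * V j w" for w
      using insert.prems(1) jL unfolding S_def
      by (subst sum.insert) (auto simp: sum_distrib_left algebra_simps intro!: sum.cong)
    have e': "(\<Sum>i\<in>insert j K. (if i = j then \<theta> else s * a i) * V' i w) = s * S' w + \<theta> * V' j w" for w
      using insert.prems(1) jL unfolding S'_def
      by (subst sum.insert) (auto simp: sum_distrib_left algebra_simps intro!: sum.cong)
    show ?thesis
      using insert.IH[of "insert j K" "\<lambda>i. if i = j then \<theta> else s * a i"] insert.prems insert.hyps jL
      unfolding e e' P_def[symmetric] P'_def[symmetric] by auto
  qed
  have int: "integrable M (\<lambda>w. P w *\<^sub>R iexp (s * S w + \<theta> * V j w))"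
            "integrable M' (\<lambda>w. P' w *\<^sub>R iexp (s * S' w + \<theta> * V' j w))" for s \<theta>
     using P01 by (auto intro!: M.integrable_const_bound[where B=1] M'.integrable_const_bound[where B=1])
  let ?I = "indicator (A j) :: real \<Rightarrow> real"
  \<comment> \<open>For f = cos or f = sin the weight P (1 + f(S)) lies between 0 and 2. Writing
    f(x) as a combination of exp(ix) and exp(-ix) expresses its characteristic integrals by the
    induction hypothesis with s = 0, 1 and -1.\<close>
  have key: "(\<integral>w. P w * (1 + f (S w)) * ?I (V j w) \<partial>M) = (\<integral>w. P' w * (1 + f (S' w)) * ?I (V' j w) \<partial>M')"
    if fm[measurable]: "f \<in> borel_measurable borel" and fb: "\<And>x. \<bar>f x\<bar> \<le> (1::real)"
     and fe: "\<And>x. of_real (f x) = c * iexp x + d * iexp (-x)" for f :: "real \<Rightarrow> real" and c d :: complex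
  proof (rule weighted_char_unique[OF M M', where c=2])
    have b: "0 \<le> 1 + f x" "1 + f x \<le> 2" for x using fb[of x] by linarith+
    show "0 \<le> P w * (1 + f (S w))" "0 \<le> P' w' * (1 + f (S' w'))" for w w' using P01 b by auto
    show "P w * (1 + f (S w)) \<le> 2" "P' w' * (1 + f (S' w')) \<le> 2" for w w'
      using mult_mono[OF P01(2)[of w] b(2)[of "S w"]] mult_mono[OF P01(4)[of w'] b(2)[of "S' w'"]] P01 b by auto
    fix \<theta>
    have "(CLINT w|M. (P w * (1 + f (S w))) *\<^sub>R iexp (\<theta> * V j w)) =
       (CLINT w|M. P w *\<^sub>R iexp (0 * S w + \<theta> * V j w) + c * (P w *\<^sub>R iexp (1 * S w + \<theta> * V j w))
           + d * (P w *\<^sub>R iexp ((-1) * S w + \<theta> * V j w)))"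
      by (rule Bochner_Integration.integral_cong[OF refl])
        (simp add: scaleR_conv_of_real fe algebra_simps exp_add exp_diff exp_minus divide_simps)
    also have "\<dots> = (CLINT w|M'. P' w *\<^sub>R iexp (0 * S' w + \<theta> * V' j w) + c * (P' w *\<^sub>R iexp (1 * S' w + \<theta> * V' j w))
           + d * (P' w *\<^sub>R iexp ((-1) * S' w + \<theta> * V' j w)))"
      by (subst (1 2) Bochner_Integration.integral_add, (intro integrable_mult_right Bochner_Integration.integrable_add int)+)
         (subst (1 2) Bochner_Integration.integral_add, (intro integrable_mult_right Bochner_Integration.integrable_add int)+,
          simp only: integral_mult_right_zero IHe)
    also have "\<dots> = (CLINT w|M'. (P' w * (1 + f (S' w))) *\<^sub>R iexp (\<theta> * V' j w))"
      by (rule Bochner_Integration.integral_cong[OF refl])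
        (simp add: scaleR_conv_of_real fe algebra_simps exp_add exp_diff exp_minus divide_simps)
    finally show "(CLINT w|M. (P w * (1 + f (S w))) *\<^sub>R iexp (\<theta> * V j w)) = \<dots>" .
  qed auto
  \<comment> \<open>The case f = 0 gives the contribution of the shift by 1, which is subtracted
    next.\<close>
  have k0: "(\<integral>w. P w * ?I (V j w) \<partial>M) = (\<integral>w. P' w * ?I (V' j w) \<partial>M')"
    using key[of "\<lambda>x. 0" 0 0] by simp
  have split: "(\<integral>w. P w * f (S w) * ?I (V j w) \<partial>M) = (\<integral>w. P' w * f (S' w) * ?I (V' j w) \<partial>M')"
    if fm[measurable]: "f \<in> borel_measurable borel" and fb: "\<And>x. \<bar>f x\<bar> \<le> (1::real)"
     and fe: "\<And>x. of_real (f x) = c * iexp x + d * iexp (-x)" for f :: "real \<Rightarrow> real" and c d :: complex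
  proof -
    have b: "\<bar>P w * f (S w) * ?I (V j w)\<bar> \<le> 1" "\<bar>P' w' * f (S' w') * ?I (V' j w')\<bar> \<le> 1" for w w'
      using mult_mono[of "\<bar>P w\<bar>" 1 "\<bar>f (S w)\<bar>" 1] mult_mono[of "\<bar>P' w'\<bar>" 1 "\<bar>f (S' w')\<bar>" 1]
        P01(1)[of w] P01(2)[of w] P01(3)[of w'] P01(4)[of w'] fb[of "S w"] fb[of "S' w'"]
      by (auto simp: abs_mult split: split_indicator)
    have i: "integrable M (\<lambda>w. P w * ?I (V j w))" "integrable M (\<lambda>w. P w * f (S w) * ?I (V j w))"
      "integrable M' (\<lambda>w. P' w * ?I (V' j w))" "integrable M' (\<lambda>w. P' w * f (S' w) * ?I (V' j w))"
      using P01 b by (auto intro!: M.integrable_const_bound[where B=1] M'.integrable_const_bound[where B=1] simp: abs_mult split: split_indicator)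
    show ?thesis using key[OF fm fb fe] k0 by (simp add: algebra_simps i[simplified algebra_simps])
  qed
  have C: "(\<integral>w. P w * cos (S w) * ?I (V j w) \<partial>M) = (\<integral>w. P' w * cos (S' w) * ?I (V' j w) \<partial>M')"
    by (rule split[of cos "1/2" "1/2"]) (auto simp: cos_of_real[symmetric] cos_exp_eq algebra_simps add_divide_distrib simp del: cos_of_real)
  have D: "(\<integral>w. P w * sin (S w) * ?I (V j w) \<partial>M) = (\<integral>w. P' w * sin (S' w) * ?I (V' j w) \<partial>M')"
    by (rule split[of sin "1/(2*\<i>)" "-1/(2*\<i>)"]) (auto simp: sin_of_real[symmetric] sin_exp_eq diff_divide_distrib algebra_simps simp del: sin_of_real)
  have b: "\<bar>P w * cos (S w) * ?I (V j w)\<bar> \<le> 1" "\<bar>P' w' * cos (S' w') * ?I (V' j w')\<bar> \<le> 1"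
     "\<bar>P w * sin (S w) * ?I (V j w)\<bar> \<le> 1" "\<bar>P' w' * sin (S' w') * ?I (V' j w')\<bar> \<le> 1" for w w'
    using mult_mono[of "\<bar>P w\<bar>" 1 "\<bar>cos (S w)\<bar>" 1] mult_mono[of "\<bar>P' w'\<bar>" 1 "\<bar>cos (S' w')\<bar>" 1]
      mult_mono[of "\<bar>P w\<bar>" 1 "\<bar>sin (S w)\<bar>" 1] mult_mono[of "\<bar>P' w'\<bar>" 1 "\<bar>sin (S' w')\<bar>" 1]
      P01(1)[of w] P01(2)[of w] P01(3)[of w'] P01(4)[of w']
    by (auto simp: abs_mult split: split_indicator)
  have i: "integrable M (\<lambda>w. P w * cos (S w) * ?I (V j w))" "integrable M (\<lambda>w. P w * sin (S w) * ?I (V j w))"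
      "integrable M' (\<lambda>w. P' w * cos (S' w) * ?I (V' j w))" "integrable M' (\<lambda>w. P' w * sin (S' w) * ?I (V' j w))"
      using b by (auto intro!: M.integrable_const_bound[where B=1] M'.integrable_const_bound[where B=1])
  have "(CLINT w|M. (?I (V j w) * P w) *\<^sub>R iexp (S w)) =
     (CLINT w|M. of_real (P w * cos (S w) * ?I (V j w)) + \<i> * of_real (P w * sin (S w) * ?I (V j w)))"
    by (rule Bochner_Integration.integral_cong[OF refl]) (simp add: exp_Euler cos_of_real sin_of_real scaleR_conv_of_real algebra_simps)
  also have "\<dots> = of_real (\<integral>w. P w * cos (S w) * ?I (V j w) \<partial>M) + \<i> * of_real (\<integral>w. P w * sin (S w) * ?I (V j w) \<partial>M)"
    by (subst Bochner_Integration.integral_add) (use i in \<open>auto simp del: of_real_mult\<close>)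
  also have "\<dots> = of_real (\<integral>w. P' w * cos (S' w) * ?I (V' j w) \<partial>M') + \<i> * of_real (\<integral>w. P' w * sin (S' w) * ?I (V' j w) \<partial>M')"
    by (simp only: C D)
  also have "\<dots> = (CLINT w|M'. of_real (P' w * cos (S' w) * ?I (V' j w)) + \<i> * of_real (P' w * sin (S' w) * ?I (V' j w)))"
    by (subst Bochner_Integration.integral_add) (use i in \<open>auto simp del: of_real_mult\<close>)
  also have "\<dots> = (CLINT w|M'. (?I (V' j w) * P' w) *\<^sub>R iexp (S' w))"
    by (rule Bochner_Integration.integral_cong[OF refl]) (simp add: exp_Euler cos_of_real sin_of_real scaleR_conv_of_real algebra_simps)
  finally show ?case
    unfolding prod.insert[OF insert.hyps] P_def P'_def S_def S'_def .
qed

lemma char_determines_rectangles: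
  fixes V :: "'i \<Rightarrow> 'w \<Rightarrow> real" and V' :: "'i \<Rightarrow> 'v \<Rightarrow> real"
  assumes M: "prob_space M" and M': "prob_space M'" and J: "finite J"
    and V[measurable]: "\<And>i. i \<in> J \<Longrightarrow> V i \<in> borel_measurable M"
    and V'[measurable]: "\<And>i. i \<in> J \<Longrightarrow> V' i \<in> borel_measurable M'"
    and eq: "\<And>a. (CLINT w|M. iexp (\<Sum>i\<in>J. a i * V i w)) = (CLINT w|M'. iexp (\<Sum>i\<in>J. a i * V' i w))"
    and A: "\<And>i. i \<in> J \<Longrightarrow> A i \<in> sets borel"
  shows "measure M {w\<in>space M. \<forall>i\<in>J. V i w \<in> A i} = measure M' {w\<in>space M'. \<forall>i\<in>J. V' i w \<in> A i}"
proof -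
  interpret M: prob_space M by fact
  interpret M': prob_space M' by fact
  have eqK: "(CLINT w|M. iexp (\<Sum>i\<in>K. a i * V i w)) = (CLINT w|M'. iexp (\<Sum>i\<in>K. a i * V' i w))" if "K \<subseteq> J" for K a
  proof -
    have *: "(\<Sum>i\<in>J. (if i \<in> K then a i else 0) * x i) = (\<Sum>i\<in>K. a i * x i)" for x
      using that J by (intro sum.mono_neutral_cong_right) auto
    show ?thesis using eq[of "\<lambda>i. if i \<in> K then a i else 0"] unfolding * .
  qed
  \<comment> \<open>Empty sets outside J make every member of the family Borel, as the auxiliary
    lemma demands of all indices.\<close>
  let ?A = "\<lambda>i. if i \<in> J then A i else {}"
  have m: "(CLINT w|M. (\<Prod>j\<in>J. indicator (?A j) (V j w)) *\<^sub>R iexp (\<Sum>i\<in>{}. 0 * V i w)) =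
     (CLINT w|M'. (\<Prod>j\<in>J. indicator (?A j) (V' j w)) *\<^sub>R iexp (\<Sum>i\<in>{}. 0 * V' i w))"
    by (rule char_determines_rectangles_aux[OF M M' V V', where L=J]) (use A J eqK in auto)
  have e: "(\<Prod>j\<in>J. indicator (?A j) (f j)) = (if \<forall>j\<in>J. f j \<in> A j then 1 else 0 :: real)" for f
    using J by (auto simp: indicator_def)
  have s: "{w\<in>space M. \<forall>i\<in>J. V i w \<in> A i} \<in> sets M" "{w\<in>space M'. \<forall>i\<in>J. V' i w \<in> A i} \<in> sets M'"
    using J A V V' by (auto intro!: sets.sets_Collect_finite_All' measurable_sets_Collect)
  have "(CLINT w|M. indicator {w\<in>space M. \<forall>i\<in>J. V i w \<in> A i} w *\<^sub>R 1) = (CLINT w|M'. indicator {w\<in>space M'. \<forall>i\<in>J. V' i w \<in> A i} w *\<^sub>R 1)"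
    using m unfolding e by (simp add: indicator_def of_bool_def cong: Bochner_Integration.integral_cong)
  then show ?thesis using s by (simp add: scaleR_conv_of_real)
qed

section \<open>Gaussian spaces\<close>

text \<open>The characteristic function is prescribed at 1 only; on a space closed under scaling
  this determines it everywhere. Constants are included, and in contrast to a condition on densities
  this form passes to limits.\<close>

definition gaussian_char :: "'w measure \<Rightarrow> ('w \<Rightarrow> real) \<Rightarrow> bool" where
  "gaussian_char M f \<longleftrightarrow> f \<in> borel_measurable M \<and> integrable M (\<lambda>w. (f w)\<^sup>2) \<and>
     (CLINT w|M. iexp (f w)) =
       exp (\<i> * of_real (\<integral>w. f w \<partial>M) - of_real ((\<integral>w. (f w - (\<integral>w. f w \<partial>M))\<^sup>2 \<partial>M) / 2))"

lemma gaussian_rv_imp_gaussian_char: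
  assumes "prob_space M" "gaussian_rv M X"
  shows "gaussian_char M X"
proof -
  interpret prob_space M by fact
  have Xm[measurable]: "X \<in> borel_measurable M" using assms by (auto simp: gaussian_rv_def)
  from assms(2) consider (c) m where "AE w in M. X w = m"
    | (n) m s where "0 < s" "distributed M lborel X (\<lambda>x. ennreal (normal_density m s x))"
    unfolding gaussian_rv_def by blast
  then show ?thesis
  proof cases
    case c
    have e: "expectation X = m" using integral_cong_AE[of X M "\<lambda>_. m"] c by (simp add: prob_space)
    have v: "variance X = 0" using integral_cong_AE[of "\<lambda>w. (X w - m)\<^sup>2" M "\<lambda>_. 0"] c
      unfolding e by simp
    have "integrable M (\<lambda>w. (X w)\<^sup>2) \<longleftrightarrow> integrable M (\<lambda>w. m\<^sup>2)"
      by (rule integrable_cong_AE) (use c in auto)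
    moreover have "(CLINT w|M. iexp (X w)) = (CLINT w|M. iexp m)"
      by (rule integral_cong_AE) (use c in auto)
    ultimately show ?thesis using e v by (simp add: gaussian_char_def prob_space)
  next
    case n
    have d: "distributed M lborel (\<lambda>w. (X w - m) / s) (\<lambda>x. ennreal (std_normal_density x))"
      using normal_standard_normal_convert[OF n(1)] n by simp
    then have D: "distr M lborel (\<lambda>w. (X w - m) / s) = std_normal_distribution"
      by (rule distributed_distr_eq_density)
    have D': "distr M borel (\<lambda>w. (X w - m) / s) = std_normal_distribution"
      using D by (simp cong: distr_cong)
    have "integrable lborel (\<lambda>x. normal_density m s x * (x - m)\<^sup>2 + 2 * m * (normal_density m s x * x) - m\<^sup>2 * normal_density m s x)"
      using n by (intro Bochner_Integration.integrable_diff Bochner_Integration.integrable_add integrable_mult_right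
        integrable_normal_moment integrable_normal_moment_nz_1 integrable_normal_density)
    then have "integrable lborel (\<lambda>x. normal_density m s x * x\<^sup>2)"
      by (simp add: power2_eq_square algebra_simps)
    then have i: "integrable M (\<lambda>w. (X w)\<^sup>2)"
      using distributed_integrable[OF n(2), of "\<lambda>x. x\<^sup>2"] normal_density_nonneg by simp
    have e: "expectation X = m" using normal_distributed_expectation[OF n(1,2)] .
    have v: "variance X = s\<^sup>2" using normal_distributed_variance[OF n(1,2)] .
    have "(CLINT w|M. iexp (X w)) = (CLINT w|M. iexp m * iexp (s * ((X w - m) / s)))"
    proof (intro Bochner_Integration.integral_cong refl)
      fix w
      have "X w = m + s * ((X w - m) / s)" using n by simp
      moreover have "iexp (m + y) = iexp m * iexp y" for y by (simp add: ring_distribs exp_add)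
      ultimately show "iexp (X w) = iexp m * iexp (s * ((X w - m) / s))" by metis
    qed
    also have "\<dots> = iexp m * (CLINT w|M. iexp (s * ((X w - m) / s)))"
      by simp
    also have "(CLINT w|M. iexp (s * ((X w - m) / s))) = char (distr M borel (\<lambda>w. (X w - m) / s)) s"
      unfolding char_def by (subst integral_distr) auto
    also have "\<dots> = exp (of_real (- s\<^sup>2 / 2))"
      unfolding D' char_std_normal_distribution by (rule exp_of_real[symmetric])
    also have "iexp m * exp (of_real (- s\<^sup>2 / 2)) = exp (\<i> * of_real m - of_real (s\<^sup>2 / 2))"
      unfolding mult_exp_exp by simp
    finally show ?thesis using i v unfolding gaussian_char_def e by simp
  qed
qed

lemma quadratic_form_discriminant:
  fixes a b c :: real
  assumes p: "\<And>s t. 0 \<le> a * s\<^sup>2 + 2 * b * s * t + c * t\<^sup>2"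
  shows "b\<^sup>2 \<le> a * c"
proof (cases "c = 0")
  case True
  have "b = 0"
  proof (rule ccontr)
    assume b: "b \<noteq> 0"
    \<comment> \<open>At s = 1 and this t the form takes the value a - (a + 1) = -1.\<close>
    have "2 * b * (- (a + 1) / (2 * b)) = - (a + 1)" using b by simp
    then show False using p[of 1 "- (a + 1) / (2 * b)"] True by simp
  qed
  then show ?thesis using True by simp
next
  case False
  have "c > 0" using p[of 0 1] False by simp
  moreover have "0 \<le> c * (a * c - b\<^sup>2)" using p[of c "- b"] by (simp add: power2_eq_square algebra_simps)
  ultimately show ?thesis by (simp add: zero_le_mult_iff)
qed

text \<open>Joint Gaussianity is encoded by linearity: every finite combination of members is again
  a member and hence Gaussian. Members are functions rather than classes, so that pointwise limits
  make sense.\<close>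

locale gaussian_space = prob_space M for M :: "'w measure" +
  fixes H :: "('w \<Rightarrow> real) set"
  assumes zero: "(\<lambda>w. 0) \<in> H"
    and add: "f \<in> H \<Longrightarrow> g \<in> H \<Longrightarrow> (\<lambda>w. f w + g w) \<in> H"
    and scale: "f \<in> H \<Longrightarrow> (\<lambda>w. c * f w) \<in> H"
    and gauss: "f \<in> H \<Longrightarrow> gaussian_char M f"
begin

lemma meas[measurable_dest]: "f \<in> H \<Longrightarrow> f \<in> borel_measurable M"
  and sq_integrable: "f \<in> H \<Longrightarrow> integrable M (\<lambda>w. (f w)\<^sup>2)"
  using gauss by (auto simp: gaussian_char_def)

lemma char_eq: "f \<in> H \<Longrightarrow> (CLINT w|M. iexp (f w)) = exp (\<i> * of_real (expectation f) - of_real (variance f / 2))"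
  using gauss by (auto simp: gaussian_char_def)

lemma integrable[simp]: "f \<in> H \<Longrightarrow> integrable M f"
  using square_integrable_imp_integrable meas sq_integrable by blast

lemma integrable_mult[simp]:
  assumes "f \<in> H" "g \<in> H" shows "integrable M (\<lambda>w. f w * g w)"
proof (rule Bochner_Integration.integrable_bound)
  show "integrable M (\<lambda>w. (f w)\<^sup>2 + (g w)\<^sup>2)" using assms sq_integrable by auto
  show "AE w in M. norm (f w * g w) \<le> norm ((f w)\<^sup>2 + (g w)\<^sup>2)"
  proof (rule AE_I2)
    fix w have "2 * (\<bar>f w\<bar> * \<bar>g w\<bar>) \<le> (f w)\<^sup>2 + (g w)\<^sup>2"
      using sum_squares_bound[of "\<bar>f w\<bar>" "\<bar>g w\<bar>"] by simp
    moreover have "\<bar>f w\<bar> * \<bar>g w\<bar> \<ge> 0" by simp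
    ultimately have "\<bar>f w\<bar> * \<bar>g w\<bar> \<le> (f w)\<^sup>2 + (g w)\<^sup>2" by linarith
    then show "norm (f w * g w) \<le> norm ((f w)\<^sup>2 + (g w)\<^sup>2)" by (simp add: abs_mult)
  qed
qed (use assms meas in \<open>auto intro: borel_measurable_times\<close>)

lemma diff: "f \<in> H \<Longrightarrow> g \<in> H \<Longrightarrow> (\<lambda>w. f w - g w) \<in> H"
  using add[OF _ scale[of g "-1"], of f] by simp

lemma sum: "(\<And>i. i \<in> S \<Longrightarrow> f i \<in> H) \<Longrightarrow> (\<lambda>w. \<Sum>i\<in>S. f i w) \<in> H"
  by (induction S rule: infinite_finite_induct) (auto intro: zero add)

definition cov :: "('w \<Rightarrow> real) \<Rightarrow> ('w \<Rightarrow> real) \<Rightarrow> real" where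
  "cov f g = expectation (\<lambda>w. (f w - expectation f) * (g w - expectation g))"

lemma variance_cov: "variance f = cov f f"
  by (simp add: cov_def power2_eq_square)

lemma cov_eq: assumes "f \<in> H" "g \<in> H"
  shows "cov f g = expectation (\<lambda>w. f w * g w) - expectation f * expectation g"
  using assms unfolding cov_def by (simp add: algebra_simps prob_space)

lemma cov_commute: "cov f g = cov g f"
  by (simp add: cov_def mult.commute)

lemma cov_add: "f \<in> H \<Longrightarrow> g \<in> H \<Longrightarrow> h \<in> H \<Longrightarrow> cov (\<lambda>w. f w + g w) h = cov f h + cov g h"
  by (simp add: cov_eq add algebra_simps)

lemma cov_scale: "f \<in> H \<Longrightarrow> h \<in> H \<Longrightarrow> cov (\<lambda>w. c * f w) h = c * cov f h"
  by (simp add: cov_eq scale algebra_simps)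

lemma cov_diff: "f \<in> H \<Longrightarrow> g \<in> H \<Longrightarrow> h \<in> H \<Longrightarrow> cov (\<lambda>w. f w - g w) h = cov f h - cov g h"
  by (simp add: cov_eq diff algebra_simps)

lemma cov_sum: "(\<And>i. i \<in> S \<Longrightarrow> f i \<in> H) \<Longrightarrow> h \<in> H \<Longrightarrow> cov (\<lambda>w. \<Sum>i\<in>S. f i w) h = (\<Sum>i\<in>S. cov (f i) h)"
proof (induction S rule: infinite_finite_induct)
  case (insert x F)
  then show ?case by (simp add: cov_add sum)
qed (auto simp: cov_eq zero)

lemma cov_nonneg: "0 \<le> cov f f"
  unfolding variance_cov[symmetric] by (rule variance_positive)

text \<open>Cauchy-Schwarz, from the nonnegative quadratic form E((s f + t g)^2) in s and t.\<close>

lemma expectation_mult_le: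
  assumes "f \<in> H" "g \<in> H"
  shows "\<bar>expectation (\<lambda>w. f w * g w)\<bar> \<le> sqrt (expectation (\<lambda>w. (f w)\<^sup>2)) * sqrt (expectation (\<lambda>w. (g w)\<^sup>2))"
proof -
  let ?a = "expectation (\<lambda>w. (f w)\<^sup>2)" and ?b = "expectation (\<lambda>w. f w * g w)" and ?c = "expectation (\<lambda>w. (g w)\<^sup>2)"
  have p: "0 \<le> ?a * s\<^sup>2 + 2 * ?b * s * t + ?c * t\<^sup>2" for s t
  proof -
    have "0 \<le> expectation (\<lambda>w. (s * f w + t * g w)\<^sup>2)" by (rule Bochner_Integration.integral_nonneg) auto
    also have "(\<lambda>w. (s * f w + t * g w)\<^sup>2) = (\<lambda>w. s\<^sup>2 * (f w)\<^sup>2 + 2 * s * t * (f w * g w) + t\<^sup>2 * (g w)\<^sup>2)"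
      by (auto simp: power2_eq_square algebra_simps)
    also have "expectation \<dots> = s\<^sup>2 * ?a + 2 * s * t * ?b + t\<^sup>2 * ?c"
      using assms sq_integrable by (simp add: integrable_mult)
    finally show ?thesis by (simp add: algebra_simps)
  qed
  then have "?b\<^sup>2 \<le> ?a * ?c" by (rule quadratic_form_discriminant)
  then have "sqrt (?b\<^sup>2) \<le> sqrt (?a * ?c)" by (rule real_sqrt_le_mono)
  then show ?thesis by (simp add: real_sqrt_mult)
qed

lemma second_moment_eq: "f \<in> H \<Longrightarrow> expectation (\<lambda>w. (f w)\<^sup>2) = cov f f + (expectation f)\<^sup>2"
  by (simp add: cov_eq power2_eq_square)

text \<open>For Gaussian variables pointwise convergence already implies convergence in L2. The
  characteristic function at 1 has modulus exp(-v/2) and tends to 1 by dominated convergence, so the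
  variances v tend to 0; the means are then controlled through the bounded variables min(1,
  |f|).\<close>

lemma second_moment_tendsto_0:
  assumes f: "\<And>n. f n \<in> H" and lim: "\<And>w. (\<lambda>n. f n w) \<longlonglongrightarrow> 0"
  shows "(\<lambda>n. expectation (\<lambda>w. (f n w)\<^sup>2)) \<longlonglongrightarrow> 0"
proof -
  note [measurable] = meas[OF f]
  define m v where "m n = expectation (f n)" and "v n = cov (f n) (f n)" for n
  have v0: "v n \<ge> 0" for n by (simp add: v_def cov_nonneg)
  have "(\<lambda>n. CLINT w|M. iexp (f n w)) \<longlonglongrightarrow> (CLINT w|M. iexp 0)"
  proof (rule integral_dominated_convergence[where w="\<lambda>_. 1"])
    show "AE w in M. (\<lambda>n. iexp (f n w)) \<longlonglongrightarrow> iexp 0"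
      using lim by (intro AE_I2 tendsto_intros)
  qed auto
  then have "(\<lambda>n. cmod (CLINT w|M. iexp (f n w))) \<longlonglongrightarrow> cmod 1"
    by (intro tendsto_norm) (simp add: prob_space)
  moreover have "cmod (CLINT w|M. iexp (f n w)) = exp (- v n / 2)" for n
    unfolding char_eq[OF f] variance_cov v_def by (simp)
  ultimately have "(\<lambda>n. exp (- v n / 2)) \<longlonglongrightarrow> 1" by simp
  then have "(\<lambda>n. ln (exp (- v n / 2))) \<longlonglongrightarrow> ln 1" by (intro tendsto_ln) auto
  then have "(\<lambda>n. (-2) * (- v n / 2)) \<longlonglongrightarrow> (-2) * 0" by (intro tendsto_mult_left) simp
  then have v: "v \<longlonglongrightarrow> 0" by simp
  have "(\<lambda>n. expectation (\<lambda>w. min 1 \<bar>f n w\<bar>)) \<longlonglongrightarrow> expectation (\<lambda>w. min 1 \<bar>0\<bar>)"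
  proof (rule integral_dominated_convergence[where w="\<lambda>_. 1"])
    show "AE w in M. (\<lambda>n. min 1 \<bar>f n w\<bar>) \<longlonglongrightarrow> min 1 \<bar>0\<bar>"
      using lim by (intro AE_I2 tendsto_intros)
  qed auto
  \<comment> \<open>From |m| <= |f| + |f - m|, where E|f - m| is at most the standard
    deviation.\<close>
  moreover have "min 1 \<bar>m n\<bar> \<le> expectation (\<lambda>w. min 1 \<bar>f n w\<bar>) + sqrt (v n)" for n
  proof -
    have "(expectation (\<lambda>w. \<bar>f n w - m n\<bar>))\<^sup>2 \<le> expectation (\<lambda>w. \<bar>f n w - m n\<bar>\<^sup>2)"
    proof -
      have "0 \<le> variance (\<lambda>w. \<bar>f n w - m n\<bar>)" by (rule variance_positive)
      also have "\<dots> = expectation (\<lambda>w. \<bar>f n w - m n\<bar>\<^sup>2) - (expectation (\<lambda>w. \<bar>f n w - m n\<bar>))\<^sup>2"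
        by (rule variance_eq) (use f sq_integrable[OF f] in \<open>auto simp: power2_diff\<close>)
      finally show ?thesis by simp
    qed
    then have le: "expectation (\<lambda>w. \<bar>f n w - m n\<bar>) \<le> sqrt (v n)"
      by (intro real_le_rsqrt) (simp add: v_def m_def variance_cov[symmetric])
    have "min 1 \<bar>m n\<bar> = expectation (\<lambda>w. min 1 \<bar>m n\<bar>)" by (simp add: prob_space)
    also have "\<dots> \<le> expectation (\<lambda>w. min 1 \<bar>f n w\<bar> + \<bar>f n w - m n\<bar>)"
      by (rule integral_mono) (use f in \<open>auto intro!: integrable_const_bound[where B=1] Bochner_Integration.integrable_add\<close>)
    also have "\<dots> = expectation (\<lambda>w. min 1 \<bar>f n w\<bar>) + expectation (\<lambda>w. \<bar>f n w - m n\<bar>)"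
      by (rule Bochner_Integration.integral_add) (use f in \<open>auto intro!: integrable_const_bound[where B=1]\<close>)
    finally show ?thesis using le by simp
  qed
  ultimately have "(\<lambda>n. min 1 \<bar>m n\<bar>) \<longlonglongrightarrow> 0"
    using tendsto_add[of "\<lambda>n. expectation (\<lambda>w. min 1 \<bar>f n w\<bar>)" 0 sequentially "\<lambda>n. sqrt (v n)" 0] tendsto_real_sqrt[OF v]
    by (intro tendsto_sandwich[of "\<lambda>_. 0" "\<lambda>n. min 1 \<bar>m n\<bar>" _ "\<lambda>n. expectation (\<lambda>w. min 1 \<bar>f n w\<bar>) + sqrt (v n)"]) auto
  \<comment> \<open>Once min(1, |m|) is below 1 the truncation has no effect.\<close>
  then have "eventually (\<lambda>n. min 1 \<bar>m n\<bar> < 1) sequentially" by (rule order_tendstoD) simp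
  then have "(\<lambda>n. \<bar>m n\<bar>) \<longlonglongrightarrow> 0"
    by (intro Lim_transform_eventually[OF \<open>(\<lambda>n. min 1 \<bar>m n\<bar>) \<longlonglongrightarrow> 0\<close>]) (auto elim!: eventually_mono)
  then have "m \<longlonglongrightarrow> 0" by (simp add: tendsto_rabs_zero_iff)
  then have "(\<lambda>n. v n + (m n)\<^sup>2) \<longlonglongrightarrow> 0 + 0\<^sup>2" using v by (intro tendsto_intros)
  then show ?thesis by (simp add: second_moment_eq f v_def m_def)
qed

text \<open>The derivatives of the paths lie here, as limits of difference quotients. A single
  pointwise limit of a sequence is taken, so this is the first sequential layer over H rather than a
  topologically closed set.\<close>

definition closure :: "('w \<Rightarrow> real) set" where
  "closure = {f. \<exists>g. (\<forall>n. g n \<in> H) \<and> (\<forall>w. (\<lambda>n. g n w) \<longlonglongrightarrow> f w)}"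

lemma subset_closure: "H \<subseteq> closure"
  by (force simp: closure_def)

text \<open>The sequence is Cauchy in L2 by \<open>second_moment_tendsto_0\<close> applied to
  differences, and Fatou identifies h as its L2 limit. So means and variances converge to those of
  h, while the characteristic functions converge by dominated convergence.\<close>

lemma limit_gaussian_char:
  assumes f: "\<And>n. f n \<in> H" and lim: "\<And>w. (\<lambda>n. f n w) \<longlonglongrightarrow> h w"
  shows "gaussian_char M h"
proof -
  note [measurable] = meas[OF f]
  have hm[measurable]: "h \<in> borel_measurable M"
    by (rule borel_measurable_LIMSEQ_metric[OF _ lim]) measurable
  \<comment> \<open>Indices a N and b N beyond N that violate the Cauchy condition would give
    differences in H that tend to 0 pointwise but not in L2.\<close>
  have cau: "\<exists>N. \<forall>n\<ge>N. \<forall>l\<ge>N. expectation (\<lambda>w. (f n w - f l w)\<^sup>2) < e" if "e > 0" for e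
  proof (rule ccontr)
    assume "\<not> ?thesis"
    then have "\<forall>N. \<exists>n l. n \<ge> N \<and> l \<ge> N \<and> expectation (\<lambda>w. (f n w - f l w)\<^sup>2) \<ge> e"
      by (simp add: not_less)
    then obtain a b where ab: "\<And>N. a N \<ge> N" "\<And>N. b N \<ge> N" "\<And>N. expectation (\<lambda>w. (f (a N) w - f (b N) w)\<^sup>2) \<ge> e"
      by metis
    have fa: "filterlim a at_top sequentially" "filterlim b at_top sequentially"
      using ab by (auto intro!: filterlim_at_top_mono[OF filterlim_ident])
    have "(\<lambda>N. expectation (\<lambda>w. (f (a N) w - f (b N) w)\<^sup>2)) \<longlonglongrightarrow> 0"
    proof (rule second_moment_tendsto_0[of "\<lambda>N w. f (a N) w - f (b N) w"])
      show "(\<lambda>w. f (a n) w - f (b n) w) \<in> H" for n using f diff by auto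
      fix w
      have "(\<lambda>n. f (a n) w - f (b n) w) \<longlonglongrightarrow> h w - h w"
        using filterlim_compose[OF lim fa(1)] filterlim_compose[OF lim fa(2)] by (intro tendsto_diff)
      then show "(\<lambda>n. f (a n) w - f (b n) w) \<longlonglongrightarrow> 0" by simp
    qed
    then have "eventually (\<lambda>N. expectation (\<lambda>w. (f (a N) w - f (b N) w)\<^sup>2) < e) sequentially"
      using that by (rule order_tendstoD(2))
    then obtain N where "expectation (\<lambda>w. (f (a N) w - f (b N) w)\<^sup>2) < e" by (meson eventually_happens sequentially_bot)
    with ab(3)[of N] show False by simp
  qed
  \<comment> \<open>Fatou in the second index of the Cauchy estimate.\<close>
  have nn: "\<exists>N. \<forall>n\<ge>N. (\<integral>\<^sup>+w. ennreal ((f n w - h w)\<^sup>2) \<partial>M) \<le> ennreal e" if e: "e > 0" for e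
  proof -
    obtain N where N: "\<And>n l. n \<ge> N \<Longrightarrow> l \<ge> N \<Longrightarrow> expectation (\<lambda>w. (f n w - f l w)\<^sup>2) < e" using cau[OF e] by blast
    have "(\<integral>\<^sup>+w. ennreal ((f n w - h w)\<^sup>2) \<partial>M) \<le> ennreal e" if "n \<ge> N" for n
    proof -
      have "(\<integral>\<^sup>+w. ennreal ((f n w - h w)\<^sup>2) \<partial>M) = (\<integral>\<^sup>+w. liminf (\<lambda>l. ennreal ((f n w - f l w)\<^sup>2)) \<partial>M)"
      proof (rule nn_integral_cong)
        fix w
        have "(\<lambda>l. ennreal ((f n w - f l w)\<^sup>2)) \<longlonglongrightarrow> ennreal ((f n w - h w)\<^sup>2)"
          using lim by (intro tendsto_intros)
        then show "ennreal ((f n w - h w)\<^sup>2) = liminf (\<lambda>l. ennreal ((f n w - f l w)\<^sup>2))"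
          by (rule lim_imp_Liminf[OF sequentially_bot, symmetric])
      qed
      also have "\<dots> \<le> liminf (\<lambda>l. \<integral>\<^sup>+w. ennreal ((f n w - f l w)\<^sup>2) \<partial>M)"
        by (rule nn_integral_liminf) measurable
      also have "\<dots> \<le> limsup (\<lambda>l. \<integral>\<^sup>+w. ennreal ((f n w - f l w)\<^sup>2) \<partial>M)"
        by (rule Liminf_le_Limsup) simp
      also have "\<dots> \<le> ennreal e"
      proof (rule Limsup_bounded)
        show "\<forall>\<^sub>F l in sequentially. (\<integral>\<^sup>+w. ennreal ((f n w - f l w)\<^sup>2) \<partial>M) \<le> ennreal e"
          using eventually_ge_at_top[of N]
        proof eventually_elim
          case (elim l)
          have "(\<integral>\<^sup>+w. ennreal ((f n w - f l w)\<^sup>2) \<partial>M) = ennreal (expectation (\<lambda>w. (f n w - f l w)\<^sup>2))"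
            using sq_integrable[OF diff[OF f f]] by (intro nn_integral_eq_integral) auto
          then show ?case using N[OF \<open>n \<ge> N\<close> elim] by (simp add: ennreal_leI)
        qed
      qed
      finally show ?thesis .
    qed
    then show ?thesis by blast
  qed
  obtain n0 where n0: "(\<integral>\<^sup>+w. ennreal ((f n0 w - h w)\<^sup>2) \<partial>M) \<le> ennreal 1" using nn[of 1] by auto
  have d2: "integrable M (\<lambda>w. (f n0 w - h w)\<^sup>2)"
    by (rule integrableI_bounded) (use n0 in \<open>auto intro: le_less_trans\<close>)
  have sqb: "(a - b)\<^sup>2 \<le> 2 * a\<^sup>2 + 2 * b\<^sup>2" for a b :: real
    using sum_squares_bound[of a "-b"] by (simp add: power2_diff)
  have h2: "integrable M (\<lambda>w. (h w)\<^sup>2)"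
  proof (rule Bochner_Integration.integrable_bound)
    show "integrable M (\<lambda>w. 2 * (f n0 w)\<^sup>2 + 2 * (f n0 w - h w)\<^sup>2)" using d2 sq_integrable[OF f] by simp
    show "AE w in M. norm ((h w)\<^sup>2) \<le> norm (2 * (f n0 w)\<^sup>2 + 2 * (f n0 w - h w)\<^sup>2)"
    proof (rule AE_I2)
      fix w show "norm ((h w)\<^sup>2) \<le> norm (2 * (f n0 w)\<^sup>2 + 2 * (f n0 w - h w)\<^sup>2)"
        using sqb[of "f n0 w" "f n0 w - h w"] by simp
    qed
  qed simp
  have h1: "integrable M h" using square_integrable_imp_integrable[OF hm h2] .
  have dint: "integrable M (\<lambda>w. (f n w - h w)\<^sup>2)" for n
  proof (rule Bochner_Integration.integrable_bound)
    show "integrable M (\<lambda>w. 2 * (f n w)\<^sup>2 + 2 * (h w)\<^sup>2)" using h2 sq_integrable[OF f] by simp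
    show "AE w in M. norm ((f n w - h w)\<^sup>2) \<le> norm (2 * (f n w)\<^sup>2 + 2 * (h w)\<^sup>2)"
      using sqb by (auto intro!: AE_I2)
  qed simp
  define d where "d n = expectation (\<lambda>w. (f n w - h w)\<^sup>2)" for n
  have d0: "d n \<ge> 0" for n unfolding d_def by (rule Bochner_Integration.integral_nonneg) auto
  have dl: "d \<longlonglongrightarrow> 0"
  proof (rule LIMSEQ_I)
    fix r :: real assume "r > 0"
    then obtain N where N: "\<And>n. n \<ge> N \<Longrightarrow> (\<integral>\<^sup>+w. ennreal ((f n w - h w)\<^sup>2) \<partial>M) \<le> ennreal (r/2)"
      using nn[of "r/2"] by auto
    have "norm (d n - 0) < r" if "n \<ge> N" for n
    proof -
      have "ennreal (d n) \<le> ennreal (r/2)"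
        using N[OF that] nn_integral_eq_integral[OF dint, of n] by (simp add: d_def)
      then show ?thesis using d0[of n] \<open>r > 0\<close> by simp
    qed
    then show "\<exists>N. \<forall>n\<ge>N. norm (d n - 0) < r" by blast
  qed
  have Eabs: "\<bar>expectation g\<bar>\<^sup>2 \<le> expectation (\<lambda>w. (g w)\<^sup>2)" if g: "g \<in> borel_measurable M" "integrable M (\<lambda>w. (g w)\<^sup>2)" for g :: "'w \<Rightarrow> real"
  proof -
    have "0 \<le> variance g" by (rule variance_positive)
    then show ?thesis using variance_eq[OF square_integrable_imp_integrable[OF g] g(2)] by simp
  qed
  have m: "(\<lambda>n. expectation (f n)) \<longlonglongrightarrow> expectation h"
  proof (rule LIM_zero_cancel)
    have le: "norm (expectation (f n) - expectation h) \<le> sqrt (d n)" for n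
      using Eabs[of "\<lambda>w. f n w - h w"] dint f h1 by (intro real_le_rsqrt) (simp add: d_def)
    have "(\<lambda>n. sqrt (d n)) \<longlonglongrightarrow> 0" using tendsto_real_sqrt[OF dl] by simp
    with always_eventually[OF allI[OF le]] show "(\<lambda>n. expectation (f n) - expectation h) \<longlonglongrightarrow> 0"
      by (rule Lim_null_comparison)
  qed
  have s: "(\<lambda>n. expectation (\<lambda>w. (f n w)\<^sup>2)) \<longlonglongrightarrow> expectation (\<lambda>w. (h w)\<^sup>2)"
  proof (rule LIM_zero_cancel)
    let ?K = "expectation (\<lambda>w. (h w)\<^sup>2)"
    have K0: "?K \<ge> 0" by (rule Bochner_Integration.integral_nonneg) auto
    \<comment> \<open>With x = f - h one has f^2 - h^2 = x^2 + 2 x h, and 2 |x| |h| <= x^2 / e + e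
      h^2. The weight e lets the second term be made small before n is chosen.\<close>
    have bd: "\<bar>expectation (\<lambda>w. (f n w)\<^sup>2) - ?K\<bar> \<le> (1 + 1/e) * d n + e * ?K" if e: "e > 0" for n e
    proof -
      have pt: "\<bar>(f n w)\<^sup>2 - (h w)\<^sup>2\<bar> \<le> (1 + 1/e) * (f n w - h w)\<^sup>2 + e * (h w)\<^sup>2" for w
      proof -
        let ?x = "f n w - h w" and ?y = "h w"
        have eq: "(f n w)\<^sup>2 - (h w)\<^sup>2 = ?x\<^sup>2 + 2 * ?x * ?y" by (simp add: power2_eq_square algebra_simps)
        have "2 * (\<bar>?x\<bar> / sqrt e) * (sqrt e * \<bar>?y\<bar>) \<le> (\<bar>?x\<bar> / sqrt e)\<^sup>2 + (sqrt e * \<bar>?y\<bar>)\<^sup>2"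
          by (rule sum_squares_bound)
        then have "2 * \<bar>?x\<bar> * \<bar>?y\<bar> \<le> (1/e) * ?x\<^sup>2 + e * ?y\<^sup>2" using e by (simp add: power_divide power_mult_distrib)
        then have "\<bar>2 * ?x * ?y\<bar> \<le> (1/e) * ?x\<^sup>2 + e * ?y\<^sup>2" by (simp only: abs_mult abs_numeral)
        moreover have "\<bar>?x\<^sup>2 + 2 * ?x * ?y\<bar> \<le> ?x\<^sup>2 + \<bar>2 * ?x * ?y\<bar>"
          using abs_triangle_ineq[of "?x\<^sup>2" "2 * ?x * ?y"] by simp
        moreover have "(1 + 1/e) * ?x\<^sup>2 = ?x\<^sup>2 + (1/e) * ?x\<^sup>2" by (simp only: distrib_right mult_1)
        ultimately show ?thesis unfolding eq by linarith
      qed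
      have "\<bar>expectation (\<lambda>w. (f n w)\<^sup>2) - ?K\<bar> = \<bar>expectation (\<lambda>w. (f n w)\<^sup>2 - (h w)\<^sup>2)\<bar>"
        using h2 sq_integrable[OF f] by simp
      also have "\<dots> \<le> expectation (\<lambda>w. \<bar>(f n w)\<^sup>2 - (h w)\<^sup>2\<bar>)" by (rule integral_abs_bound)
      also have "\<dots> \<le> expectation (\<lambda>w. (1 + 1/e) * (f n w - h w)\<^sup>2 + e * (h w)\<^sup>2)"
        by (rule integral_mono) (use pt h2 sq_integrable[OF f] dint in auto)
      also have "\<dots> = (1 + 1/e) * d n + e * ?K" using h2 dint by (simp add: d_def)
      finally show ?thesis .
    qed
    show "(\<lambda>n. expectation (\<lambda>w. (f n w)\<^sup>2) - ?K) \<longlonglongrightarrow> 0"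
    proof (rule LIMSEQ_I)
      fix r :: real assume r: "r > 0"
      \<comment> \<open>Chosen so that e times the second moment of h is at most r/2; the added 1
        keeps the denominator positive.\<close>
      define e where "e = r / (2 * (?K + 1))"
      have K1: "?K + 1 > 0" using K0 by (rule add_nonneg_pos) simp
      have e0: "e > 0" unfolding e_def using r K1 by (intro divide_pos_pos mult_pos_pos) auto
      have "e * ?K \<le> e * (?K + 1)" using e0 by simp
      also have "\<dots> = r / 2"
      proof -
        have "r / (2 * k) * k = r / 2" if "k > 0" for k :: real using that by simp
        from this[OF K1] show ?thesis unfolding e_def .
      qed
      finally have e: "e > 0" "e * ?K \<le> r / 2" using e0 by simp_all
      have "(\<lambda>n. (1 + 1/e) * d n) \<longlonglongrightarrow> (1 + 1/e) * 0" by (intro tendsto_intros dl)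
      then have "eventually (\<lambda>n. (1 + 1/e) * d n < r / 2) sequentially" using r by (intro order_tendstoD(2)) auto
      then obtain N where "\<And>n. n \<ge> N \<Longrightarrow> (1 + 1/e) * d n < r / 2" by (auto simp: eventually_sequentially)
      then show "\<exists>N. \<forall>n\<ge>N. norm (expectation (\<lambda>w. (f n w)\<^sup>2) - ?K - 0) < r"
      proof (intro exI[of _ N] allI impI)
        fix n assume "N \<le> n"
        then have "(1 + 1/e) * d n + e * ?K < r" using \<open>\<And>n. n \<ge> N \<Longrightarrow> (1 + 1/e) * d n < r / 2\<close>[of n] e(2) by linarith
        with bd[OF e(1), of n] show "norm (expectation (\<lambda>w. (f n w)\<^sup>2) - ?K - 0) < r" by simp
      qed
    qed
  qed
  have v: "(\<lambda>n. variance (f n)) \<longlonglongrightarrow> variance h"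
    unfolding variance_eq[OF integrable[OF f] sq_integrable[OF f]] variance_eq[OF h1 h2]
    by (intro tendsto_intros s m)
  have "(\<lambda>n. CLINT w|M. iexp (f n w)) \<longlonglongrightarrow> (CLINT w|M. iexp (h w))"
  proof (rule integral_dominated_convergence[where w="\<lambda>_. 1"])
    show "AE w in M. (\<lambda>n. iexp (f n w)) \<longlonglongrightarrow> iexp (h w)"
      using lim by (intro AE_I2 tendsto_intros)
  qed auto
  moreover have "(\<lambda>n. CLINT w|M. iexp (f n w)) \<longlonglongrightarrow> exp (\<i> * of_real (expectation h) - of_real (variance h / 2))"
    unfolding char_eq[OF f] by (intro tendsto_intros m v) auto
  ultimately have "(CLINT w|M. iexp (h w)) = exp (\<i> * of_real (expectation h) - of_real (variance h / 2))"
    by (rule LIMSEQ_unique)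
  then show ?thesis using h2 hm unfolding gaussian_char_def by simp
qed

lemma gaussian_space_closure: "gaussian_space M closure"
proof
  show "(\<lambda>w. 0) \<in> closure" using subset_closure zero by blast
next
  fix f g assume "f \<in> closure" "g \<in> closure"
  then obtain F G where "\<And>n. F n \<in> H" "\<And>w. (\<lambda>n. F n w) \<longlonglongrightarrow> f w" "\<And>n. G n \<in> H" "\<And>w. (\<lambda>n. G n w) \<longlonglongrightarrow> g w"
    unfolding closure_def by blast
  then show "(\<lambda>w. f w + g w) \<in> closure"
    unfolding closure_def by (auto intro!: exI[of _ "\<lambda>n w. F n w + G n w"] tendsto_add add)
next
  fix f c assume "f \<in> closure"
  then obtain F where "\<And>n. F n \<in> H" "\<And>w. (\<lambda>n. F n w) \<longlonglongrightarrow> f w"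
    unfolding closure_def by blast
  then show "(\<lambda>w. c * f w) \<in> closure"
    unfolding closure_def by (auto intro!: exI[of _ "\<lambda>n w. c * F n w"] tendsto_mult_left scale)
next
  fix f assume "f \<in> closure"
  then show "gaussian_char M f" unfolding closure_def by (auto intro: limit_gaussian_char)
qed

end

section \<open>Independence and regression\<close>

text \<open>An intersection-stable generator of the sigma-algebra of the variables in K, on which
  independence can be tested.\<close>

definition cylinders :: "'w measure \<Rightarrow> ('w \<Rightarrow> real) set \<Rightarrow> 'w set set" where
  "cylinders M K = {{w\<in>space M. \<forall>f\<in>J. f w \<in> A f} | J A. finite J \<and> J \<subseteq> K \<and> (\<forall>f\<in>J. A f \<in> sets borel)}"

definition gen_algebra :: "'w measure \<Rightarrow> ('w \<Rightarrow> real) set \<Rightarrow> 'w measure" where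
  "gen_algebra M K = sigma (space M) (cylinders M K)"

lemma cylinders_subset_Pow: "cylinders M K \<subseteq> Pow (space M)"
  by (auto simp: cylinders_def)

lemma space_gen_algebra[simp]: "space (gen_algebra M K) = space M"
  by (simp add: gen_algebra_def space_measure_of_conv)

lemma sets_gen_algebra: "sets (gen_algebra M K) = sigma_sets (space M) (cylinders M K)"
  by (simp add: gen_algebra_def cylinders_subset_Pow)

lemma measurable_gen_algebra:
  assumes "f \<in> K" shows "f \<in> borel_measurable (gen_algebra M K)"
proof (rule measurableI)
  fix A :: "real set" assume "A \<in> sets borel"
  then have "{w\<in>space M. \<forall>g\<in>{f}. g w \<in> A} \<in> cylinders M K"
    unfolding cylinders_def using assms by (auto intro!: exI[of _ "{f}"] exI[of _ "\<lambda>_. A"])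
  moreover have "f -` A \<inter> space (gen_algebra M K) = {w\<in>space M. \<forall>g\<in>{f}. g w \<in> A}" by auto
  ultimately show "f -` A \<inter> space (gen_algebra M K) \<in> sets (gen_algebra M K)"
    unfolding sets_gen_algebra by auto
qed simp

lemma Int_stable_cylinders: "Int_stable (cylinders M K)"
proof (rule Int_stableI)
  fix a b assume "a \<in> cylinders M K" "b \<in> cylinders M K"
  then obtain J A L B where J: "finite J" "J \<subseteq> K" "\<forall>f\<in>J. A f \<in> sets borel" "a = {w\<in>space M. \<forall>f\<in>J. f w \<in> A f}"
    and L: "finite L" "L \<subseteq> K" "\<forall>f\<in>L. B f \<in> sets borel" "b = {w\<in>space M. \<forall>f\<in>L. f w \<in> B f}"
    unfolding cylinders_def by blast
  define C where "C f = (if f \<in> J then A f else UNIV) \<inter> (if f \<in> L then B f else UNIV)" for f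
  have "a \<inter> b = {w\<in>space M. \<forall>f\<in>J \<union> L. f w \<in> C f}" unfolding J(4) L(4) C_def by auto
  moreover have "\<forall>f\<in>J \<union> L. C f \<in> sets borel" using J(3) L(3) by (auto simp: C_def)
  ultimately show "a \<inter> b \<in> cylinders M K" unfolding cylinders_def using J L
    by (intro CollectI exI[of _ "J \<union> L"] exI[of _ C]) auto
qed

lemma cylinders_events:
  assumes "\<And>f. f \<in> K \<Longrightarrow> f \<in> borel_measurable M" shows "cylinders M K \<subseteq> sets M"
proof
  fix a assume "a \<in> cylinders M K"
  then obtain J A where J: "finite J" "J \<subseteq> K" "\<forall>f\<in>J. A f \<in> sets borel" "a = {w\<in>space M. \<forall>f\<in>J. f w \<in> A f}"
    unfolding cylinders_def by blast
  show "a \<in> sets M" unfolding J(4)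
  proof (cases "J = {}")
    case False
    have "{w\<in>space M. f w \<in> A f} \<in> sets M" if "f \<in> J" for f
      using that J(2,3) assms[of f] measurable_sets_Collect[of f M borel "\<lambda>x. x \<in> A f"] by auto
    then show "{w\<in>space M. \<forall>f\<in>J. f w \<in> A f} \<in> sets M"
      using \<open>finite J\<close> False by (rule sets.sets_Collect_finite_All')
  qed simp
qed

lemma subalgebra_gen_algebra:
  assumes "\<And>f. f \<in> K \<Longrightarrow> f \<in> borel_measurable M" shows "subalgebra M (gen_algebra M K)"
  unfolding subalgebra_def sets_gen_algebra using sets.sigma_sets_subset[OF cylinders_events[OF assms]] by simp

lemma borel_measurable_inner_BasisI:
  fixes X :: "'w \<Rightarrow> 'a::euclidean_space"
  assumes "\<And>b. b \<in> Basis \<Longrightarrow> (\<lambda>w. b \<bullet> X w) \<in> borel_measurable N"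
  shows "X \<in> borel_measurable N"
  unfolding borel_measurable_euclidean_space[of X] using assms by (auto simp only: inner_commute[of "X w" for w])

lemma (in prob_space) char_product:
  fixes U W :: "'a \<Rightarrow> real"
  assumes [measurable]: "U \<in> borel_measurable M" "W \<in> borel_measurable M"
  shows "(CLINT z|M \<Otimes>\<^sub>M M. iexp (U (fst z) + W (snd z))) = (CLINT w|M. iexp (U w)) * (CLINT w|M. iexp (W w))"
proof -
  interpret P: pair_prob_space M M ..
  have "integrable (M \<Otimes>\<^sub>M M) (\<lambda>z. iexp (U (fst z) + W (snd z)))"
    by (rule P.integrable_const_bound[where B=1]) auto
  then have "(CLINT z|M \<Otimes>\<^sub>M M. iexp (U (fst z) + W (snd z))) = (CLINT x|M. CLINT y|M. iexp (U x + W y))"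
    by (subst P.integral_fst'[symmetric]) auto
  also have "\<dots> = (CLINT x|M. CLINT y|M. iexp (U x) * iexp (W y))"
    by (simp add: ring_distribs exp_add)
  also have "\<dots> = (CLINT w|M. iexp (U w)) * (CLINT w|M. iexp (W w))" by simp
  finally show ?thesis .
qed

context gaussian_space begin

text \<open>Uncorrelated and jointly Gaussian implies independent. The model for independence is the
  product of M with itself, where variables from K are read on the first factor and those from L on
  the second. Since variances of uncorrelated combinations add, both settings have the same
  characteristic functions, hence give the same probabilities to rectangles.\<close>

lemma indep_cylinders:
  assumes K: "K \<subseteq> H" "L \<subseteq> H" and c: "\<And>f g. f \<in> K \<Longrightarrow> g \<in> L \<Longrightarrow> cov f g = 0"
  shows "indep_set (cylinders M K) (cylinders M L)"
proof (rule indep_setI)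
  show "cylinders M K \<subseteq> events" "cylinders M L \<subseteq> events"
    using K meas by (auto intro!: cylinders_events)
  fix a b assume "a \<in> cylinders M K" "b \<in> cylinders M L"
  then obtain J A J' B where J: "finite J" "J \<subseteq> K" "\<forall>f\<in>J. A f \<in> sets borel" "a = {w\<in>space M. \<forall>f\<in>J. f w \<in> A f}"
    and J': "finite J'" "J' \<subseteq> L" "\<forall>f\<in>J'. B f \<in> sets borel" "b = {w\<in>space M. \<forall>f\<in>J'. f w \<in> B f}"
    unfolding cylinders_def by blast
  have Jm: "f \<in> J \<Longrightarrow> f \<in> borel_measurable M" "f \<in> J' \<Longrightarrow> f \<in> borel_measurable M" for f
    using J J' K meas by auto
  interpret P: pair_prob_space M M ..
  have P: "prob_space (M \<Otimes>\<^sub>M M)" by unfold_locales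
  \<comment> \<open>Indexing by a disjoint sum gives a variable that occurs in both J and J' two
    separate indices.\<close>
  let ?V = "case_sum (\<lambda>f w. f w) (\<lambda>f w. f w) :: _ \<Rightarrow> 'w \<Rightarrow> real"
  let ?V' = "case_sum (\<lambda>f z. f (fst z)) (\<lambda>f z. f (snd z)) :: _ \<Rightarrow> 'w \<times> 'w \<Rightarrow> real"
  let ?J = "J <+> J'" and ?A = "case_sum A B"
  have s: "(\<Sum>i\<in>?J. g i) = (\<Sum>f\<in>J. g (Inl f)) + (\<Sum>f\<in>J'. g (Inr f))" for g :: "_ \<Rightarrow> real"
    using J(1) J'(1) by (simp add: sum.Plus)
  have "measure M {w\<in>space M. \<forall>i\<in>?J. ?V i w \<in> ?A i} = measure (M \<Otimes>\<^sub>M M) {w\<in>space (M \<Otimes>\<^sub>M M). \<forall>i\<in>?J. ?V' i w \<in> ?A i}"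
  proof (rule char_determines_rectangles[OF prob_space_axioms P])
    show "finite ?J" using J J' by auto
    show "?V i \<in> borel_measurable M" if "i \<in> ?J" for i using that Jm by auto
    show "?V' i \<in> borel_measurable (M \<Otimes>\<^sub>M M)" if "i \<in> ?J" for i
      using that Jm by (auto intro: measurable_compose[OF measurable_fst] measurable_compose[OF measurable_snd])
    show "?A i \<in> sets borel" if "i \<in> ?J" for i using that J J' by auto
    fix x :: "('w \<Rightarrow> real) + ('w \<Rightarrow> real) \<Rightarrow> real"
    define U where "U w = (\<Sum>f\<in>J. x (Inl f) * f w)" for w
    define W where "W w = (\<Sum>f\<in>J'. x (Inr f) * f w)" for w
    have U: "U \<in> H" unfolding U_def using J K by (intro sum scale) auto
    have W: "W \<in> H" unfolding W_def using J' K by (intro sum scale) auto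
    have "cov U W = (\<Sum>f\<in>J. x (Inl f) * cov f W)"
      unfolding U_def using J K W by (subst cov_sum) (auto intro!: scale sum.cong cov_scale)
    moreover have "cov f W = 0" if "f \<in> J" for f
    proof -
      have "cov W f = (\<Sum>g\<in>J'. x (Inr g) * cov g f)"
        unfolding W_def using J' K J that by (subst cov_sum) (auto intro!: scale sum.cong cov_scale)
      also have "\<dots> = 0" using c[of f] J J' that by (intro sum.neutral) (auto simp: cov_commute)
      finally show ?thesis by (simp add: cov_commute)
    qed
    ultimately have UW: "cov U W = 0" by simp
    let ?S = "\<lambda>w. U w + W w"
    have "cov ?S ?S = cov U ?S + cov W ?S" by (rule cov_add[OF U W add[OF U W]])
    also have "cov U ?S = cov U U + cov W U" by (subst cov_commute) (rule cov_add[OF U W U])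
    also have "cov W ?S = cov U W + cov W W" by (subst cov_commute) (rule cov_add[OF U W W])
    also have "cov W U = 0" by (subst cov_commute) (rule UW)
    finally have "cov ?S ?S = cov U U + cov W W" using UW by simp
    then have v: "variance (\<lambda>w. U w + W w) = variance U + variance W" by (simp only: variance_cov)
    have "(CLINT w|M. iexp (\<Sum>i\<in>?J. x i * ?V i w)) = (CLINT w|M. iexp (U w + W w))"
      by (simp add: s U_def W_def)
    also have "\<dots> = (CLINT w|M. iexp (U w)) * (CLINT w|M. iexp (W w))"
    proof -
      have e: "expectation (\<lambda>w. U w + W w) = expectation U + expectation W" using U W by simp
      show ?thesis unfolding char_eq[OF add[OF U W]] char_eq[OF U] char_eq[OF W] v mult_exp_exp
        unfolding e of_real_add add_divide_distrib by (rule arg_cong[where f=exp]) (simp only: ring_distribs diff_conv_add_uminus minus_add_distrib ac_simps)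
    qed
    also have "\<dots> = (CLINT z|M \<Otimes>\<^sub>M M. iexp (U (fst z) + W (snd z)))"
      by (rule char_product[OF meas[OF U] meas[OF W], symmetric])
    also have "\<dots> = (CLINT w|M \<Otimes>\<^sub>M M. iexp (\<Sum>i\<in>?J. x i * ?V' i w))"
      by (simp add: s U_def W_def)
    finally show "(CLINT w|M. iexp (\<Sum>i\<in>?J. x i * ?V i w)) = \<dots>" .
  qed
  also have "{w\<in>space M. \<forall>i\<in>?J. ?V i w \<in> ?A i} = a \<inter> b" unfolding J(4) J'(4) Plus_def ball_Un by auto
  also have "{w\<in>space (M \<Otimes>\<^sub>M M). \<forall>i\<in>?J. ?V' i w \<in> ?A i} = a \<times> b"
    unfolding J(4) J'(4) Plus_def ball_Un by (auto simp: space_pair_measure)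
  also have "measure (M \<Otimes>\<^sub>M M) (a \<times> b) = prob a * prob b"
    using \<open>cylinders M K \<subseteq> events\<close> \<open>cylinders M L \<subseteq> events\<close> \<open>a \<in> _\<close> \<open>b \<in> _\<close>
    by (subst measure_def, subst emeasure_pair_measure_Times)
      (auto simp: emeasure_eq_measure enn2real_mult)
  finally show "prob (a \<inter> b) = prob a * prob b" .
qed

text \<open>The second argument of \<Psi> is the whole sample point, but seen only through the
  sigma-algebra generated by K. In this way \<Psi> may depend on infinitely many residuals at once.
  By independence the law of w -> (\<xi> w, w) is the product of the law of \<xi> with the
  restriction N of M to that sigma-algebra.\<close>

lemma nn_integral_indep:
  fixes \<xi> :: "'w \<Rightarrow> 'a::euclidean_space"
  assumes \<xi>: "\<And>b. b \<in> Basis \<Longrightarrow> (\<lambda>w. \<xi> w \<bullet> b) \<in> H" and K: "K \<subseteq> H"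
    and c: "\<And>b g. b \<in> Basis \<Longrightarrow> g \<in> K \<Longrightarrow> cov (\<lambda>w. \<xi> w \<bullet> b) g = 0"
    and \<Psi>[measurable]: "\<Psi> \<in> borel_measurable (borel \<Otimes>\<^sub>M gen_algebra M K)"
  shows "(\<integral>\<^sup>+w. \<Psi> (\<xi> w, w) \<partial>M) = (\<integral>\<^sup>+w. \<integral>\<^sup>+w'. \<Psi> (\<xi> w', w) \<partial>M \<partial>M)"
proof -
  let ?L = "(\<lambda>b w. \<xi> w \<bullet> b) ` Basis"
  let ?G = "gen_algebra M K"
  have sub: "subalgebra M ?G" using K meas by (intro subalgebra_gen_algebra) auto
  have subL: "subalgebra M (gen_algebra M ?L)" using \<xi> meas by (intro subalgebra_gen_algebra) auto
  define N where "N = restr_to_subalg M ?G"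
  have sN: "sets N = sets ?G" "space N = space M" unfolding N_def by (simp_all add: sets_restr_to_subalg[OF sub] space_restr_to_subalg)
  have \<xi>L: "\<xi> \<in> borel_measurable (gen_algebra M ?L)"
    by (subst borel_measurable_euclidean_space) (auto intro: measurable_gen_algebra)
  have \<xi>m[measurable]: "\<xi> \<in> borel_measurable M" using measurable_from_subalg[OF subL \<xi>L] .
  have ind: "indep_set (sigma_sets (space M) (cylinders M ?L)) (sigma_sets (space M) (cylinders M K))"
    by (intro indep_set_sigma_sets indep_cylinders Int_stable_cylinders) (use \<xi> K c in auto)
  have idm: "(\<lambda>w. w) \<in> M \<rightarrow>\<^sub>M N" using sub sN unfolding subalgebra_def by (auto intro!: measurableI)
  have pm[measurable]: "(\<lambda>w. (\<xi> w, w)) \<in> M \<rightarrow>\<^sub>M borel \<Otimes>\<^sub>M N" using idm by measurable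
  define D where "D = distr M borel \<xi>"
  interpret N: prob_space N unfolding N_def by (rule prob_space_restr_to_subalg[OF sub prob_space_axioms])
  interpret D: prob_space D unfolding D_def by (rule prob_space_distr) simp
  interpret DN: pair_prob_space D N ..
  have sD: "sets D = sets borel" by (simp add: D_def)
  have \<Psi>N[measurable]: "\<Psi> \<in> borel_measurable (borel \<Otimes>\<^sub>M N)"
    using \<Psi> sN by (simp cong: measurable_cong_sets sets_pair_measure_cong)
  have DNeq: "D \<Otimes>\<^sub>M N = distr M (borel \<Otimes>\<^sub>M N) (\<lambda>w. (\<xi> w, w))"
  proof (rule pair_measure_eqI)
    show "sigma_finite_measure D" "sigma_finite_measure N" by unfold_locales
    show "sets (D \<Otimes>\<^sub>M N) = sets (distr M (borel \<Otimes>\<^sub>M N) (\<lambda>w. (\<xi> w, w)))"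
      using sD by (simp cong: sets_pair_measure_cong)
    fix A B assume A: "A \<in> sets D" and B: "B \<in> sets N"
    have A': "A \<in> sets borel" using A sD by simp
    have BM: "B \<in> events" using B sub sN unfolding subalgebra_def by auto
    have "\<xi> -` A \<inter> space M \<in> sigma_sets (space M) (cylinders M ?L)"
      using measurable_sets[OF \<xi>L A'] by (simp add: sets_gen_algebra)
    then have "prob ((\<xi> -` A \<inter> space M) \<inter> B) = prob (\<xi> -` A \<inter> space M) * prob B"
      using B sN by (intro indep_setD[OF ind]) (auto simp: sets_gen_algebra)
    moreover have "(\<lambda>w. (\<xi> w, w)) -` (A \<times> B) \<inter> space M = (\<xi> -` A \<inter> space M) \<inter> B"
      using sets.sets_into_space[OF BM] by auto
    moreover have "A \<times> B \<in> sets (borel \<Otimes>\<^sub>M N)" using A' B by auto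
    moreover have "emeasure N B = emeasure M B"
      unfolding N_def using B sN by (intro emeasure_restr_to_subalg[OF sub]) auto
    ultimately show "emeasure D A * emeasure N B = emeasure (distr M (borel \<Otimes>\<^sub>M N) (\<lambda>w. (\<xi> w, w))) (A \<times> B)"
      unfolding D_def using A' by (simp add: emeasure_distr emeasure_eq_measure ennreal_mult)
  qed
  have "(\<integral>\<^sup>+w. \<Psi> (\<xi> w, w) \<partial>M) = (\<integral>\<^sup>+z. \<Psi> z \<partial>distr M (borel \<Otimes>\<^sub>M N) (\<lambda>w. (\<xi> w, w)))"
    by (subst nn_integral_distr) auto
  also have "\<dots> = (\<integral>\<^sup>+z. \<Psi> z \<partial>(D \<Otimes>\<^sub>M N))" by (simp add: DNeq)
  also have "\<dots> = (\<integral>\<^sup>+w. \<integral>\<^sup>+x. \<Psi> (x, w) \<partial>D \<partial>N)"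
    by (subst DN.nn_integral_snd[symmetric]) (use \<Psi>N sD in \<open>auto cong: measurable_cong_sets sets_pair_measure_cong\<close>)
  also have "\<dots> = (\<integral>\<^sup>+w. \<integral>\<^sup>+x. \<Psi> (x, w) \<partial>D \<partial>M)"
    unfolding N_def
  proof (rule nn_integral_subalgebra2[OF sub])
    have "(\<lambda>w. \<integral>\<^sup>+x. \<Psi> (x, w) \<partial>D) \<in> borel_measurable N"
      by (rule D.borel_measurable_nn_integral) (use \<Psi>N sD in \<open>auto cong: measurable_cong_sets sets_pair_measure_cong\<close>)
    then show "(\<lambda>w. \<integral>\<^sup>+x. \<Psi> (x, w) \<partial>D) \<in> borel_measurable ?G" using sN by (simp cong: measurable_cong_sets)
  qed
  also have "\<dots> = (\<integral>\<^sup>+w. \<integral>\<^sup>+w'. \<Psi> (\<xi> w', w) \<partial>M \<partial>M)"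
  proof (rule nn_integral_cong)
    fix w assume "w \<in> space M"
    then have w: "w \<in> space N" by (simp add: sN)
    have "(\<lambda>x. \<Psi> (x, w)) \<in> borel_measurable borel"
      by (rule measurable_compose[OF measurable_Pair2'[OF w] \<Psi>N])
    then have "(\<lambda>x. \<Psi> (x, w)) \<in> borel_measurable (distr M borel \<xi>)" by (simp only: measurable_distr_eq1)
    with nn_integral_distr[where f="\<lambda>x. \<Psi> (x, w)", OF \<xi>m] show "(\<integral>\<^sup>+x. \<Psi> (x, w) \<partial>D) = (\<integral>\<^sup>+w'. \<Psi> (\<xi> w', w) \<partial>M)"
      unfolding D_def by blast
  qed
  finally show ?thesis .
qed

definition gvec :: "('w \<Rightarrow> 'a::euclidean_space) \<Rightarrow> bool" where
  "gvec X \<longleftrightarrow> (\<forall>a. (\<lambda>w. a \<bullet> X w) \<in> H)"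

lemma gvecD: "gvec X \<Longrightarrow> (\<lambda>w. a \<bullet> X w) \<in> H"
  by (simp add: gvec_def)

lemma gvec_measurable: "gvec X \<Longrightarrow> X \<in> borel_measurable M"
  by (rule borel_measurable_inner_BasisI) (auto intro: meas gvecD)

lemma gvec_linear:
  assumes "gvec X" "linear f" shows "gvec (\<lambda>w. f (X w))"
  unfolding gvec_def
proof
  fix a
  have "a \<bullet> f (X w) = adjoint f a \<bullet> X w" for w
    using adjoint_works[OF assms(2), of "X w" a] by (simp only: inner_commute[of "X w"] inner_commute[of _ a])
  then show "(\<lambda>w. a \<bullet> f (X w)) \<in> H" using gvecD[OF assms(1)] by simp
qed

lemma gvec_diff: "gvec X \<Longrightarrow> gvec Y \<Longrightarrow> gvec (\<lambda>w. X w - Y w)"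
  by (auto simp: gvec_def inner_diff_right intro: diff)

lemma integrable_componentwise:
  assumes "\<And>b. b \<in> Basis \<Longrightarrow> integrable M (\<lambda>w. b \<bullet> X w)"
  shows "integrable M (X :: 'w \<Rightarrow> 'a::euclidean_space)"
proof -
  have "integrable M (\<lambda>w. \<Sum>b\<in>Basis. (b \<bullet> X w) *\<^sub>R b)" using assms by (intro Bochner_Integration.integrable_sum) auto
  then show ?thesis by (simp only: inner_commute[of _ "X w" for w] euclidean_representation)
qed

lemma gvec_integrable: "gvec X \<Longrightarrow> integrable M X"
  by (rule integrable_componentwise) (simp add: gvecD)

lemma expectation_inner: "gvec X \<Longrightarrow> expectation (\<lambda>w. a \<bullet> X w) = a \<bullet> integral\<^sup>L M X"
  using gvec_integrable by (intro integral_inner_right) auto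

lemma covariance_map_eq:
  assumes X: "gvec X" and Y: "gvec Y"
  shows "covariance_map M X Y a = (\<integral>w. (a \<bullet> (X w - integral\<^sup>L M X)) *\<^sub>R (Y w - integral\<^sup>L M Y) \<partial>M)"
  unfolding covariance_map_def Let_def using gvec_measurable[OF X] gvec_measurable[OF Y]
  by (simp add: integral_completion)

lemma integrable_centered_mult:
  assumes "f \<in> H" "g \<in> H" shows "integrable M (\<lambda>w. (f w - c) * (g w - d))"
proof -
  have "integrable M (\<lambda>w. f w * g w - c * g w - d * f w + c * d)" using assms by simp
  moreover have "(\<lambda>w. f w * g w - c * g w - d * f w + c * d) = (\<lambda>w. (f w - c) * (g w - d))"
    by (rule ext) (simp add: algebra_simps)
  ultimately show ?thesis by simp
qed

lemma covariance_map_inner: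
  assumes X: "gvec X" and Y: "gvec Y"
  shows "b \<bullet> covariance_map M X Y a = cov (\<lambda>w. a \<bullet> X w) (\<lambda>w. b \<bullet> Y w)"
proof -
  let ?f = "\<lambda>w. (a \<bullet> (X w - integral\<^sup>L M X)) *\<^sub>R (Y w - integral\<^sup>L M Y)"
  have i: "integrable M (\<lambda>w. b \<bullet> ?f w)" for b
    unfolding inner_scaleR_right inner_diff_right by (rule integrable_centered_mult[OF gvecD[OF X] gvecD[OF Y]])
  have "b \<bullet> (\<integral>w. ?f w \<partial>M) = expectation (\<lambda>w. b \<bullet> ?f w)"
    by (rule integral_inner_right[symmetric]) (rule integrable_componentwise, rule i)
  then show ?thesis
    unfolding covariance_map_eq[OF X Y] cov_def expectation_inner[OF X] expectation_inner[OF Y]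
    by (simp add: inner_diff_right)
qed

lemma covariance_map_inner':
  assumes X: "gvec X" and Y: "gvec Y"
  shows "covariance_map M X Y a \<bullet> b = cov (\<lambda>w. a \<bullet> X w) (\<lambda>w. b \<bullet> Y w)"
  using covariance_map_inner[OF X Y] by (simp only: inner_commute[of "covariance_map M X Y a"])

lemma linear_covariance_map:
  assumes X: "gvec X" and Y: "gvec Y" shows "linear (covariance_map M X Y)"
proof
  fix a a' c
  note i = covariance_map_inner'[OF X Y]
  show "covariance_map M X Y (a + a') = covariance_map M X Y a + covariance_map M X Y a'"
    by (rule euclidean_eqI) (simp add: i inner_add_left inner_add_right cov_add gvecD[OF X] gvecD[OF Y])
  show "covariance_map M X Y (c *\<^sub>R a) = c *\<^sub>R covariance_map M X Y a"
    by (rule euclidean_eqI) (simp add: i cov_scale gvecD[OF X] gvecD[OF Y])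
qed

text \<open>A direction of zero variance would confine X almost surely to a hyperplane.\<close>

lemma nondegenerate_cov_pos:
  assumes X: "gvec X" and nd: "nondegenerate M X" and a: "a \<noteq> 0"
  shows "cov (\<lambda>w. a \<bullet> X w) (\<lambda>w. a \<bullet> X w) > 0"
proof (rule ccontr)
  let ?f = "\<lambda>w. a \<bullet> X w"
  assume "\<not> ?thesis"
  then have "expectation (\<lambda>w. (?f w - expectation ?f)\<^sup>2) = 0" using cov_nonneg[of ?f] unfolding variance_cov by linarith
  moreover have "integrable M (\<lambda>w. (?f w - expectation ?f)\<^sup>2)"
    using gvecD[OF X, of a] sq_integrable[OF gvecD[OF X, of a]] by (simp add: power2_diff)
  ultimately have "AE w in M. (?f w - expectation ?f)\<^sup>2 = 0" by (subst (asm) integral_nonneg_eq_0_iff_AE) auto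
  then have "AE w in M. X w \<in> {x. a \<bullet> x = expectation ?f}" by simp
  moreover have "{x. a \<bullet> x = expectation ?f} \<noteq> UNIV"
  proof
    assume U: "{x. a \<bullet> x = expectation ?f} = UNIV"
    have "0 \<in> {x. a \<bullet> x = expectation ?f}" "a \<in> {x. a \<bullet> x = expectation ?f}" unfolding U by auto
    then show False using a by simp
  qed
  ultimately show False using nd affine_hyperplane[of a "expectation ?f"] unfolding nondegenerate_def by blast
qed

lemma bij_covariance_map:
  assumes X: "gvec X" and nd: "nondegenerate M X" shows "bij (covariance_map M X X)"
proof -
  have "inj (covariance_map M X X)"
    unfolding linear_injective_0[OF linear_covariance_map[OF X X]]
  proof safe
    fix a assume "covariance_map M X X a = 0"
    then have "cov (\<lambda>w. a \<bullet> X w) (\<lambda>w. a \<bullet> X w) = 0" using covariance_map_inner[OF X X, of a a] by simp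
    then show "a = 0" using nondegenerate_cov_pos[OF X nd, of a] by auto
  qed
  then show ?thesis using linear_injective_imp_surjective[OF linear_covariance_map[OF X X]] by (simp add: bij_def)
qed

lemma linear_regression_map:
  assumes X: "gvec X" and nd: "nondegenerate M X" and Y: "gvec Y"
  shows "linear (regression_map M X Y)"
  unfolding regression_map_def
  using linear_compose[OF bij_covariance_map[OF X nd, THEN bij_is_inj, THEN inj_linear_imp_inv_linear[OF linear_covariance_map[OF X X]]]
     linear_covariance_map[OF X Y]] .

lemma regression_map_cov:
  assumes X: "gvec X" and nd: "nondegenerate M X"
  shows "regression_map M X Y (covariance_map M X X a) = covariance_map M X Y a"
  unfolding regression_map_def using bij_covariance_map[OF X nd] by (simp add: bij_is_inj)

lemma regression_map_self:
  assumes X: "gvec X" and nd: "nondegenerate M X"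
  shows "regression_map M X X x = x"
  unfolding regression_map_def using bij_covariance_map[OF X nd] by (simp add: bij_is_surj surj_f_inv_f)

lemma regression_map_linear:
  assumes X: "gvec X" and Y: "gvec Y" and f: "linear f"
  shows "regression_map M X (\<lambda>w. f (Y w)) x = f (regression_map M X Y x)"
proof (rule euclidean_eqI)
  fix b :: 'c assume "b \<in> Basis"
  have "b \<bullet> f y = adjoint f b \<bullet> y" for y using adjoint_works[OF f, of y b] by (simp only: inner_commute[of y] inner_commute[of _ b])
  then have "b \<bullet> covariance_map M X (\<lambda>w. f (Y w)) a = b \<bullet> f (covariance_map M X Y a)" for a
    by (simp add: covariance_map_inner[OF X Y] covariance_map_inner[OF X gvec_linear[OF Y f]])
  then have "b \<bullet> regression_map M X (\<lambda>w. f (Y w)) x = b \<bullet> f (regression_map M X Y x)"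
    by (simp add: regression_map_def)
  then show "regression_map M X (\<lambda>w. f (Y w)) x \<bullet> b = f (regression_map M X Y x) \<bullet> b"
    by (simp only: inner_commute[of _ b])
qed

text \<open>The full orthogonal complement of the components of X in H for the covariance form. It
  contains the residuals of all vectors on X, so a whole path of residuals is measurable for one
  sigma-algebra independent of X.\<close>

definition residuals :: "('w \<Rightarrow> 'a::euclidean_space) \<Rightarrow> ('w \<Rightarrow> real) set" where
  "residuals X = {f \<in> H. \<forall>a. cov (\<lambda>w. a \<bullet> X w) f = 0}"

text \<open>The normal equations B Var(X) = Cov(Y, X), tested against b after moving B to b by its
  adjoint.\<close>

lemma residual_in_residuals:
  assumes X: "gvec X" and nd: "nondegenerate M X" and Y: "gvec Y"
  shows "(\<lambda>w. b \<bullet> (Y w - regression_map M X Y (X w))) \<in> residuals X"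
proof -
  let ?B = "regression_map M X Y"
  note lin = linear_regression_map[OF X nd Y]
  have BX: "gvec (\<lambda>w. ?B (X w))" by (rule gvec_linear[OF X lin])
  have ad: "b \<bullet> ?B x = adjoint ?B b \<bullet> x" for x
    using adjoint_works[OF lin, of x b] by (simp only: inner_commute[of x] inner_commute[of _ b])
  have "cov (\<lambda>w. a \<bullet> X w) (\<lambda>w. b \<bullet> (Y w - ?B (X w))) = 0" for a
  proof -
    have "cov (\<lambda>w. a \<bullet> X w) (\<lambda>w. b \<bullet> ?B (X w)) = adjoint ?B b \<bullet> covariance_map M X X a"
      unfolding ad covariance_map_inner[OF X X] ..
    also have "\<dots> = b \<bullet> covariance_map M X Y a" unfolding ad[symmetric] regression_map_cov[OF X nd] ..
    also have "\<dots> = cov (\<lambda>w. a \<bullet> X w) (\<lambda>w. b \<bullet> Y w)" by (rule covariance_map_inner[OF X Y])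
    finally show ?thesis
      using cov_diff[OF gvecD[OF Y] gvecD[OF BX] gvecD[OF X], of b b a]
      by (simp add: inner_diff_right cov_commute[of "\<lambda>w. a \<bullet> X w"])
  qed
  then show ?thesis using gvecD[OF gvec_diff[OF Y BX], of b] by (simp add: residuals_def)
qed

lemma residual_measurable:
  assumes X: "gvec X" and nd: "nondegenerate M X" and Y: "gvec Y"
  shows "(\<lambda>w. Y w - regression_map M X Y (X w)) \<in> borel_measurable (gen_algebra M (residuals X))"
  by (rule borel_measurable_inner_BasisI, rule measurable_gen_algebra, rule residual_in_residuals[OF assms])

lemma nn_integral_residuals:
  assumes X: "gvec X" and "\<Psi> \<in> borel_measurable (borel \<Otimes>\<^sub>M gen_algebra M (residuals X))"
  shows "(\<integral>\<^sup>+w. \<Psi> (X w, w) \<partial>M) = (\<integral>\<^sup>+w. \<integral>\<^sup>+w'. \<Psi> (X w', w) \<partial>M \<partial>M)"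
proof (rule nn_integral_indep[OF _ _ _ assms(2)])
  have c: "(\<lambda>w. X w \<bullet> b) = (\<lambda>w. b \<bullet> X w)" for b by (rule ext) (rule inner_commute)
  show "(\<lambda>w. X w \<bullet> b) \<in> H" for b unfolding c by (rule gvecD[OF X])
  show "cov (\<lambda>w. X w \<bullet> b) g = 0" if "g \<in> residuals X" for b g using that unfolding c residuals_def by blast
qed (auto simp: residuals_def)

lemma residuals_subalgebra: "subalgebra M (gen_algebra M (residuals X))"
  by (rule subalgebra_gen_algebra) (auto simp: residuals_def meas)

end

section \<open>Densities of Gaussian vectors\<close>

lemma emeasure_lborel_open_pos:
  fixes S :: "'a::euclidean_space set"
  assumes "open S" "x \<in> S" shows "emeasure lborel S > 0"
proof -
  obtain e where e: "e > 0" "ball x e \<subseteq> S" using assms open_contains_ball by blast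
  have "0 < ennreal (measure lborel (ball x e))" using content_ball_pos[OF e(1)] by simp
  also have "ennreal (measure lborel (ball x e)) = emeasure lborel (ball x e)"
    by (rule emeasure_eq_ennreal_measure[symmetric]) (use emeasure_bounded_finite[of "ball x e"] in auto)
  also have "\<dots> \<le> emeasure lborel S" using e assms by (intro emeasure_mono) auto
  finally show ?thesis by simp
qed

lemma continuous_AE_eq_imp_eq:
  fixes f g :: "'a::euclidean_space \<Rightarrow> real"
  assumes "continuous_on UNIV f" "continuous_on UNIV g" and ae: "AE x in lborel. f x = g x"
  shows "f x = g x"
proof (rule ccontr)
  assume ne: "f x \<noteq> g x"
  have o: "open {x. f x \<noteq> g x}" using open_Collect_neq[OF assms(1,2)] by simp
  then have "emeasure lborel {x. f x \<noteq> g x} = 0"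
    using ae by (subst (asm) AE_iff_measurable[OF _ refl]) auto
  then show False using emeasure_lborel_open_pos[OF o, of x] ne by simp
qed

section \<open>Lebesgue measure under translations, reflections and linear maps\<close>

lemma nn_integral_lborel_translate:
  fixes f :: "'a::euclidean_space \<Rightarrow> ennreal"
  assumes [measurable]: "f \<in> borel_measurable borel"
  shows "(\<integral>\<^sup>+x. f (c + x) \<partial>lborel) = (\<integral>\<^sup>+x. f x \<partial>lborel)"
proof -
  have "(\<integral>\<^sup>+x. f x \<partial>lborel) = (\<integral>\<^sup>+x. f x \<partial>distr lborel borel ((+) c))" by (simp add: lborel_distr_plus)
  also have "\<dots> = (\<integral>\<^sup>+x. f (c + x) \<partial>lborel)" by (subst nn_integral_distr) auto
  finally show ?thesis by simp
qed

lemma nn_integral_lborel_reflect: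
  fixes f :: "'a::euclidean_space \<Rightarrow> ennreal"
  assumes [measurable]: "f \<in> borel_measurable borel"
  shows "(\<integral>\<^sup>+x. f (c - x) \<partial>lborel) = (\<integral>\<^sup>+x. f x \<partial>lborel)"
proof -
  have "lborel = distr lborel borel (\<lambda>x. c + (-1) *\<^sub>R x :: 'a)"
    using lborel_affine[of "-1" c] by (simp add: density_1)
  then have "(\<integral>\<^sup>+x. f x \<partial>lborel) = (\<integral>\<^sup>+x. f x \<partial>distr lborel borel (\<lambda>x. c + (-1) *\<^sub>R x))" by simp
  also have "\<dots> = (\<integral>\<^sup>+x. f (c - x) \<partial>lborel)" by (subst nn_integral_distr) auto
  finally show ?thesis by simp
qed

lemma linear_borel_measurable:
  fixes L :: "'a::euclidean_space \<Rightarrow> 'b::euclidean_space"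
  assumes "linear L" shows "L \<in> borel_measurable borel"
  by (intro borel_measurable_continuous_onI linear_continuous_on) (use assms in \<open>simp add: linear_conv_bounded_linear\<close>)

lemma ennreal_divide_mult_self: "0 < c \<Longrightarrow> ennreal (1/c) * ennreal c = 1"
  using ennreal_mult[of "1/c" c] by simp

text \<open>Uniqueness of translation invariant measures: for \<open>\<mu>\<close> the image of Lebesgue measure under
  \<open>L\<close>, Fubini and the invariance of both measures give \<open>\<mu>(f) \<lambda>(g) = \<mu>(g) \<lambda>(f)\<close>.\<close>

lemma nn_integral_linear_change:
  fixes L :: "'a::euclidean_space \<Rightarrow> 'a"
  assumes lin: "linear L" and "inj L"
  obtains c where "0 < c"
    "\<And>f. f \<in> borel_measurable borel \<Longrightarrow> (\<integral>\<^sup>+x. f x \<partial>lborel) = ennreal c * (\<integral>\<^sup>+x. f (L x) \<partial>lborel)"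
proof -
  have sur: "surj L" using linear_injective_imp_surjective[OF lin \<open>inj L\<close>] by simp
  define K where "K = inv L"
  have KL: "K (L x) = x" "L (K x) = x" for x
    using \<open>inj L\<close> sur by (auto simp: K_def inv_f_f surj_f_inv_f)
  have K: "linear K" unfolding K_def by (rule inj_linear_imp_inv_linear[OF lin \<open>inj L\<close>])
  note [measurable] = linear_borel_measurable[OF lin] linear_borel_measurable[OF K]
  have sym: "(\<integral>\<^sup>+x. f (L x) \<partial>lborel) * (\<integral>\<^sup>+y. g y \<partial>lborel) = (\<integral>\<^sup>+x. g (L x) \<partial>lborel) * (\<integral>\<^sup>+y. f y \<partial>lborel)"
    if [measurable]: "f \<in> borel_measurable borel" "g \<in> borel_measurable borel" for f g :: "'a \<Rightarrow> ennreal"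
  proof -
    have "(\<integral>\<^sup>+x. f (L x) \<partial>lborel) * (\<integral>\<^sup>+y. g y \<partial>lborel) = (\<integral>\<^sup>+x. f (L x) * (\<integral>\<^sup>+y. g y \<partial>lborel) \<partial>lborel)"
      by (rule nn_integral_multc[symmetric]) measurable
    also have "\<dots> = (\<integral>\<^sup>+x. \<integral>\<^sup>+y. f (L x) * g (L x + y) \<partial>lborel \<partial>lborel)"
      by (simp add: nn_integral_cmult nn_integral_lborel_translate)
    also have "\<dots> = (\<integral>\<^sup>+y. \<integral>\<^sup>+x. f (L x) * g (L x + y) \<partial>lborel \<partial>lborel)"
      by (rule lborel_pair.Fubini') measurable
    also have "\<dots> = (\<integral>\<^sup>+y. \<integral>\<^sup>+x. f (L x - y) * g (L x) \<partial>lborel \<partial>lborel)"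
    proof (rule nn_integral_cong)
      fix y
      have "(\<integral>\<^sup>+x. f (L x) * g (L x + y) \<partial>lborel) = (\<integral>\<^sup>+x. f (L (- K y + x)) * g (L (- K y + x) + y) \<partial>lborel)"
        by (rule nn_integral_lborel_translate[symmetric]) measurable
      also have "\<dots> = (\<integral>\<^sup>+x. f (L x - y) * g (L x) \<partial>lborel)"
        by (simp add: linear_diff[OF lin] KL)
      finally show "(\<integral>\<^sup>+x. f (L x) * g (L x + y) \<partial>lborel) = (\<integral>\<^sup>+x. f (L x - y) * g (L x) \<partial>lborel)" .
    qed
    also have "\<dots> = (\<integral>\<^sup>+x. \<integral>\<^sup>+y. f (L x - y) * g (L x) \<partial>lborel \<partial>lborel)"
      by (rule lborel_pair.Fubini') measurable
    also have "\<dots> = (\<integral>\<^sup>+x. g (L x) * (\<integral>\<^sup>+y. f y \<partial>lborel) \<partial>lborel)"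
    proof (rule nn_integral_cong)
      fix x
      have "(\<integral>\<^sup>+y. f (L x - y) * g (L x) \<partial>lborel) = (\<integral>\<^sup>+y. f (L x - y) \<partial>lborel) * g (L x)"
        by (rule nn_integral_multc) measurable
      then show "(\<integral>\<^sup>+y. f (L x - y) * g (L x) \<partial>lborel) = g (L x) * (\<integral>\<^sup>+y. f y \<partial>lborel)"
        by (simp only: nn_integral_lborel_reflect[OF that(1)] mult.commute)
    qed
    also have "\<dots> = (\<integral>\<^sup>+x. g (L x) \<partial>lborel) * (\<integral>\<^sup>+y. f y \<partial>lborel)"
      by (rule nn_integral_multc) measurable
    finally show ?thesis .
  qed
  \<comment> \<open>The unit box as test set determines the constant: c = 1/m, where m is the
    measure of its preimage. It is finite since the preimage is bounded and positive since the
    preimage is open and nonempty.\<close>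
  define B where "B = (box 0 One :: 'a set)"
  have [measurable]: "B \<in> sets borel" by (simp add: B_def)
  have B1: "(\<integral>\<^sup>+y. indicator B y \<partial>lborel) = 1"
    by (simp add: B_def)
  define m where "m = emeasure lborel (L -` B)"
  have m: "(\<integral>\<^sup>+x. indicator B (L x) \<partial>lborel) = m"
  proof -
    have "(\<integral>\<^sup>+x. indicator B (L x) \<partial>lborel) = (\<integral>\<^sup>+x. indicator (L -` B) x \<partial>lborel)"
      by (simp add: indicator_def)
    also have "L -` B \<in> sets lborel" using measurable_sets[OF linear_borel_measurable[OF lin], of B] by simp
    then have "(\<integral>\<^sup>+x. indicator (L -` B) x \<partial>lborel) = m" unfolding m_def by (rule nn_integral_indicator)
    finally show ?thesis .
  qed
  have im: "L -` B = K ` B" unfolding K_def by (rule bij_vimage_eq_inv_image[OF bijI[OF \<open>inj L\<close> sur]])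
  have "bounded (K ` B)" unfolding B_def
    using bounded_linear_image[OF bounded_box] K by (simp add: linear_conv_bounded_linear)
  then have mfin: "m < \<infinity>" unfolding m_def im by (rule emeasure_bounded_finite)
  have "open (L -` B)"
    unfolding B_def by (intro open_vimage open_box linear_continuous_on) (use lin in \<open>simp add: linear_conv_bounded_linear\<close>)
  moreover have "K ((1/2) *\<^sub>R One) \<in> L -` B" by (simp add: KL B_def mem_box)
  ultimately have mpos: "m > 0" unfolding m_def by (rule emeasure_lborel_open_pos)
  obtain r where r: "m = ennreal r" "r > 0" using mfin mpos by (cases m) (auto simp: top_unique)
  have "(\<integral>\<^sup>+x. f x \<partial>lborel) = ennreal (1/r) * (\<integral>\<^sup>+x. f (L x) \<partial>lborel)" if f[measurable]: "f \<in> borel_measurable borel" for f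
  proof -
    have "(\<integral>\<^sup>+x. f (L x) \<partial>lborel) = m * (\<integral>\<^sup>+x. f x \<partial>lborel)"
      using sym[OF f, of "indicator B"] unfolding B1 m by simp
    then have "ennreal (1/r) * (\<integral>\<^sup>+x. f (L x) \<partial>lborel) = (ennreal (1/r) * ennreal r) * (\<integral>\<^sup>+x. f x \<partial>lborel)"
      unfolding r by (simp add: mult.assoc)
    also have "ennreal (1/r) * ennreal r = 1" by (rule ennreal_divide_mult_self[OF r(2)])
    finally show ?thesis by simp
  qed
  then show ?thesis by (rule that[OF divide_pos_pos[OF zero_less_one r(2)]])
qed

lemma nn_integral_affine_change:
  fixes L :: "'a::euclidean_space \<Rightarrow> 'a"
  assumes lin: "linear L" and ch: "\<And>f. f \<in> borel_measurable borel \<Longrightarrow> (\<integral>\<^sup>+x. f x \<partial>lborel) = ennreal c * (\<integral>\<^sup>+x. f (L x) \<partial>lborel)"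
    and [measurable]: "f \<in> borel_measurable borel"
  shows "(\<integral>\<^sup>+x. f x \<partial>lborel) = ennreal c * (\<integral>\<^sup>+x. f (r + L x) \<partial>lborel)"
proof -
  have "(\<integral>\<^sup>+x. f x \<partial>lborel) = (\<integral>\<^sup>+x. f (r + x) \<partial>lborel)" by (simp add: nn_integral_lborel_translate)
  also have "\<dots> = ennreal c * (\<integral>\<^sup>+x. f (r + L x) \<partial>lborel)" by (rule ch) measurable
  finally show ?thesis .
qed

section \<open>Standard normal vectors and continuous Gaussian densities\<close>

definition std_gauss_density :: "'a::euclidean_space \<Rightarrow> real" where
  "std_gauss_density x = (\<Prod>b\<in>Basis. std_normal_density (x \<bullet> b))"

lemma std_gauss_density_nonneg: "0 \<le> std_gauss_density x"
  unfolding std_gauss_density_def by (intro prod_nonneg) auto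

lemma std_gauss_density_le: "std_gauss_density x \<le> 1"
  unfolding std_gauss_density_def
proof (rule prod_le_1, intro conjI)
  fix b
  have "sqrt (2 * pi) \<ge> 1" using pi_gt3 by (simp add: real_le_rsqrt)
  then have "1 / sqrt (2 * pi) * exp (- (x \<bullet> b)\<^sup>2 / 2) \<le> 1 * 1" by (intro mult_mono) auto
  then show "std_normal_density (x \<bullet> b) \<le> 1" by (simp add: std_normal_density_def)
qed auto

lemma continuous_on_std_gauss_density[continuous_intros]:
  "continuous_on A f \<Longrightarrow> continuous_on A (\<lambda>x. std_gauss_density (f x))"
  unfolding std_gauss_density_def std_normal_density_def by (intro continuous_intros) auto

lemma borel_measurable_std_gauss_density[measurable]: "std_gauss_density \<in> borel_measurable borel"
  by (intro borel_measurable_continuous_onI continuous_intros)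

text \<open>The hypothesis factorises over the coordinates, so W has the same characteristic
  function as a product of standard normal laws; equality on rectangles includes all boxes, which
  generate the Borel sets.\<close>

lemma (in prob_space) char_std_normal_imp_distributed:
  fixes W :: "'a \<Rightarrow> 'b::euclidean_space"
  assumes [measurable]: "W \<in> borel_measurable M"
    and ch: "\<And>a. (CLINT w|M. iexp (a \<bullet> W w)) = of_real (exp (- (a \<bullet> a) / 2))"
  shows "distributed M lborel W (\<lambda>x. ennreal (std_gauss_density x))"
proof -
  interpret N: prob_space std_normal_distribution by (rule prob_space_normal_density) simp
  interpret PS: product_prob_space "\<lambda>_::'b. std_normal_distribution" Basis ..
  let ?P = "PiM Basis (\<lambda>_::'b. std_normal_distribution)"
  have P: "prob_space ?P" by unfold_locales
  have rect: "measure M {w\<in>space M. \<forall>b\<in>Basis. W w \<bullet> b \<in> A b} = (\<Prod>b\<in>Basis. measure std_normal_distribution (A b))"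
    if A: "\<And>b. b \<in> Basis \<Longrightarrow> A b \<in> sets borel" for A :: "'b \<Rightarrow> real set"
  proof -
    have "measure M {w\<in>space M. \<forall>b\<in>Basis. W w \<bullet> b \<in> A b} = measure ?P {x\<in>space ?P. \<forall>b\<in>Basis. x b \<in> A b}"
    proof (rule char_determines_rectangles[OF prob_space_axioms P])
      fix a :: "'b \<Rightarrow> real"
      define v where "v = (\<Sum>b\<in>Basis. a b *\<^sub>R b)"
      have vb: "v \<bullet> b = a b" if "b \<in> Basis" for b using that by (simp add: v_def inner_sum_left_Basis)
      have "(\<Sum>b\<in>Basis. a b * (W w \<bullet> b)) = v \<bullet> W w" for w
        by (subst euclidean_inner) (simp add: vb)
      then have "(CLINT w|M. iexp (\<Sum>b\<in>Basis. a b * (W w \<bullet> b))) = of_real (exp (- (v \<bullet> v) / 2))"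
        using ch by simp
      also have "v \<bullet> v = (\<Sum>b\<in>Basis. (a b)\<^sup>2)"
        by (subst euclidean_inner) (simp add: vb power2_eq_square)
      also have "complex_of_real (exp (- (\<Sum>b\<in>Basis. (a b)\<^sup>2) / 2)) = (\<Prod>b\<in>(Basis::'b set). of_real (exp (- (a b)\<^sup>2 / 2)))"
        by (simp add: sum_divide_distrib exp_sum flip: sum_negf of_real_prod)
      also have "\<dots> = (\<Prod>b\<in>(Basis::'b set). CLINT x|std_normal_distribution. iexp (a b * x))"
        using char_std_normal_distribution by (simp add: fun_eq_iff char_def)
      also have "\<dots> = (CLINT x|?P. (\<Prod>b\<in>Basis. iexp (a b * x b)))"
        by (rule PS.product_integral_prod[symmetric]) (auto intro!: N.integrable_const_bound[where B=1])
      also have "\<dots> = (CLINT x|?P. iexp (\<Sum>b\<in>Basis. a b * x b))"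
        by (simp add: exp_sum sum_distrib_left)
      finally show "(CLINT w|M. iexp (\<Sum>b\<in>Basis. a b * (W w \<bullet> b))) = \<dots>" .
    next
      show "(\<lambda>x. x b) \<in> borel_measurable ?P" if "b \<in> Basis" for b
        using measurable_component_singleton[OF that, of "\<lambda>_. std_normal_distribution"] by simp
    qed (use A in auto)
    also have "{x\<in>space ?P. \<forall>b\<in>Basis. x b \<in> A b} = Pi\<^sub>E Basis A" by (auto simp: space_PiM PiE_def Pi_def)
    finally have 1: "measure M {w\<in>space M. \<forall>b\<in>Basis. W w \<bullet> b \<in> A b} = measure ?P (Pi\<^sub>E Basis A)" .
    have "emeasure ?P (Pi\<^sub>E Basis A) = (\<Prod>b\<in>Basis. emeasure std_normal_distribution (A b))"
      by (rule PS.emeasure_PiM[OF finite_Basis]) (simp add: A)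
    also have "\<dots> = (\<Prod>b\<in>Basis. ennreal (measure std_normal_distribution (A b)))"
      by (simp only: N.emeasure_eq_measure)
    also have "\<dots> = ennreal (\<Prod>b\<in>Basis. measure std_normal_distribution (A b))"
      by (rule prod_ennreal) (rule measure_nonneg)
    finally show ?thesis unfolding 1 by (intro measure_eq_emeasure_eq_ennreal prod_nonneg) (simp_all add: measure_nonneg)
  qed
  have "distr M lborel W = density lborel (\<lambda>x. ennreal (std_gauss_density x))"
  proof (rule measure_eqI_generator_eq)
    let ?E = "range (\<lambda>(a, b). box a b::'b set)"
    show "Int_stable ?E" by (auto simp: Int_stable_def box_Int_box)
    show "?E \<subseteq> Pow UNIV" "sets (distr M lborel W) = sigma_sets UNIV ?E"
      "sets (density lborel (\<lambda>x. ennreal (std_gauss_density x))) = sigma_sets UNIV ?E"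
      by (simp_all add: borel_eq_box)
    let ?A = "\<lambda>n::nat. box (- (real n *\<^sub>R One)) (real n *\<^sub>R One) :: 'b set"
    show "range ?A \<subseteq> ?E" "(\<Union>i. ?A i) = UNIV" unfolding UN_box_eq_UNIV by auto
    show "emeasure (distr M lborel W) (?A i) \<noteq> \<infinity>" for i
      by (subst emeasure_distr) (auto simp: emeasure_eq_measure)
    fix X assume "X \<in> ?E"
    then obtain l u where X: "X = box l u" by auto
    have "emeasure (distr M lborel W) X = ennreal (measure M {w\<in>space M. \<forall>b\<in>Basis. W w \<bullet> b \<in> {l \<bullet> b <..< u \<bullet> b}})"
      unfolding X by (subst emeasure_distr) (auto simp: emeasure_eq_measure box_def intro!: arg_cong[where f="measure M"])
    also have "\<dots> = ennreal (\<Prod>b\<in>Basis. measure std_normal_distribution {l \<bullet> b <..< u \<bullet> b})" by (subst rect) auto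
    also have "\<dots> = (\<Prod>b\<in>Basis. emeasure std_normal_distribution {l \<bullet> b <..< u \<bullet> b})"
      by (simp add: N.emeasure_eq_measure prod_ennreal)
    also have "\<dots> = (\<Prod>b\<in>Basis. \<integral>\<^sup>+x. ennreal (std_normal_density x) * indicator {l \<bullet> b <..< u \<bullet> b} x \<partial>lborel)"
      by (intro prod.cong refl emeasure_density) auto
    also have "\<dots> = (\<integral>\<^sup>+x. (\<Prod>b\<in>Basis. ennreal (std_normal_density (x \<bullet> b)) * indicator {l \<bullet> b <..< u \<bullet> b} (x \<bullet> b)) \<partial>lborel)"
      by (rule nn_integral_lborel_prod[symmetric]) auto
    also have "\<dots> = (\<integral>\<^sup>+x. ennreal (std_gauss_density x) * indicator X x \<partial>lborel)"
      by (intro nn_integral_cong) (auto simp: prod.distrib std_gauss_density_def prod_ennreal X box_def indicator_def)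
    also have "\<dots> = emeasure (density lborel (\<lambda>x. ennreal (std_gauss_density x))) X"
      unfolding X by (subst emeasure_density) auto
    finally show "emeasure (distr M lborel W) X = emeasure (density lborel (\<lambda>x. ennreal (std_gauss_density x))) X" .
  qed
  then show ?thesis unfolding distributed_def by simp
qed

context gaussian_space begin

text \<open>Gram--Schmidt for the covariance form.\<close>

lemma covariance_orthonormal_family:
  fixes X :: "'w \<Rightarrow> 'a::euclidean_space"
  assumes X: "gvec X" and nd: "nondegenerate M X"
  shows "n \<le> DIM('a) \<Longrightarrow> \<exists>A. finite A \<and> card A = n \<and> (\<forall>a\<in>A. \<forall>b\<in>A. cov (\<lambda>w. a \<bullet> X w) (\<lambda>w. b \<bullet> X w) = of_bool (a = b))"
proof (induction n)
  case (Suc n)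
  then obtain A where A: "finite A" "card A = n" "\<And>a b. a \<in> A \<Longrightarrow> b \<in> A \<Longrightarrow> cov (\<lambda>w. a \<bullet> X w) (\<lambda>w. b \<bullet> X w) = of_bool (a = b)"
    by auto
  let ?c = "\<lambda>a b. cov (\<lambda>w. a \<bullet> X w) (\<lambda>w. b \<bullet> X w)"
  have "dim A \<le> n" using dim_le_card'[OF A(1)] A(2) by simp
  then have "span A \<noteq> UNIV" using Suc.prems dim_eq_full[of A] by auto
  then obtain v where v: "v \<notin> span A" by auto
  define v' where "v' = v - (\<Sum>a\<in>A. ?c v a *\<^sub>R a)"
  have cv: "?c v' b = ?c v b - (\<Sum>a\<in>A. ?c v a * ?c a b)" for b
  proof -
    have "(\<lambda>w. v' \<bullet> X w) = (\<lambda>w. v \<bullet> X w - (\<Sum>a\<in>A. ?c v a * (a \<bullet> X w)))"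
      by (rule ext) (simp add: v'_def inner_diff_left inner_sum_left)
    then show ?thesis
      using gvecD[OF X] by (simp only: cov_diff sum scale cov_sum cov_scale)
  qed
  have orth: "?c v' b = 0" if b: "b \<in> A" for b
  proof -
    have "(\<Sum>a\<in>A. ?c v a * ?c a b) = (\<Sum>a\<in>A. if a = b then ?c v b else 0)"
      using A b by (intro sum.cong refl) auto
    then show ?thesis unfolding cv using A b by simp
  qed
  have "(\<Sum>a\<in>A. ?c v a *\<^sub>R a) \<in> span A" by (intro span_sum span_scale span_base)
  then have v0: "v' \<noteq> 0" using v unfolding v'_def by auto
  define s where "s = ?c v' v'"
  have s: "s > 0" unfolding s_def by (rule nondegenerate_cov_pos[OF X nd v0])
  define e where "e = (1 / sqrt s) *\<^sub>R v'"
  have ce: "?c e b = (1 / sqrt s) * ?c v' b" for b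
    unfolding e_def inner_scaleR_left by (rule cov_scale[OF gvecD[OF X] gvecD[OF X]])
  have ee: "?c e e = 1"
    unfolding ce using s by (subst cov_commute) (simp only: ce s_def[symmetric], simp add: real_sqrt_mult[symmetric] flip: power2_eq_square)
  have eb: "?c e b = 0" "?c b e = 0" if "b \<in> A" for b
    using orth[OF that] ce[of b] by (simp_all add: cov_commute[of "\<lambda>w. b \<bullet> X w"])
  have "e \<notin> A" using eb(1)[of e] ee by auto
  then show ?case using A ee eb by (intro exI[of _ "insert e A"]) auto
qed (auto intro: exI[of _ "{}"])

text \<open>A covariance-orthonormal family f, placed in the rows of a linear map L, makes L(X - E
  X) standard normal. Its density is at most 1, so pulling it back along L gives a continuous
  density bounded by the Jacobian constant c. The bound serves later dominated convergence.\<close>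

lemma gaussian_density_exists:
  fixes X :: "'w \<Rightarrow> 'a::euclidean_space"
  assumes X: "gvec X" and nd: "nondegenerate M X"
  shows "\<exists>p B. continuous_on UNIV p \<and> (\<forall>x. 0 \<le> p x \<and> p x \<le> B) \<and> distributed M lborel X (\<lambda>x. ennreal (p x))"
proof -
  note [measurable] = gvec_measurable[OF X]
  let ?c = "\<lambda>a b. cov (\<lambda>w. a \<bullet> X w) (\<lambda>w. b \<bullet> X w)"
  obtain A where A: "finite A" "card A = DIM('a)" "\<And>a b. a \<in> A \<Longrightarrow> b \<in> A \<Longrightarrow> ?c a b = of_bool (a = b)"
    using covariance_orthonormal_family[OF X nd order.refl] by auto
  obtain f :: "'a \<Rightarrow> 'a" where f: "bij_betw f Basis A"
    using finite_same_card_bij[OF finite_Basis A(1)] A(2) by auto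
  have fA: "b \<in> Basis \<Longrightarrow> f b \<in> A" for b using f bij_betwE by blast
  define L where "L x = (\<Sum>b\<in>Basis. (f b \<bullet> x) *\<^sub>R b)" for x
  have Lb: "L x \<bullet> b = f b \<bullet> x" if "b \<in> Basis" for x b using that by (simp add: L_def inner_sum_left_Basis)
  have lin: "linear L"
    by (rule linearI; rule euclidean_eqI) (simp_all add: Lb inner_add_right inner_add_left)
  \<comment> \<open>The adjoint of L: testing L X against a is testing X against T a.\<close>
  define T where "T a = (\<Sum>b\<in>Basis. (a \<bullet> b) *\<^sub>R f b)" for a
  have aL: "a \<bullet> L x = T a \<bullet> x" for a x
    unfolding T_def inner_sum_left by (subst euclidean_inner) (simp add: Lb)
  have cT: "?c (T a) y = (\<Sum>b\<in>Basis. (a \<bullet> b) * ?c (f b) y)" for a y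
  proof -
    have "(\<lambda>w. T a \<bullet> X w) = (\<lambda>w. \<Sum>b\<in>Basis. (a \<bullet> b) * (f b \<bullet> X w))"
      by (rule ext) (simp add: T_def inner_sum_left)
    then show ?thesis using gvecD[OF X] by (simp only: sum scale cov_sum cov_scale)
  qed
  have TT: "?c (T a) (T a) = a \<bullet> a" for a
  proof -
    have "?c (f b) (T a) = (\<Sum>b'\<in>Basis. (a \<bullet> b') * ?c (f b') (f b))" for b
      by (subst cov_commute) (rule cT)
    also have "\<dots> b = (a \<bullet> b)" if b: "b \<in> Basis" for b
    proof -
      have "(\<Sum>b'\<in>Basis. (a \<bullet> b') * ?c (f b') (f b)) = (\<Sum>b'\<in>Basis. if b' = b then a \<bullet> b else 0)"
        using f b by (intro sum.cong refl) (auto simp: A(3) fA bij_betw_def inj_on_eq_iff)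
      then show ?thesis using b by simp
    qed
    finally have "\<And>b. b \<in> Basis \<Longrightarrow> ?c (f b) (T a) = a \<bullet> b" by auto
    then show ?thesis unfolding cT by (subst euclidean_inner) simp
  qed
  have inj: "inj L"
    unfolding linear_injective_0[OF lin]
  proof safe
    fix x assume x: "L x = 0"
    \<comment> \<open>The map T is injective because T a has variance a \<bullet> a, hence
      surjective. If L x = 0 and x = T a, then x \<bullet> x = a \<bullet> L x = 0.\<close>
    have "surj T"
    proof -
      have linT: "linear T" by (rule linearI) (simp_all add: T_def inner_add_left scaleR_add_left sum.distrib scaleR_sum_right)
      have "inj T" unfolding linear_injective_0[OF linT]
      proof safe
        fix a assume "T a = 0"
        then have "?c (T a) (T a) = 0" by (simp add: cov_def)
        then show "a = 0" using TT[of a] by simp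
      qed
      then show ?thesis using linear_injective_imp_surjective[OF linT] by blast
    qed
    then obtain a where "x = T a" by (metis surjD)
    then have "x \<bullet> x = a \<bullet> L x" using aL by simp
    then show "x = 0" using x by simp
  qed
  obtain c where c: "0 < c" "\<And>g. g \<in> borel_measurable borel \<Longrightarrow> (\<integral>\<^sup>+x. g x \<partial>lborel) = ennreal c * (\<integral>\<^sup>+x. g (L x) \<partial>lborel)"
    using nn_integral_linear_change[OF lin inj] by blast
  define \<mu> where "\<mu> = integral\<^sup>L M X"
  define W where "W w = L (X w - \<mu>)" for w
  note [measurable] = linear_borel_measurable[OF lin]
  have Wm[measurable]: "W \<in> borel_measurable M" unfolding W_def by measurable
  have "distributed M lborel W (\<lambda>x. ennreal (std_gauss_density x))"
  proof (rule char_std_normal_imp_distributed[OF Wm])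
    fix a
    let ?f = "\<lambda>w. T a \<bullet> X w"
    have "(CLINT w|M. iexp (a \<bullet> W w)) = (CLINT w|M. iexp (- (T a \<bullet> \<mu>)) * iexp (?f w))"
      by (simp add: W_def aL inner_diff_right ring_distribs exp_diff exp_minus divide_inverse mult.commute)
    also have "\<dots> = iexp (- (T a \<bullet> \<mu>)) * (CLINT w|M. iexp (?f w))" by (rule integral_mult_right_zero)
    also have "(CLINT w|M. iexp (?f w)) = exp (\<i> * of_real (expectation ?f) - of_real (?c (T a) (T a) / 2))"
      unfolding variance_cov[symmetric] by (rule char_eq[OF gvecD[OF X]])
    also have "\<dots> = exp (\<i> * of_real (T a \<bullet> \<mu>) - of_real (a \<bullet> a / 2))"
      by (simp only: TT expectation_inner[OF X] \<mu>_def)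
    also have "iexp (- (T a \<bullet> \<mu>)) * exp (\<i> * of_real (T a \<bullet> \<mu>) - of_real (a \<bullet> a / 2)) = exp (of_real (- (a \<bullet> a) / 2))"
      unfolding mult_exp_exp by simp
    finally show "(CLINT w|M. iexp (a \<bullet> W w)) = of_real (exp (- (a \<bullet> a) / 2))" by (simp only: exp_of_real)
  qed
  note dW = this
  have XW: "X w = \<mu> + inv L (W w)" for w using inj by (simp add: W_def inv_f_f)
  have Km[measurable]: "inv L \<in> borel_measurable borel"
    by (rule linear_borel_measurable[OF inj_linear_imp_inv_linear[OF lin inj]])
  define p where "p x = c * std_gauss_density (L (x - \<mu>))" for x
  have pm[measurable]: "p \<in> borel_measurable borel" unfolding p_def by measurable
  have "distr M lborel X = density lborel (\<lambda>x. ennreal (p x))"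
  proof (rule measure_eqI)
    fix A assume "A \<in> sets (distr M lborel X)"
    then have [measurable]: "A \<in> sets borel" by simp
    have "emeasure (distr M lborel X) A = emeasure M (X -` A \<inter> space M)" by (subst emeasure_distr) auto
    also have "\<dots> = (\<integral>\<^sup>+w. indicator (X -` A \<inter> space M) w \<partial>M)" by (rule nn_integral_indicator[symmetric]) measurable
    also have "\<dots> = (\<integral>\<^sup>+w. indicator A (\<mu> + inv L (W w)) \<partial>M)"
      by (intro nn_integral_cong) (simp add: XW[symmetric] indicator_def)
    also have "\<dots> = (\<integral>\<^sup>+y. ennreal (std_gauss_density y) * indicator A (\<mu> + inv L y) \<partial>lborel)"
      by (rule distributed_nn_integral[OF dW, symmetric]) measurable
    also have "\<dots> = ennreal c * (\<integral>\<^sup>+x. ennreal (std_gauss_density (L x)) * indicator A (\<mu> + inv L (L x)) \<partial>lborel)"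
      by (rule c(2)) measurable
    also have "\<dots> = ennreal c * (\<integral>\<^sup>+x. ennreal (std_gauss_density (L (- \<mu> + x))) * indicator A (\<mu> + (- \<mu> + x)) \<partial>lborel)"
      by (subst nn_integral_lborel_translate[where c="- \<mu>"]) (use inj in \<open>auto simp: inv_f_f\<close>)
    also have "\<dots> = (\<integral>\<^sup>+x. ennreal c * (ennreal (std_gauss_density (L (- \<mu> + x))) * indicator A (\<mu> + (- \<mu> + x))) \<partial>lborel)"
      by (rule nn_integral_cmult[symmetric]) measurable
    also have "\<dots> = (\<integral>\<^sup>+x. ennreal (p x) * indicator A x \<partial>lborel)"
      using c(1) by (intro nn_integral_cong) (simp add: p_def ennreal_mult std_gauss_density_nonneg mult.assoc)
    also have "\<dots> = emeasure (density lborel (\<lambda>x. ennreal (p x))) A" by (subst emeasure_density) auto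
    finally show "emeasure (distr M lborel X) A = emeasure (density lborel (\<lambda>x. ennreal (p x))) A" .
  qed simp
  then have "distributed M lborel X (\<lambda>x. ennreal (p x))" unfolding distributed_def by simp
  moreover have "continuous_on UNIV p"
    unfolding p_def by (intro continuous_intros linear_continuous_on_compose[OF _ lin])
  moreover have "0 \<le> p x \<and> p x \<le> c" for x
    unfolding p_def using c(1) mult_left_mono[OF std_gauss_density_le[of "L (x - \<mu>)"], of c]
      mult_nonneg_nonneg[OF _ std_gauss_density_nonneg[of "L (x - \<mu>)"], of c] by simp
  ultimately show ?thesis by (intro exI[of _ p] exI[of _ c]) simp
qed

text \<open>Two continuous densities of one law agree almost everywhere and then everywhere, so the
  definite description denotes the bounded density just constructed.\<close>

lemma continuous_density_props:
  fixes X :: "'w \<Rightarrow> 'a::euclidean_space"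
  assumes X: "gvec X" and nd: "nondegenerate M X"
  shows "continuous_on UNIV (continuous_density M X)" "0 \<le> continuous_density M X x"
    "\<exists>B. \<forall>x. continuous_density M X x \<le> B"
    "distributed M lborel X (\<lambda>x. ennreal (continuous_density M X x))"
proof -
  obtain p B where p: "continuous_on UNIV p" "\<And>x. 0 \<le> p x" "\<And>x. p x \<le> B" "distributed M lborel X (\<lambda>x. ennreal (p x))"
    using gaussian_density_exists[OF X nd] by blast
  have "continuous_density M X = p"
    unfolding continuous_density_def
  proof (rule the_equality)
    show "continuous_on UNIV p \<and> (\<forall>x. 0 \<le> p x) \<and> distributed M lborel X (\<lambda>x. ennreal (p x))" using p by blast
    fix f assume f: "continuous_on UNIV f \<and> (\<forall>x. 0 \<le> f x) \<and> distributed M lborel X (\<lambda>x. ennreal (f x))"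
    then have "AE x in lborel. ennreal (f x) = ennreal (p x)" using distributed_unique p(4) by blast
    then have "AE x in lborel. f x = p x" by eventually_elim (use f p(2) in \<open>simp add: ennreal_inj\<close>)
    then have "f x = p x" for x using continuous_AE_eq_imp_eq f p(1) by blast
    then show "f = p" by blast
  qed
  then show "continuous_on UNIV (continuous_density M X)" "0 \<le> continuous_density M X x"
    "\<exists>B. \<forall>x. continuous_density M X x \<le> B"
    "distributed M lborel X (\<lambda>x. ennreal (continuous_density M X x))" using p by auto
qed

text \<open>The density in v of the measure A -> E(F(Y); X in A), computed by conditioning on the
  residuals R and S in X = R + C \<xi> and Y = S + D \<xi>. The equation X = v forces \<xi> = J(v -
  R), where J is meant to invert C and c to be the Jacobian of C.\<close>

definition disintegration_density where
  "disintegration_density \<xi> X Y F J c v =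
     (let C = regression_map M \<xi> X; D = regression_map M \<xi> Y in
       expectation (\<lambda>w. continuous_density M \<xi> (J (v - (X w - C (\<xi> w)))) *
          F ((Y w - D (\<xi> w)) + D (J (v - (X w - C (\<xi> w)))))) / c)"

text \<open>With the residuals frozen, \<xi> still has its density, and the substitution v = R + C x
  turns the integral over x into one over v. Boundedness of F and of the density of \<xi> gives a
  constant majorant, from which continuity in v follows.\<close>

lemma gaussian_disintegration:
  fixes \<xi> X :: "'w \<Rightarrow> 'a::euclidean_space" and Y :: "'w \<Rightarrow> 'c::euclidean_space"
  assumes \<xi>: "gvec \<xi>" and nd: "nondegenerate M \<xi>" and X: "gvec X" and Y: "gvec Y"
    and J: "linear J" "\<And>x. J (regression_map M \<xi> X x) = x" "\<And>x. regression_map M \<xi> X (J x) = x"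
    and c: "0 < c" "\<And>f. f \<in> borel_measurable borel \<Longrightarrow>
       (\<integral>\<^sup>+x. f x \<partial>lborel) = ennreal c * (\<integral>\<^sup>+x. f (regression_map M \<xi> X x) \<partial>lborel)"
    and F: "continuous_on UNIV F" "\<And>y. 0 \<le> F y" "\<And>y. F y \<le> B"
  shows "continuous_on UNIV (disintegration_density \<xi> X Y F J c)"
    and "\<And>v. 0 \<le> disintegration_density \<xi> X Y F J c v"
    and "\<And>\<phi>. \<phi> \<in> borel_measurable borel \<Longrightarrow> (\<integral>\<^sup>+w. \<phi> (X w) * ennreal (F (Y w)) \<partial>M) =
       (\<integral>\<^sup>+v. \<phi> v * ennreal (disintegration_density \<xi> X Y F J c v) \<partial>lborel)"
proof -
  let ?C = "regression_map M \<xi> X" and ?D = "regression_map M \<xi> Y" and ?p = "continuous_density M \<xi>"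
  let ?N = "gen_algebra M (residuals \<xi>)"
  define R where "R w = X w - ?C (\<xi> w)" for w
  define S where "S w = Y w - ?D (\<xi> w)" for w
  note p = continuous_density_props[OF \<xi> nd]
  obtain b where b: "\<And>x. ?p x \<le> b" using p(3) by blast
  have linC: "linear ?C" and linD: "linear ?D" using linear_regression_map[OF \<xi> nd] X Y by auto
  have RN: "R \<in> borel_measurable ?N" and SN: "S \<in> borel_measurable ?N"
    unfolding R_def S_def using residual_measurable[OF \<xi> nd] X Y by auto
  note RM[measurable] = measurable_from_subalg[OF residuals_subalgebra RN]
  note SM[measurable] = measurable_from_subalg[OF residuals_subalgebra SN]
  note [measurable] = linear_borel_measurable[OF linC] linear_borel_measurable[OF linD] linear_borel_measurable[OF J(1)]
    borel_measurable_continuous_onI[OF F(1)] borel_measurable_continuous_onI[OF p(1)]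
  define h where "h v w = ?p (J (v - R w)) * F (S w + ?D (J (v - R w)))" for v w
  have h0: "0 \<le> h v w" for v w unfolding h_def using p(2) F(2) by simp
  have hb: "h v w \<le> b * B" for v w unfolding h_def using p(2) F(2,3) b order_trans[OF p(2) b] by (intro mult_mono) auto
  have hm[measurable]: "h v \<in> borel_measurable M" for v unfolding h_def by measurable
  have hm2: "(\<lambda>(v, w). ennreal (h v w)) \<in> borel_measurable (lborel \<Otimes>\<^sub>M M)" unfolding h_def by measurable
  have hi: "integrable M (h v)" for v by (rule integrable_const_bound[where B="b*B"]) (use h0 hb in auto)
  have dd: "disintegration_density \<xi> X Y F J c v = expectation (h v) / c" for v
    unfolding disintegration_density_def Let_def h_def R_def S_def ..
  show "continuous_on UNIV (disintegration_density \<xi> X Y F J c)"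
  proof -
    have "continuous_on UNIV (\<lambda>v. expectation (h v))"
      unfolding continuous_on_sequentially comp_def
    proof safe
      fix x :: "nat \<Rightarrow> 'a" and a assume x: "x \<longlonglongrightarrow> a"
      show "(\<lambda>n. expectation (h (x n))) \<longlonglongrightarrow> expectation (h a)"
      proof (rule integral_dominated_convergence[where w="\<lambda>_. b * B"])
        have "continuous_on UNIV (\<lambda>v. h v w)" for w
          unfolding h_def by (intro continuous_intros continuous_on_compose2[OF p(1)] continuous_on_compose2[OF F(1)]
             linear_continuous_on_compose[OF _ J(1)] linear_continuous_on_compose[OF _ linD]) auto
        then show "AE w in M. (\<lambda>n. h (x n) w) \<longlonglongrightarrow> h a w"
          using x by (auto simp: continuous_on_sequentially comp_def)
      qed (use h0 hb in auto)
    qed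
    then show ?thesis unfolding dd using c(1) by (intro continuous_intros) auto
  qed
  show nn: "0 \<le> disintegration_density \<xi> X Y F J c v" for v
    unfolding dd using c(1) h0 by (auto intro!: divide_nonneg_pos Bochner_Integration.integral_nonneg)
  fix \<phi> :: "'a \<Rightarrow> ennreal" assume [measurable]: "\<phi> \<in> borel_measurable borel"
  define \<Psi> where "\<Psi> z = \<phi> (R (snd z) + ?C (fst z)) * ennreal (F (S (snd z) + ?D (fst z)))" for z
  have "\<Psi> \<in> borel_measurable (borel \<Otimes>\<^sub>M ?N)"
  proof -
    note RN[measurable] SN[measurable]
    show ?thesis unfolding \<Psi>_def by measurable
  qed
  then have "(\<integral>\<^sup>+w. \<Psi> (\<xi> w, w) \<partial>M) = (\<integral>\<^sup>+w. \<integral>\<^sup>+w'. \<Psi> (\<xi> w', w) \<partial>M \<partial>M)"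
    by (rule nn_integral_residuals[OF \<xi>])
  also have "\<dots> = (\<integral>\<^sup>+w. \<integral>\<^sup>+v. \<phi> v * ennreal (h v w) * ennreal (1/c) \<partial>lborel \<partial>M)"
  proof (rule nn_integral_cong)
    fix w
    define r s where "r = R w" and "s = S w"
    have g1[measurable]: "(\<lambda>v. J (v - r)) \<in> borel_measurable borel" by measurable
    have g2[measurable]: "(\<lambda>v. ?p (J (v - r))) \<in> borel_measurable borel" by measurable
    have g4[measurable]: "(\<lambda>v. F (s + ?D (J (v - r)))) \<in> borel_measurable borel" by measurable
    have g5[measurable]: "(\<lambda>v. \<phi> v * ennreal (F (s + ?D (J (v - r))))) \<in> borel_measurable borel" by measurable
    \<comment> \<open>The integrand at \<xi> = x is this function at v = r + C x, so the affine
      substitution applies and leaves the factor 1/c.\<close>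
    let ?g = "\<lambda>v. ennreal (?p (J (v - r))) * (\<phi> v * ennreal (F (s + ?D (J (v - r)))))"
    have "(\<integral>\<^sup>+w'. \<Psi> (\<xi> w', w) \<partial>M) = (\<integral>\<^sup>+x. ennreal (?p x) * \<Psi> (x, w) \<partial>lborel)"
      by (rule distributed_nn_integral[OF p(4), symmetric]) (simp add: \<Psi>_def)
    also have "\<dots> = (\<integral>\<^sup>+x. ?g (r + ?C x) \<partial>lborel)" by (simp add: \<Psi>_def J r_def s_def)
    also have "\<dots> = (ennreal (1/c) * ennreal c) * (\<integral>\<^sup>+x. ?g (r + ?C x) \<partial>lborel)"
      by (simp only: ennreal_divide_mult_self[OF c(1)] mult_1)
    also have "\<dots> = ennreal (1/c) * (ennreal c * (\<integral>\<^sup>+x. ?g (r + ?C x) \<partial>lborel))" by (rule mult.assoc)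
    also have "ennreal c * (\<integral>\<^sup>+x. ?g (r + ?C x) \<partial>lborel) = (\<integral>\<^sup>+v. ?g v \<partial>lborel)"
    proof (rule nn_integral_affine_change[OF linC c(2), symmetric])
      show "?g \<in> borel_measurable borel"
        by (rule borel_measurable_times_ennreal[OF measurable_compose[OF g2 measurable_ennreal] g5])
    qed
    also have "ennreal (1/c) * (\<integral>\<^sup>+v. ?g v \<partial>lborel) = (\<integral>\<^sup>+v. ennreal (1/c) * ?g v \<partial>lborel)" by (rule nn_integral_cmult[symmetric]) measurable
    also have "\<dots> = (\<integral>\<^sup>+v. \<phi> v * ennreal (h v w) * ennreal (1/c) \<partial>lborel)"
      by (rule nn_integral_cong) (simp add: h_def ennreal_mult p(2) F(2) ac_simps r_def s_def)
    finally show "(\<integral>\<^sup>+w'. \<Psi> (\<xi> w', w) \<partial>M) = \<dots>" .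
  qed
  also have "\<dots> = (\<integral>\<^sup>+v. \<integral>\<^sup>+w. \<phi> v * ennreal (h v w) * ennreal (1/c) \<partial>M \<partial>lborel)"
  proof -
    interpret P: pair_sigma_finite lborel M ..
    show ?thesis by (rule P.Fubini') (use hm2 in measurable)
  qed
  also have "\<dots> = (\<integral>\<^sup>+v. \<phi> v * ennreal (disintegration_density \<xi> X Y F J c v) \<partial>lborel)"
  proof (rule nn_integral_cong)
    fix v
    have "(\<integral>\<^sup>+w. \<phi> v * ennreal (h v w) * ennreal (1/c) \<partial>M) = \<phi> v * (\<integral>\<^sup>+w. ennreal (h v w) \<partial>M) * ennreal (1/c)"
      by (simp add: nn_integral_multc nn_integral_cmult)
    also have "(\<integral>\<^sup>+w. ennreal (h v w) \<partial>M) = ennreal (expectation (h v))"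
      by (rule nn_integral_eq_integral[OF hi]) (use h0 in auto)
    also have "\<phi> v * ennreal (expectation (h v)) * ennreal (1/c) = \<phi> v * ennreal (disintegration_density \<xi> X Y F J c v)"
    proof -
      have "0 \<le> expectation (h v)" by (rule Bochner_Integration.integral_nonneg) (rule h0)
      then have "ennreal (expectation (h v)) * ennreal (1/c) = ennreal (expectation (h v) * (1/c))"
        using c(1) by (intro ennreal_mult[symmetric]) auto
      then show ?thesis unfolding dd by (simp only: mult.assoc) simp
    qed
    finally show "(\<integral>\<^sup>+w. \<phi> v * ennreal (h v w) * ennreal (1/c) \<partial>M) = \<phi> v * ennreal (disintegration_density \<xi> X Y F J c v)" .
  qed
  finally show "(\<integral>\<^sup>+w. \<phi> (X w) * ennreal (F (Y w)) \<partial>M) = (\<integral>\<^sup>+v. \<phi> v * ennreal (disintegration_density \<xi> X Y F J c v) \<partial>lborel)"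
    by (simp add: \<Psi>_def R_def S_def)
qed

text \<open>Both sides are densities of the measure A -> E(F(Y); X in A): one by conditioning
  through \<xi>, the other through X itself, where C and J are the identity and c = 1. Continuity
  upgrades agreement almost everywhere to agreement at each v.\<close>

lemma regression_identity_bounded:
  fixes \<xi> X :: "'w \<Rightarrow> 'a::euclidean_space" and Y :: "'w \<Rightarrow> 'c::euclidean_space"
  assumes \<xi>: "gvec \<xi>" and nd: "nondegenerate M \<xi>" and X: "gvec X" and ndX: "nondegenerate M X" and Y: "gvec Y"
    and J: "linear J" "\<And>x. J (regression_map M \<xi> X x) = x" "\<And>x. regression_map M \<xi> X (J x) = x"
    and c: "0 < c" "\<And>f. f \<in> borel_measurable borel \<Longrightarrow>
       (\<integral>\<^sup>+x. f x \<partial>lborel) = ennreal c * (\<integral>\<^sup>+x. f (regression_map M \<xi> X x) \<partial>lborel)"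
    and F: "continuous_on UNIV F" "\<And>y. 0 \<le> F y" "\<And>y. F y \<le> B"
  shows "disintegration_density \<xi> X Y F J c v = disintegration_density X X Y F (\<lambda>x. x) 1 v"
proof -
  note 1 = gaussian_disintegration[OF \<xi> nd X Y J c F]
  have id: "regression_map M X X = (\<lambda>x. x)" using regression_map_self[OF X ndX] by blast
  note 2 = gaussian_disintegration[OF X ndX X Y linear_ident _ _ _ _ F, of 1, unfolded id, simplified]
  let ?f = "disintegration_density \<xi> X Y F J c" and ?g = "disintegration_density X X Y F (\<lambda>x. x) 1"
  have m: "?f \<in> borel_measurable borel" "?g \<in> borel_measurable borel"
    using 1(1) 2(1) by (auto intro: borel_measurable_continuous_onI)
  have "density lborel (\<lambda>v. ennreal (?f v)) = density lborel (\<lambda>v. ennreal (?g v))"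
  proof (rule measure_eqI)
    fix A assume "A \<in> sets (density lborel (\<lambda>v. ennreal (?f v)))"
    then have A: "A \<in> sets borel" by simp
    have "(\<integral>\<^sup>+v. indicator A v * ennreal (?f v) \<partial>lborel) = (\<integral>\<^sup>+v. indicator A v * ennreal (?g v) \<partial>lborel)"
      using 1(3)[of "indicator A"] 2(3)[of "indicator A"] A by simp
    then show "emeasure (density lborel (\<lambda>v. ennreal (?f v))) A = emeasure (density lborel (\<lambda>v. ennreal (?g v))) A"
      using A m by (subst (1 2) emeasure_density) (auto simp: mult.commute)
  qed simp
  then have "AE v in lborel. ennreal (?f v) = ennreal (?g v)"
    using m by (intro sigma_finite_measure.density_unique[OF sigma_finite_lborel]) auto
  then have "AE v in lborel. ?f v = ?g v" by eventually_elim (simp add: ennreal_inj 1(2) 2(2))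
  moreover have "continuous_on UNIV ?f" "continuous_on UNIV ?g" using 1(1) 2(1) by auto
  ultimately show ?thesis by (intro continuous_AE_eq_imp_eq[of ?f ?g v])
qed

text \<open>The bounded case for the truncations min(F, n), followed by monotone convergence on both
  sides; this allows the determinant as weight and an infinite value.\<close>

lemma regression_identity:
  fixes \<xi> X :: "'w \<Rightarrow> 'a::euclidean_space" and Y :: "'w \<Rightarrow> 'c::euclidean_space"
  assumes \<xi>: "gvec \<xi>" and nd: "nondegenerate M \<xi>" and X: "gvec X" and ndX: "nondegenerate M X" and Y: "gvec Y"
    and J: "linear J" "\<And>x. J (regression_map M \<xi> X x) = x" "\<And>x. regression_map M \<xi> X (J x) = x"
    and c: "0 < c" "\<And>f. f \<in> borel_measurable borel \<Longrightarrow>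
       (\<integral>\<^sup>+x. f x \<partial>lborel) = ennreal c * (\<integral>\<^sup>+x. f (regression_map M \<xi> X x) \<partial>lborel)"
    and F: "continuous_on UNIV F" "\<And>y. 0 \<le> F y"
  shows "(\<integral>\<^sup>+w. ennreal (continuous_density M \<xi> (J (v - (X w - regression_map M \<xi> X (\<xi> w)))) *
            (F ((Y w - regression_map M \<xi> Y (\<xi> w)) + regression_map M \<xi> Y (J (v - (X w - regression_map M \<xi> X (\<xi> w))))) / c)) \<partial>M) =
     gaussian_cond_exp M (\<lambda>y. ennreal (F y)) Y X v * ennreal (continuous_density M X v)"
proof -
  let ?C = "regression_map M \<xi> X" and ?D = "regression_map M \<xi> Y" and ?p = "continuous_density M \<xi>"
  let ?G = "\<lambda>w. (Y w - ?D (\<xi> w)) + ?D (J (v - (X w - ?C (\<xi> w))))"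
  let ?P = "\<lambda>w. ?p (J (v - (X w - ?C (\<xi> w))))"
  let ?B = "regression_map M X Y" and ?q = "continuous_density M X"
  let ?K = "\<lambda>w. (Y w - ?B (X w)) + ?B v"
  note p = continuous_density_props[OF \<xi> nd] and q = continuous_density_props[OF X ndX]
  have linC: "linear ?C" and linD: "linear ?D" using linear_regression_map[OF \<xi> nd] X Y by auto
  have linB: "linear ?B" by (rule linear_regression_map[OF X ndX Y])
  note [measurable] = linear_borel_measurable[OF linC] linear_borel_measurable[OF linD] linear_borel_measurable[OF J(1)]
    linear_borel_measurable[OF linB]
    borel_measurable_continuous_onI[OF F(1)] borel_measurable_continuous_onI[OF p(1)]
    gvec_measurable[OF X] gvec_measurable[OF \<xi>] gvec_measurable[OF Y]
  obtain b where b: "\<And>x. ?p x \<le> b" using p(3) by blast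
  define Fn where "Fn n y = min (F y) (real n)" for n y
  have Fn: "continuous_on UNIV (Fn n)" "0 \<le> Fn n y" "Fn n y \<le> real n" for n y
    unfolding Fn_def using F by (auto intro!: continuous_intros)
  have [measurable]: "Fn n \<in> borel_measurable borel" for n by (rule borel_measurable_continuous_onI[OF Fn(1)])
  have step: "(\<integral>\<^sup>+w. ennreal (?P w * (Fn n (?G w) / c)) \<partial>M) = (\<integral>\<^sup>+w. ennreal (Fn n (?K w)) \<partial>M) * ennreal (?q v)" for n
  proof -
    have "integrable M (\<lambda>w. ?P w * Fn n (?G w))"
      by (rule integrable_const_bound[where B="b * real n"])
        (auto simp: abs_mult p(2) Fn(2) b order_trans[OF p(2) b] intro!: mult_mono Fn(3))
    then have "(\<integral>\<^sup>+w. ennreal (?P w * (Fn n (?G w) / c)) \<partial>M) = ennreal (expectation (\<lambda>w. ?P w * Fn n (?G w) / c))"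
      using c(1) by (subst nn_integral_eq_integral[symmetric]) (auto simp: p(2) Fn(2))
    also have "\<dots> = ennreal (disintegration_density \<xi> X Y (Fn n) J c v)"
      unfolding disintegration_density_def Let_def by simp
    also have "\<dots> = ennreal (disintegration_density X X Y (Fn n) (\<lambda>x. x) 1 v)"
      by (simp add: regression_identity_bounded[OF \<xi> nd X ndX Y J c Fn])
    \<comment> \<open>The residual of X on itself is 0, so the density factor is the constant
      \<open>continuous_density M X v\<close> and leaves the expectation.\<close>
    also have "disintegration_density X X Y (Fn n) (\<lambda>x. x) 1 v = expectation (\<lambda>w. ?q v * Fn n (?K w))"
      unfolding disintegration_density_def Let_def by (simp add: regression_map_self[OF X ndX])
    also have "\<dots> = ?q v * expectation (\<lambda>w. Fn n (?K w))" by simp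
    also have "ennreal \<dots> = ennreal (?q v) * ennreal (expectation (\<lambda>w. Fn n (?K w)))"
      by (rule ennreal_mult[OF q(2)]) (auto intro!: Bochner_Integration.integral_nonneg Fn(2))
    also have "ennreal (expectation (\<lambda>w. Fn n (?K w))) = (\<integral>\<^sup>+w. ennreal (Fn n (?K w)) \<partial>M)"
      by (rule nn_integral_eq_integral[symmetric], rule integrable_const_bound[where B="real n"]) (use Fn(2,3) in auto)
    finally show ?thesis by (simp add: mult.commute)
  qed
  have inc: "incseq (\<lambda>n. ennreal (a * (Fn n y / d)))" if "a \<ge> 0" "d > 0" for a d y
    unfolding Fn_def incseq_def le_fun_def using that
    by (auto intro!: ennreal_leI mult_left_mono divide_right_mono)
  have sup: "(SUP n. ennreal (a * (Fn n y / d))) = ennreal (a * (F y / d))" if "a \<ge> 0" "d > 0" for a d y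
  proof (rule antisym)
    show "(SUP n. ennreal (a * (Fn n y / d))) \<le> ennreal (a * (F y / d))"
      using that by (intro SUP_least ennreal_leI mult_left_mono divide_right_mono) (auto simp: Fn_def)
    obtain n :: nat where "F y \<le> real n" using real_arch_simple by blast
    then have "F y = Fn n y" by (simp add: Fn_def)
    then show "ennreal (a * (F y / d)) \<le> (SUP n. ennreal (a * (Fn n y / d)))" by (metis SUP_upper UNIV_I)
  qed
  have "(\<integral>\<^sup>+w. ennreal (?P w * (F (?G w) / c)) \<partial>M) = (\<integral>\<^sup>+w. (SUP n. ennreal (?P w * (Fn n (?G w) / c))) \<partial>M)"
    by (simp only: sup[OF p(2) c(1)])
  also have "\<dots> = (SUP n. \<integral>\<^sup>+w. ennreal (?P w * (Fn n (?G w) / c)) \<partial>M)"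
    by (rule nn_integral_monotone_convergence_SUP) (use inc[OF p(2) c(1)] in \<open>auto simp: incseq_def le_fun_def\<close>)
  also have "\<dots> = (SUP n. (\<integral>\<^sup>+w. ennreal (Fn n (?K w)) \<partial>M) * ennreal (?q v))" by (simp only: step)
  also have "\<dots> = (SUP n. (\<integral>\<^sup>+w. ennreal (Fn n (?K w)) \<partial>M)) * ennreal (?q v)"
    by (rule SUP_mult_right_ennreal[symmetric])
  also have "(SUP n. (\<integral>\<^sup>+w. ennreal (Fn n (?K w)) \<partial>M)) = (\<integral>\<^sup>+w. (SUP n. ennreal (Fn n (?K w))) \<partial>M)"
    by (rule nn_integral_monotone_convergence_SUP[symmetric]) (use inc[of 1 1] in \<open>auto simp: incseq_def le_fun_def\<close>)
  also have "\<dots> = (\<integral>\<^sup>+w. ennreal (F (?K w)) \<partial>M)" using sup[of 1 1] by simp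
  also have "\<dots> = gaussian_cond_exp M (\<lambda>y. ennreal (F y)) Y X v" unfolding gaussian_cond_exp_def Let_def ..
  finally show ?thesis .
qed

end

section \<open>The area formula\<close>

text \<open>The change of variables theorems of \<open>HOL-Analysis\<close> are stated for \<open>real^'n\<close> with a well-ordered
  index type; this index type makes them available on every Euclidean space.\<close>

typedef (overloaded) 'a coord = "{..<DIM('a::euclidean_space)}"
  by (rule exI[of _ 0]) simp

instantiation coord :: (euclidean_space) wellorder
begin

definition less_eq_coord :: "'a coord \<Rightarrow> 'a coord \<Rightarrow> bool" where
  "less_eq_coord i j \<longleftrightarrow> Rep_coord i \<le> Rep_coord j"

definition less_coord :: "'a coord \<Rightarrow> 'a coord \<Rightarrow> bool" where
  "less_coord i j \<longleftrightarrow> Rep_coord i < Rep_coord j"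

instance
proof
  fix P :: "'a coord \<Rightarrow> bool" and a
  assume step: "\<And>x. (\<And>y. y < x \<Longrightarrow> P y) \<Longrightarrow> P x"
  show "P a"
    by (induction a rule: measure_induct_rule[where f=Rep_coord]) (rule step, simp add: less_coord_def)
qed (auto simp: less_eq_coord_def less_coord_def Rep_coord_inject)

end

lemma UNIV_coord: "(UNIV :: 'a::euclidean_space coord set) = Abs_coord ` {..<DIM('a)}"
  using type_definition.Abs_image[OF type_definition_coord] by auto

instance coord :: (euclidean_space) finite
  by standard (simp add: UNIV_coord)

lemma card_coord: "CARD('a::euclidean_space coord) = DIM('a)"
  by (simp add: type_definition.card[OF type_definition_coord])

definition coord_vec :: "'a::euclidean_space coord \<Rightarrow> 'a" where
  "coord_vec = (SOME e. bij_betw e UNIV Basis)"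

lemma bij_coord_vec: "bij_betw (coord_vec :: 'a::euclidean_space coord \<Rightarrow> 'a) UNIV Basis"
  unfolding coord_vec_def
  by (rule someI_ex[where P="\<lambda>e. bij_betw e UNIV Basis"], rule finite_same_card_bij) (simp_all add: card_coord)

lemma coord_vec_Basis[simp]: "coord_vec i \<in> Basis"
  using bij_coord_vec bij_betwE by blast

lemma inj_coord_vec: "inj coord_vec"
  by (rule bij_betw_imp_inj_on[OF bij_coord_vec])

lemma Basis_eq_range_coord_vec: "Basis = range coord_vec"
  by (rule bij_betw_imp_surj_on[OF bij_coord_vec, symmetric])

lemma inner_coord_vec: "coord_vec i \<bullet> coord_vec j = of_bool (i = j)"
  by (auto simp: inner_Basis inj_eq[OF inj_coord_vec])

lemma sum_coord_vec: "(\<Sum>i\<in>UNIV. f (coord_vec i)) = (\<Sum>b\<in>Basis. f b)"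
  by (rule sum.reindex_bij_betw[OF bij_coord_vec])

lemma prod_coord_vec: "(\<Prod>i\<in>UNIV. f (coord_vec i)) = (\<Prod>b\<in>Basis. f b)"
  by (rule prod.reindex_bij_betw[OF bij_coord_vec])

definition of_coords :: "real^('a::euclidean_space coord) \<Rightarrow> 'a" where
  "of_coords x = (\<Sum>i\<in>UNIV. (x $ i) *\<^sub>R coord_vec i)"

definition to_coords :: "'a::euclidean_space \<Rightarrow> real^('a coord)" where
  "to_coords y = (\<chi> i. y \<bullet> coord_vec i)"

lemma of_coords_inner[simp]: "of_coords x \<bullet> coord_vec i = x $ i"
  by (simp add: of_coords_def inner_sum_left inner_coord_vec)

lemma to_of_coords[simp]: "to_coords (of_coords x) = x"
  by (simp add: vec_eq_iff to_coords_def)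

lemma of_to_coords[simp]: "of_coords (to_coords y) = y"
  unfolding of_coords_def to_coords_def
  using sum_coord_vec[of "\<lambda>b. (y \<bullet> b) *\<^sub>R b"] by (simp add: euclidean_representation)

lemma to_coords_image: "to_coords ` S = of_coords -` S"
proof (intro equalityI subsetI)
  fix x assume "x \<in> of_coords -` S"
  then show "x \<in> to_coords ` S" by (intro image_eqI[of _ _ "of_coords x"]) auto
qed auto

lemma linear_of_coords: "linear of_coords"
  by (rule linearI) (simp_all add: of_coords_def scaleR_add_left sum.distrib scaleR_sum_right)

lemma linear_to_coords: "linear to_coords"
  by (rule linearI) (simp_all add: to_coords_def vec_eq_iff inner_add_left)

lemma bounded_linear_of_coords: "bounded_linear of_coords"
  and bounded_linear_to_coords: "bounded_linear to_coords"
  using linear_of_coords linear_to_coords by (simp_all add: linear_conv_bounded_linear)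

lemma of_coords_measurable[measurable]: "of_coords \<in> borel_measurable borel"
  and to_coords_measurable[measurable]: "to_coords \<in> borel_measurable borel"
  by (rule linear_borel_measurable[OF linear_of_coords], rule linear_borel_measurable[OF linear_to_coords])

lemma Basis_cart: "(Basis :: (real^'n) set) = range (\<lambda>i. axis i 1)"
  by (auto simp: Basis_vec_def)

lemma prod_Basis_cart: "(\<Prod>b\<in>Basis. f b) = (\<Prod>i\<in>UNIV. f (axis i (1::real)))"
  unfolding Basis_cart by (subst prod.reindex) (auto simp: inj_on_def axis_eq_axis)

lemma distr_of_coords: "distr lborel borel of_coords = (lborel :: 'a::euclidean_space measure)"
proof (rule lborel_eqI[symmetric])
  fix l u :: 'a assume le: "\<And>b. b \<in> Basis \<Longrightarrow> l \<bullet> b \<le> u \<bullet> b"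
  have "of_coords -` box l u = box (to_coords l) (to_coords u)"
  proof -
    have "x \<in> box l u \<longleftrightarrow> (\<forall>i. l \<bullet> coord_vec i < x \<bullet> coord_vec i \<and> x \<bullet> coord_vec i < u \<bullet> coord_vec i)" for x
      unfolding mem_box Basis_eq_range_coord_vec by simp
    then show ?thesis by (auto simp: mem_box_cart to_coords_def)
  qed
  then have "emeasure (distr lborel borel of_coords) (box l u) = emeasure lborel (box (to_coords l) (to_coords u))"
    by (subst emeasure_distr) auto
  also have "\<dots> = ennreal (\<Prod>b\<in>Basis. (to_coords u - to_coords l) \<bullet> b)"
    by (rule emeasure_lborel_box) (auto simp: Basis_cart to_coords_def inner_axis le)
  also have "(\<Prod>b\<in>Basis. (to_coords u - to_coords l) \<bullet> b) = (\<Prod>i\<in>UNIV. (u - l) \<bullet> coord_vec i)"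
    unfolding prod_Basis_cart by (simp add: inner_axis to_coords_def inner_diff_left)
  also have "\<dots> = (\<Prod>b\<in>Basis. (u - l) \<bullet> b)" by (rule prod_coord_vec)
  finally show "emeasure (distr lborel borel of_coords) (box l u) = ennreal (\<Prod>b\<in>Basis. (u - l) \<bullet> b)" .
qed simp

lemma nn_integral_of_coords:
  fixes f :: "'a::euclidean_space \<Rightarrow> ennreal"
  assumes [measurable]: "f \<in> borel_measurable borel"
  shows "(\<integral>\<^sup>+x. f (of_coords x) \<partial>lborel) = (\<integral>\<^sup>+x. f x \<partial>lborel)"
proof -
  have "(\<integral>\<^sup>+x. f x \<partial>lborel) = (\<integral>\<^sup>+x. f x \<partial>distr lborel borel of_coords)" by (simp add: distr_of_coords)
  also have "\<dots> = (\<integral>\<^sup>+x. f (of_coords x) \<partial>lborel)" by (subst nn_integral_distr) auto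
  finally show ?thesis by simp
qed

text \<open>The absolute Jacobian determinant of an endomorphism of an arbitrary Euclidean space.
  Rows and columns follow the same enumeration of the basis, so the arbitrary choice in
  \<open>coord_vec\<close> does not affect the value.\<close>

definition adet :: "('a::euclidean_space \<Rightarrow> 'a) \<Rightarrow> real" where
  "adet A = \<bar>det (\<chi> i j. A (coord_vec j) \<bullet> coord_vec i :: real^('a coord)^('a coord))\<bar>"

lemma adet_nonneg: "0 \<le> adet A" by (simp add: adet_def)

lemma of_coords_axis: "of_coords (axis j 1) = coord_vec j"
  unfolding of_coords_def axis_def
  by (simp add: if_distrib[of "\<lambda>c. c *\<^sub>R _"] sum.delta cong: if_cong)

lemma adet_matrix: "adet A = \<bar>det (matrix (to_coords \<circ> A \<circ> of_coords))\<bar>"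
  unfolding adet_def matrix_def by (simp add: of_coords_axis to_coords_def)

lemma linear_conj_coords: "linear A \<Longrightarrow> linear (to_coords \<circ> A \<circ> of_coords)"
  by (intro linear_compose linear_of_coords linear_to_coords)

lemma adet_compose:
  assumes "linear A" "linear B" shows "adet (\<lambda>x. A (B x)) = adet A * adet B"
proof -
  have "to_coords \<circ> (\<lambda>x. A (B x)) \<circ> of_coords = (to_coords \<circ> A \<circ> of_coords) \<circ> (to_coords \<circ> B \<circ> of_coords)"
    by (auto simp: fun_eq_iff)
  then show ?thesis unfolding adet_matrix
    by (simp only: matrix_compose[OF linear_conj_coords[OF assms(2)] linear_conj_coords[OF assms(1)]] det_mul abs_mult)
qed

lemma adet_eq_0_iff:
  assumes "linear A" shows "adet A = 0 \<longleftrightarrow> \<not> inj A"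
proof -
  have "inj (to_coords \<circ> A \<circ> of_coords) \<longleftrightarrow> inj A"
    unfolding inj_def comp_def by (metis of_to_coords to_of_coords)
  then show ?thesis using det_nz_iff_inj[OF linear_conj_coords[OF assms]] unfolding adet_matrix by auto
qed

lemma continuous_on_adet:
  assumes "\<And>h. continuous_on S (\<lambda>t. A t h)" shows "continuous_on S (\<lambda>t. adet (A t))"
  unfolding adet_def det_def by (simp, intro continuous_intros assms)

section \<open>F-sigma sets in Euclidean spaces\<close>

lemma fsigma_Int:
  fixes S :: "'a::euclidean_space set"
  assumes "fsigma S" "fsigma T" shows "fsigma (S \<inter> T)"
proof -
  obtain F G :: "nat \<Rightarrow> 'a set" where F: "\<And>n. closed (F n)" "S = (\<Union>n. F n)" and G: "\<And>n. closed (G n)" "T = (\<Union>n. G n)"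
    using assms fsigma.cases by metis
  have "S \<inter> T = (\<Union>n. (\<lambda>(i,j). F i \<inter> G j) (prod_decode n))"
  proof (intro equalityI subsetI)
    fix x assume "x \<in> S \<inter> T"
    then obtain i j where "x \<in> F i" "x \<in> G j" using F G by auto
    then show "x \<in> (\<Union>n. (\<lambda>(i,j). F i \<inter> G j) (prod_decode n))"
      by (intro UN_I[of "prod_encode (i, j)"]) auto
  next
    fix x assume "x \<in> (\<Union>n. (\<lambda>(i,j). F i \<inter> G j) (prod_decode n))"
    then obtain n where "x \<in> (\<lambda>(i,j). F i \<inter> G j) (prod_decode n)" by (rule UN_E)
    then show "x \<in> S \<inter> T" unfolding F(2) G(2) by (cases "prod_decode n") auto
  qed
  moreover have "closed ((\<lambda>(i,j). F i \<inter> G j) (prod_decode n))" for n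
    using F G by (auto split: prod.split)
  ultimately show ?thesis using fsigma.intros by metis
qed

lemma closed_imp_fsigma: "closed S \<Longrightarrow> fsigma S"
  using fsigma.intros[of "\<lambda>_. S"] by simp

lemma open_imp_fsigma:
  fixes S :: "'a::euclidean_space set"
  assumes "open S" shows "fsigma S"
proof -
  obtain C :: "nat \<Rightarrow> 'a set" where C: "\<And>n. compact (C n)" "\<Union>(range C) = S"
    using open_Union_compact_subsets[OF assms] by metis
  show ?thesis using fsigma.intros[of C, OF compact_imp_closed[OF C(1)]] C(2) by simp
qed

lemma fsigma_borel: "fsigma (S :: 'a::euclidean_space set) \<Longrightarrow> S \<in> sets borel"
  by (erule fsigma.cases) (simp add: borel_closed sets.countable_UN')

lemma fsigmaE_compact:
  fixes S :: "'a::euclidean_space set"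
  assumes "fsigma S" obtains K :: "nat \<Rightarrow> 'a set" where "\<And>n. compact (K n)" "S = (\<Union>n. K n)"
proof -
  obtain F :: "nat \<Rightarrow> 'a set" where "range F \<subseteq> Collect compact" "S = \<Union>(F ` UNIV)"
    using assms unfolding fsigma_Union_compact by auto
  then show ?thesis by (intro that[of F]) auto
qed

text \<open>An F-sigma set is a countable union of compact sets, and continuous images of compact
  sets are compact. Images of general Borel sets may fail to be Borel, which is why all pieces below
  are F-sigma.\<close>

lemma fsigma_continuous_image:
  fixes f :: "'a::euclidean_space \<Rightarrow> 'b::euclidean_space"
  assumes "fsigma S" "continuous_on S f" shows "fsigma (f ` S)"
proof -
  obtain K :: "nat \<Rightarrow> 'a set" where K: "\<And>n. compact (K n)" "S = (\<Union>n. K n)" using fsigmaE_compact[OF assms(1)] by metis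
  have "f ` S = (\<Union>n. f ` K n)" unfolding K(2) by blast
  moreover have "closed (f ` K n)" for n
    using K assms(2) by (intro compact_imp_closed compact_continuous_image) (auto intro: continuous_on_subset)
  ultimately show ?thesis using fsigma.intros[of "\<lambda>n. f ` K n"] by simp
qed

text \<open>Change of variables for an indicator. Boundedness of P, of its image and of the
  determinant makes both sides finite, so the statement about absolute integrability translates into
  nonnegative integrals.\<close>

lemma emeasure_image_cart:
  fixes g :: "real^'n::{finite,wellorder} \<Rightarrow> real^'n::_"
  assumes P: "P \<in> sets borel" "bounded P" and gP: "g ` P \<in> sets borel" "bounded (g ` P)"
    and der: "\<And>x. x \<in> P \<Longrightarrow> (g has_derivative g' x) (at x within P)" and inj: "inj_on g P"
    and c: "\<And>x. x \<in> P \<Longrightarrow> \<bar>det (matrix (g' x))\<bar> \<le> c"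
    and m: "(\<lambda>x. indicator P x * (\<bar>det (matrix (g' x))\<bar> * indicator B (g x))) \<in> borel_measurable borel"
    and B[measurable]: "B \<in> sets borel"
  shows "emeasure lborel (B \<inter> g ` P) = (\<integral>\<^sup>+x. ennreal (indicator P x * (\<bar>det (matrix (g' x))\<bar> * indicator B (g x))) \<partial>lborel)"
proof -
  note P(1)[measurable] gP(1)[measurable]
  let ?h = "\<lambda>x. indicator P x * (\<bar>det (matrix (g' x))\<bar> * indicator B (g x)) :: real"
  \<comment> \<open>The change of variables theorem integrates vector-valued functions, so the
    indicator is placed in a one-dimensional vector space.\<close>
  let ?f = "\<lambda>x. vec (indicator B x) :: real^1"
  have c0: "?h x \<le> \<bar>c\<bar> * indicator P x" "0 \<le> ?h x" for x using c[of x] by (auto simp: indicator_def)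
  have hfin: "(\<integral>\<^sup>+x. ennreal (?h x) \<partial>lborel) < \<infinity>"
  proof -
    have "(\<integral>\<^sup>+x. ennreal (?h x) \<partial>lborel) \<le> (\<integral>\<^sup>+x. ennreal \<bar>c\<bar> * indicator P x \<partial>lborel)"
    proof (rule nn_integral_mono)
      fix x
      have "ennreal (?h x) \<le> ennreal (\<bar>c\<bar> * indicator P x)" by (rule ennreal_leI[OF c0(1)])
      also have "\<dots> = ennreal \<bar>c\<bar> * indicator P x" by (simp add: indicator_def)
      finally show "ennreal (?h x) \<le> ennreal \<bar>c\<bar> * indicator P x" .
    qed
    also have "\<dots> = ennreal \<bar>c\<bar> * emeasure lborel P" by (simp add: nn_integral_cmult)
    also have "\<dots> < \<infinity>" using emeasure_bounded_finite[OF P(2)] by (simp add: ennreal_mult_less_top)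
    finally show ?thesis .
  qed
  have hint: "integrable lborel ?h"
    using m c0 hfin by (intro integrableI_nonneg) auto
  have tf: "(\<integral>\<^sup>+x. ennreal (indicator (B \<inter> g ` P) x) \<partial>lborel) < \<infinity>"
    using emeasure_bounded_finite[OF bounded_subset[OF gP(2)], of "B \<inter> g ` P"] by (simp add: ennreal_indicator)
  have "(\<lambda>x. \<bar>det (matrix (g' x))\<bar> *\<^sub>R ?f (g x)) absolutely_integrable_on P"
  proof (rule absolutely_integrable_componentwise)
    fix b :: "real^1" assume "b \<in> Basis"
    then have b: "b = axis 1 1" by (auto simp: Basis_cart)
    have "(\<lambda>x. \<bar>det (matrix (g' x))\<bar> * indicator B (g x)) absolutely_integrable_on P"
      unfolding set_integrable_def real_scaleR_def using hint integrable_completion[of ?h lborel] m by simp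
    then show "(\<lambda>x. (\<bar>det (matrix (g' x))\<bar> *\<^sub>R ?f (g x)) \<bullet> b) absolutely_integrable_on P"
      by (simp add: b inner_axis)
  qed
  then have *: "?f absolutely_integrable_on g ` P \<and> integral (g ` P) ?f = integral P (\<lambda>x. \<bar>det (matrix (g' x))\<bar> *\<^sub>R ?f (g x))"
    using has_absolute_integral_change_of_variables[of P g g' ?f "integral P (\<lambda>x. \<bar>det (matrix (g' x))\<bar> *\<^sub>R ?f (g x))"]
      der inj sets_completionI_sets[of P lborel] P(1) by simp
  have i1: "?f integrable_on g ` P" using * set_lebesgue_integral_eq_integral(1) by blast
  have i2: "(\<lambda>x. \<bar>det (matrix (g' x))\<bar> *\<^sub>R ?f (g x)) integrable_on P"
    using \<open>(\<lambda>x. \<bar>det (matrix (g' x))\<bar> *\<^sub>R ?f (g x)) absolutely_integrable_on P\<close> set_lebesgue_integral_eq_integral(1) by blast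
  have "integral (g ` P) (\<lambda>x. ?f x $ 1) = integral P (\<lambda>x. (\<bar>det (matrix (g' x))\<bar> *\<^sub>R ?f (g x)) $ 1)"
    unfolding integral_component_eq_cart[OF i1] integral_component_eq_cart[OF i2] using * by simp
  then have eq: "integral (g ` P) (indicator B) = integral P (\<lambda>x. \<bar>det (matrix (g' x))\<bar> * indicator B (g x))"
    by simp
  have "emeasure lborel (B \<inter> g ` P) = (\<integral>\<^sup>+x. ennreal (indicator (B \<inter> g ` P) x) \<partial>lborel)"
    by (simp add: ennreal_indicator)
  also have "\<dots> = ennreal (integral UNIV (indicator (B \<inter> g ` P)))"
    by (rule nn_integral_lborel_eq_integral) (use tf in auto)
  also have "integral UNIV (indicator (B \<inter> g ` P)) = integral (g ` P) (indicator B :: _ \<Rightarrow> real)"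
    by (subst integral_restrict_UNIV[symmetric]) (auto intro!: integral_cong simp: indicator_def)
  also have "\<dots> = integral UNIV ?h"
    unfolding eq by (subst integral_restrict_UNIV[symmetric]) (auto intro!: integral_cong simp: indicator_def)
  also have "ennreal \<dots> = (\<integral>\<^sup>+x. ennreal (?h x) \<partial>lborel)"
    by (rule nn_integral_lborel_eq_integral[symmetric]) (use m c0 hfin in auto)
  finally show ?thesis .
qed

text \<open>Transport of the coordinate version along the linear isometry \<open>to_coords\<close>;
  the compact set K supplies the bound on the Jacobian.\<close>

lemma emeasure_image_euclidean:
  fixes g :: "'a::euclidean_space \<Rightarrow> 'a"
  assumes P: "fsigma P" "P \<subseteq> K" and K: "compact K" "K \<subseteq> V" and V: "open V"
    and der: "\<And>x. x \<in> V \<Longrightarrow> (g has_derivative g' x) (at x)"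
    and cont: "\<And>h. continuous_on V (\<lambda>x. g' x h)" and inj: "inj_on g P"
    and B[measurable]: "B \<in> sets borel"
  shows "emeasure lborel (B \<inter> g ` P) = (\<integral>\<^sup>+x. ennreal (indicator P x * (adet (g' x) * indicator B (g x))) \<partial>lborel)"
proof -
  let ?g = "to_coords \<circ> g \<circ> of_coords" and ?g' = "\<lambda>x. to_coords \<circ> g' (of_coords x) \<circ> of_coords"
  let ?P = "to_coords ` P"
  have Pv: "?P = of_coords -` P" by (rule to_coords_image)
  have cg: "continuous_on V g" using der by (meson continuous_at_imp_continuous_on has_derivative_continuous)
  have clin: "continuous_on S to_coords" "continuous_on S' of_coords" for S S'
    by (auto intro: linear_continuous_on bounded_linear_to_coords bounded_linear_of_coords)
  have Pb: "P \<in> sets borel" by (rule fsigma_borel[OF P(1)])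
  have Vb[measurable]: "V \<in> sets borel" using V by simp
  note Pb[measurable]
  have fgP: "fsigma (g ` P)" by (rule fsigma_continuous_image[OF P(1) continuous_on_subset[OF cg]]) (use P K in auto)
  have gPeq: "?g ` ?P = to_coords ` (g ` P)" by (auto simp: image_image)
  \<comment> \<open>Continuity of g and its derivative is known on V only; cut off to 0 outside V
    they become Borel on the whole space and are unchanged on P.\<close>
  have am: "(\<lambda>x. indicator V x *\<^sub>R adet (g' x)) \<in> borel_measurable borel"
    by (rule borel_measurable_continuous_on_indicator[OF _ continuous_on_adet[OF cont]]) simp
  have gm: "(\<lambda>x. indicator V x *\<^sub>R g x) \<in> borel_measurable borel"
    by (rule borel_measurable_continuous_on_indicator[OF _ cg]) simp
  have hm[measurable]: "(\<lambda>x. indicator P x * (adet (g' x) * indicator B (g x))) \<in> borel_measurable borel"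
  proof -
    have "(\<lambda>x. indicator P x * ((indicator V x *\<^sub>R adet (g' x)) * indicator B (indicator V x *\<^sub>R g x))) \<in> borel_measurable borel"
      using am gm by measurable
    moreover have "(\<lambda>x. indicator P x * ((indicator V x *\<^sub>R adet (g' x)) * indicator B (indicator V x *\<^sub>R g x))) =
       (\<lambda>x. indicator P x * (adet (g' x) * indicator B (g x)) :: real)"
      using P K by (intro ext) (auto simp: indicator_def)
    ultimately show ?thesis by simp
  qed
  have "continuous_on K (\<lambda>x. adet (g' x))" by (rule continuous_on_adet[OF continuous_on_subset[OF cont K(2)]])
  then have "bounded ((\<lambda>x. adet (g' x)) ` K)" by (intro compact_imp_bounded compact_continuous_image K(1))
  then obtain c where c': "\<forall>y\<in>(\<lambda>x. adet (g' x)) ` K. norm y \<le> c" unfolding bounded_iff by blast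
  have c: "adet (g' x) \<le> c" if "x \<in> K" for x using c' that by force
  have B': "to_coords ` B \<in> sets borel"
  proof -
    show ?thesis using measurable_sets[OF of_coords_measurable B] by (simp add: to_coords_image)
  qed
  have ind: "indicator (to_coords ` S) (to_coords y) = (indicator S y :: real)" for S :: "'a set" and y
    by (simp add: to_coords_image indicator_def)
  have ind': "indicator ?P x = (indicator P (of_coords x) :: real)" for x
    unfolding Pv by (auto simp: indicator_def)
  have e: "indicator ?P x * (\<bar>det (matrix (?g' x))\<bar> * indicator (to_coords ` B) (?g x)) =
     indicator P (of_coords x) * (adet (g' (of_coords x)) * indicator B (g (of_coords x)))" for x
    by (simp add: adet_matrix ind ind')
  have "emeasure lborel (to_coords ` B \<inter> ?g ` ?P) = (\<integral>\<^sup>+x. ennreal (indicator ?P x * (\<bar>det (matrix (?g' x))\<bar> * indicator (to_coords ` B) (?g x))) \<partial>lborel)"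
  proof (rule emeasure_image_cart[where c=c])
    show "?P \<in> sets borel" unfolding Pv using measurable_sets[OF of_coords_measurable Pb] by simp
    show "bounded ?P" using compact_imp_bounded[OF K(1)] P(2) bounded_subset
      by (intro bounded_linear_image[OF _ bounded_linear_to_coords]) blast
    show "?g ` ?P \<in> sets borel" unfolding gPeq by (intro fsigma_borel fsigma_continuous_image fgP clin)
    have "bounded (g ` K)" by (intro compact_imp_bounded compact_continuous_image K(1) continuous_on_subset[OF cg K(2)])
    then show "bounded (?g ` ?P)" unfolding gPeq
      by (intro bounded_linear_image[OF _ bounded_linear_to_coords]) (use P(2) in \<open>auto intro: bounded_subset\<close>)
    show "(?g has_derivative ?g' x) (at x within ?P)" if "x \<in> ?P" for x
    proof -
      have "of_coords x \<in> V" using that P K by auto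
      then have "((\<lambda>x. to_coords (g (of_coords x))) has_derivative (\<lambda>h. to_coords (g' (of_coords x) (of_coords h)))) (at x within ?P)"
        by (intro bounded_linear.has_derivative[OF bounded_linear_to_coords]
          has_derivative_compose[OF bounded_linear_imp_has_derivative[OF bounded_linear_of_coords] der])
      then show ?thesis by (simp add: comp_def)
    qed
    show "inj_on ?g ?P"
    proof (rule inj_onI)
      fix x y assume xy: "x \<in> ?P" "y \<in> ?P" "?g x = ?g y"
      then have "of_coords (?g x) = of_coords (?g y)" by simp
      then have "of_coords x = of_coords y" using inj xy(1,2) unfolding inj_on_def Pv by simp
      then have "to_coords (of_coords x) = to_coords (of_coords y)" by simp
      then show "x = y" by simp
    qed
    show "\<bar>det (matrix (?g' x))\<bar> \<le> c" if "x \<in> ?P" for x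
      unfolding adet_matrix[symmetric] by (rule c) (use that P in auto)
    show "(\<lambda>x. indicator ?P x * (\<bar>det (matrix (?g' x))\<bar> * indicator (to_coords ` B) (?g x))) \<in> borel_measurable borel"
      unfolding e by (rule measurable_compose[OF of_coords_measurable hm])
  qed (rule B')
  also have "\<dots> = (\<integral>\<^sup>+x. ennreal (indicator P x * (adet (g' x) * indicator B (g x))) \<partial>lborel)"
    unfolding e by (rule nn_integral_of_coords) measurable
  also have "to_coords ` B \<inter> ?g ` ?P = of_coords -` (B \<inter> g ` P)"
    by (subst gPeq, subst to_coords_image, subst to_coords_image) blast
  also have "emeasure lborel (of_coords -` (B \<inter> g ` P)) = emeasure lborel (B \<inter> g ` P)"
  proof -
    have "emeasure (distr lborel borel of_coords) (B \<inter> g ` P) = emeasure lborel (of_coords -` (B \<inter> g ` P) \<inter> space lborel)"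
      by (rule emeasure_distr) (use fsigma_borel[OF fgP] in auto)
    then show ?thesis unfolding distr_of_coords by simp
  qed
  finally show ?thesis .
qed

lemma negligible_critical_values:
  fixes g :: "'a::euclidean_space \<Rightarrow> 'a"
  assumes der: "\<And>x. x \<in> S \<Longrightarrow> (g has_derivative g' x) (at x)"
    and sing: "\<And>x. x \<in> S \<Longrightarrow> adet (g' x) = 0"
  shows "negligible (g ` S)"
proof -
  let ?g = "to_coords \<circ> g \<circ> of_coords" and ?g' = "\<lambda>x. to_coords \<circ> g' (of_coords x) \<circ> of_coords"
  have "negligible (?g ` (to_coords ` S))"
  proof (rule baby_Sard)
    fix x assume x: "x \<in> to_coords ` S"
    then have xS: "of_coords x \<in> S" by auto
    have "((\<lambda>x. to_coords (g (of_coords x))) has_derivative (\<lambda>h. to_coords (g' (of_coords x) (of_coords h)))) (at x within to_coords ` S)"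
      by (intro bounded_linear.has_derivative[OF bounded_linear_to_coords]
          has_derivative_compose[OF bounded_linear_imp_has_derivative[OF bounded_linear_of_coords] der[OF xS]])
    then show "(?g has_derivative ?g' x) (at x within to_coords ` S)" by (simp add: comp_def)
    have "det (matrix (?g' x)) = 0" using sing[OF xS] unfolding adet_matrix by simp
    then show "rank (matrix (?g' x)) < CARD('a coord)" by (simp add: det_eq_0_rank)
  qed simp
  then have "negligible (of_coords ` (?g ` (to_coords ` S)))"
    by (rule negligible_differentiable_image_negligible[rotated])
      (auto simp: card_coord intro: linear_imp_differentiable_on linear_of_coords)
  then show ?thesis by (simp add: image_image)
qed

text \<open>The formula for sets B says that two measures coincide, so they integrate every
  nonnegative \<phi> alike.\<close>

lemma area_formula_injective:
  fixes g :: "'a::euclidean_space \<Rightarrow> 'a"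
  assumes P: "fsigma P" "P \<subseteq> K" and K: "compact K" "K \<subseteq> V" and V: "open V"
    and der: "\<And>x. x \<in> V \<Longrightarrow> (g has_derivative g' x) (at x)"
    and cont: "\<And>h. continuous_on V (\<lambda>x. g' x h)" and inj: "inj_on g P"
    and \<phi>[measurable]: "\<phi> \<in> borel_measurable borel"
  shows "(\<integral>\<^sup>+x. \<phi> x * indicator (g ` P) x \<partial>lborel) = (\<integral>\<^sup>+t. indicator P t * (ennreal (adet (g' t)) * \<phi> (g t)) \<partial>lborel)"
proof -
  have cg: "continuous_on V g" using der by (meson continuous_at_imp_continuous_on has_derivative_continuous)
  have Pb[measurable]: "P \<in> sets borel" by (rule fsigma_borel[OF P(1)])
  have Vb[measurable]: "V \<in> sets borel" using V by simp
  have gPb[measurable]: "g ` P \<in> sets borel"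
    by (rule fsigma_borel[OF fsigma_continuous_image[OF P(1) continuous_on_subset[OF cg]]]) (use P K in auto)
  define a where "a x = indicator V x *\<^sub>R adet (g' x)" for x
  define g0 where "g0 x = indicator V x *\<^sub>R g x" for x
  have [measurable]: "a \<in> borel_measurable borel" unfolding a_def
    by (rule borel_measurable_continuous_on_indicator[OF _ continuous_on_adet[OF cont]]) simp
  have [measurable]: "g0 \<in> borel_measurable borel" unfolding g0_def
    by (rule borel_measurable_continuous_on_indicator[OF _ cg]) simp
  have PV: "x \<in> P \<Longrightarrow> x \<in> V" for x using P K by auto
  have "density lborel (indicator (g ` P)) = distr (density lborel (\<lambda>t. indicator P t * ennreal (a t))) borel g0"
  proof (rule measure_eqI)
    fix B assume "B \<in> sets (density lborel (indicator (g ` P)))"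
    then have B[measurable]: "B \<in> sets borel" by simp
    have "emeasure (density lborel (indicator (g ` P))) B = (\<integral>\<^sup>+x. indicator (g ` P) x * indicator B x \<partial>lborel)"
      by (subst emeasure_density) auto
    also have "\<dots> = (\<integral>\<^sup>+x. indicator (B \<inter> g ` P) x \<partial>lborel)" by (intro nn_integral_cong) (auto simp: indicator_def)
    also have "\<dots> = emeasure lborel (B \<inter> g ` P)" by (rule nn_integral_indicator) simp
    also have "\<dots> = (\<integral>\<^sup>+x. ennreal (indicator P x * (adet (g' x) * indicator B (g x))) \<partial>lborel)"
      by (rule emeasure_image_euclidean[OF P K V der cont inj B])
    also have "\<dots> = (\<integral>\<^sup>+x. indicator P x * ennreal (a x) * indicator (g0 -` B \<inter> space (density lborel (\<lambda>t. indicator P t * ennreal (a t)))) x \<partial>lborel)"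
      by (intro nn_integral_cong) (auto simp: indicator_def a_def g0_def dest: PV)
    also have "\<dots> = emeasure (density lborel (\<lambda>t. indicator P t * ennreal (a t))) (g0 -` B \<inter> space (density lborel (\<lambda>t. indicator P t * ennreal (a t))))"
      by (rule emeasure_density[symmetric]) measurable
    also have "\<dots> = emeasure (distr (density lborel (\<lambda>t. indicator P t * ennreal (a t))) borel g0) B"
      by (rule emeasure_distr[symmetric]) auto
    finally show "emeasure (density lborel (indicator (g ` P))) B = emeasure (distr (density lborel (\<lambda>t. indicator P t * ennreal (a t))) borel g0) B" .
  qed simp
  then have "(\<integral>\<^sup>+x. \<phi> x \<partial>density lborel (indicator (g ` P))) = (\<integral>\<^sup>+x. \<phi> x \<partial>distr (density lborel (\<lambda>t. indicator P t * ennreal (a t))) borel g0)" by simp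
  also have "\<dots> = (\<integral>\<^sup>+t. indicator P t * ennreal (a t) * \<phi> (g0 t) \<partial>lborel)"
    by (subst nn_integral_distr, simp, simp, subst nn_integral_density) auto
  also have "\<dots> = (\<integral>\<^sup>+t. indicator P t * (ennreal (adet (g' t)) * \<phi> (g t)) \<partial>lborel)"
    by (intro nn_integral_cong) (auto simp: indicator_def a_def g0_def dest: PV)
  also have "(\<integral>\<^sup>+x. \<phi> x \<partial>density lborel (indicator (g ` P))) = (\<integral>\<^sup>+x. \<phi> x * indicator (g ` P) x \<partial>lborel)"
    by (subst nn_integral_density) (auto simp: mult.commute)
  finally show ?thesis .
qed

lemma locally_injective_at_regular:
  fixes g :: "'a::euclidean_space \<Rightarrow> 'a"
  assumes V: "open V" "a \<in> V" and der: "\<And>x. x \<in> V \<Longrightarrow> (g has_derivative g' x) (at x)"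
    and cont: "\<And>h. continuous_on V (\<lambda>x. g' x h)" and reg: "adet (g' a) \<noteq> 0"
  obtains r where "r > 0" "cball a r \<subseteq> V" "inj_on g (cball a r)"
proof -
  have bl: "bounded_linear (g' x)" if "x \<in> V" for x using der[OF that] by (rule has_derivative_bounded_linear)
  have lin: "linear (g' a)" using bl[OF V(2)] by (simp add: linear_conv_bounded_linear)
  have inj: "inj (g' a)" using reg adet_eq_0_iff[OF lin] by simp
  have on: "\<exists>d>0. \<forall>x. dist a x < d \<longrightarrow> onorm (\<lambda>v. g' x v - g' a v) < e" if e: "e > 0" for e
  proof -
    \<comment> \<open>The sum over the basis dominates the operator norm, so continuity in each
      fixed direction suffices for the local injectivity criterion.\<close>
    let ?s = "\<lambda>x. \<Sum>b\<in>Basis. norm (g' x b - g' a b)"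
    have "continuous_on V ?s" by (intro continuous_intros cont)
    then have "isCont ?s a" using V by (simp add: continuous_on_eq_continuous_at)
    then have "eventually (\<lambda>x. ?s x < e) (at a)" using e by (auto simp: isCont_def dest!: order_tendstoD(2)[of _ _ _ e])
    then obtain d where d: "d > 0" "\<And>x. x \<noteq> a \<Longrightarrow> dist x a < d \<Longrightarrow> ?s x < e" unfolding eventually_at by auto
    obtain d' where d': "d' > 0" "ball a d' \<subseteq> V" using V open_contains_ball by blast
    have "onorm (\<lambda>v. g' x v - g' a v) < e" if x: "dist a x < min d d'" for x
    proof -
      have "x \<in> V" using x d' by auto
      then have "onorm (\<lambda>v. g' x v - g' a v) \<le> ?s x"
        by (intro onorm_componentwise bounded_linear_sub bl V(2))
      also have "?s x < e" using d(2)[of x] x e by (cases "x = a") (auto simp: dist_commute)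
      finally show ?thesis .
    qed
    then show ?thesis using d(1) d'(1) by (intro exI[of _ "min d d'"]) auto
  qed
  have "linear (inv (g' a))" by (rule inj_linear_imp_inv_linear[OF lin inj])
  then have bi: "bounded_linear (inv (g' a))" by (simp add: linear_conv_bounded_linear)
  obtain r where r: "r > 0" "ball a r \<subseteq> V" "inj_on g (ball a r)"
    using has_derivative_locally_injective[OF V(2,1) bi inv_o_cancel[OF inj] der on] by blast
  have "cball a (r/2) \<subseteq> ball a r" using r(1) by auto
  then show ?thesis using r by (intro that[of "r/2"]) (auto intro: inj_on_subset)
qed

text \<open>On the open set Q of regular points g is locally injective; countably many balls cover
  Q, and cutting B along them gives disjoint pieces on which the multiplicities are 0 or 1 and add
  up. Critical points contribute to neither side: their values form a null set by Sard, and their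
  Jacobian is 0.\<close>

theorem area_formula:
  fixes g :: "'a::euclidean_space \<Rightarrow> 'a"
  assumes V: "open V" and der: "\<And>x. x \<in> V \<Longrightarrow> (g has_derivative g' x) (at x)"
    and cont: "\<And>h. continuous_on V (\<lambda>x. g' x h)"
    and B: "fsigma B" "B \<subseteq> V" and \<phi>[measurable]: "\<phi> \<in> borel_measurable borel"
  shows "(\<integral>\<^sup>+x. \<phi> x * emeasure (count_space UNIV) {t\<in>B. g t = x} \<partial>lborel) =
    (\<integral>\<^sup>+t. indicator B t * (ennreal (adet (g' t)) * \<phi> (g t)) \<partial>lborel)"
proof -
  define Q where "Q = V \<inter> (\<lambda>t. adet (g' t)) -` (- {0})"
  have Qo: "open Q" unfolding Q_def
    by (rule continuous_open_preimage[OF continuous_on_adet[OF cont] V]) auto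
  have cg: "continuous_on V g" using der by (meson continuous_at_imp_continuous_on has_derivative_continuous)
  have Bb[measurable]: "B \<in> sets borel" by (rule fsigma_borel[OF B(1)])
  have Vb[measurable]: "V \<in> sets borel" using V by simp
  \<comment> \<open>Injectivity on the closed ball puts each piece inside a compact subset of Q, as
    the injective case requires.\<close>
  define \<F> where "\<F> = {ball t r | t r. r > 0 \<and> cball t r \<subseteq> Q \<and> inj_on g (cball t r)}"
  have "\<Union>\<F> = Q"
  proof (intro equalityI subsetI)
    fix t assume t: "t \<in> Q"
    then have "adet (g' t) \<noteq> 0" by (simp add: Q_def)
    have derQ: "(g has_derivative g' x) (at x)" if "x \<in> Q" for x using that der by (simp add: Q_def)
    have contQ: "continuous_on Q (\<lambda>x. g' x h)" for h
      by (rule continuous_on_subset[OF cont]) (simp add: Q_def)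
    obtain r where r: "r > 0" "cball t r \<subseteq> Q" "inj_on g (cball t r)"
      using locally_injective_at_regular[OF Qo t derQ contQ \<open>adet (g' t) \<noteq> 0\<close>] by blast
    then have "ball t r \<in> \<F>" unfolding \<F>_def by blast
    then show "t \<in> \<Union>\<F>" using r(1) by (intro UnionI[of "ball t r"]) auto
  next
    fix t assume "t \<in> \<Union>\<F>"
    then show "t \<in> Q" unfolding \<F>_def using ball_subset_cball by blast
  qed
  moreover obtain \<F>' where F': "\<F>' \<subseteq> \<F>" "countable \<F>'" "\<Union>\<F>' = \<Union>\<F>"
  proof -
    have "open S" if "S \<in> \<F>" for S using that unfolding \<F>_def by auto
    from Lindelof[OF this] show ?thesis using that by blast
  qed
  ultimately have UF: "\<Union>\<F>' = Q" by simp
  define D where "D n = (if \<F>' = {} then {} else from_nat_into \<F>' n)" for n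
  have UD: "(\<Union>n. D n) = Q"
  proof (cases "\<F>' = {}")
    case False
    then have "range D = \<F>'" using range_from_nat_into[OF False F'(2)] by (simp add: D_def[abs_def])
    then show ?thesis using UF by simp
  qed (use UF in \<open>simp add: D_def\<close>)
  have Dn: "\<exists>K. compact K \<and> D n \<subseteq> K \<and> K \<subseteq> Q \<and> inj_on g K \<and> open (D n)" for n
  proof (cases "\<F>' = {}")
    case False
    then have "D n \<in> \<F>" using from_nat_into[OF False, of n] F'(1) by (auto simp: D_def)
    then obtain t r where "D n = ball t r" "cball t r \<subseteq> Q" "inj_on g (cball t r)" unfolding \<F>_def by blast
    then show ?thesis by (intro exI[of _ "cball t r"]) auto
  qed (auto simp: D_def)
  define P where "P n = B \<inter> disjointed D n" for n
  have Pf: "fsigma (P n)" for n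
  proof -
    have "disjointed D n = D n \<inter> - (\<Union>i<n. D i)" by (auto simp: disjointed_def)
    moreover have "closed (- (\<Union>i<n. D i))" using Dn by (intro closed_Compl open_UN) auto
    moreover have "open (D n)" using Dn by blast
    ultimately have "fsigma (disjointed D n)" by (simp only: fsigma_Int[OF open_imp_fsigma closed_imp_fsigma])
    then show ?thesis unfolding P_def by (rule fsigma_Int[OF B(1)])
  qed
  have disjP: "disjoint_family P"
    using disjoint_family_disjointed[of D] unfolding P_def disjoint_family_on_def by blast
  have UP: "(\<Union>n. P n) = B \<inter> Q" unfolding P_def using UN_disjointed_eq[of D] UD by auto
  have piece: "(\<integral>\<^sup>+x. \<phi> x * indicator (g ` P n) x \<partial>lborel) = (\<integral>\<^sup>+t. indicator (P n) t * (ennreal (adet (g' t)) * \<phi> (g t)) \<partial>lborel)"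
    and injP: "inj_on g (P n)" and gPb: "g ` P n \<in> sets borel" and Pb: "P n \<in> sets borel" for n
  proof -
    obtain K where K: "compact K" "D n \<subseteq> K" "K \<subseteq> Q" "inj_on g K" using Dn by blast
    have PK: "P n \<subseteq> K" unfolding P_def using K(2) disjointed_subset[of D n] by auto
    have KV: "K \<subseteq> V" using K(3) by (auto simp: Q_def)
    show inj: "inj_on g (P n)" using K(4) PK by (rule inj_on_subset)
    show "(\<integral>\<^sup>+x. \<phi> x * indicator (g ` P n) x \<partial>lborel) = (\<integral>\<^sup>+t. indicator (P n) t * (ennreal (adet (g' t)) * \<phi> (g t)) \<partial>lborel)"
      by (rule area_formula_injective[OF Pf PK K(1) KV V der cont inj \<phi>])
    show "g ` P n \<in> sets borel"
      by (rule fsigma_borel[OF fsigma_continuous_image[OF Pf continuous_on_subset[OF cg]]]) (use PK KV in auto)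
    show "P n \<in> sets borel" by (rule fsigma_borel[OF Pf])
  qed
  note [measurable] = gPb Pb
  have neg: "negligible (g ` (B - Q))"
    by (rule negligible_critical_values[of _ g g']) (use der B(2) in \<open>auto simp: Q_def\<close>)
  then have ae: "AE x in lborel. x \<notin> g ` (B - Q)"
    using AE_not_in[of "g ` (B - Q)" lebesgue] by (simp add: negligible_iff_null_sets AE_completion_iff)
  have cnt: "emeasure (count_space UNIV) {t\<in>B. g t = x} = (\<Sum>n. indicator (g ` P n) x)" if x: "x \<notin> g ` (B - Q)" for x
  proof -
    have "{t\<in>B. g t = x} = (\<Union>n. {t\<in>P n. g t = x})" using x UP by blast
    moreover have "disjoint_family (\<lambda>n. {t\<in>P n. g t = x})" using disjP unfolding disjoint_family_on_def by blast
    ultimately have "emeasure (count_space UNIV) {t\<in>B. g t = x} = (\<Sum>n. emeasure (count_space UNIV) {t\<in>P n. g t = x})"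
      by (subst suminf_emeasure) auto
    moreover have "emeasure (count_space UNIV) {t\<in>P n. g t = x} = indicator (g ` P n) x" for n
    proof (cases "x \<in> g ` P n")
      case True
      then obtain t where t: "t \<in> P n" "g t = x" by blast
      then have "{t\<in>P n. g t = x} = {t}" using injP[of n] by (auto simp: inj_on_def)
      then show ?thesis using True by simp
    next
      case False
      then have e: "{t\<in>P n. g t = x} = {}" by blast
      show ?thesis unfolding e using False by simp
    qed
    ultimately show ?thesis by simp
  qed
  define a where "a x = indicator V x *\<^sub>R adet (g' x)" for x
  define g0 where "g0 x = indicator V x *\<^sub>R g x" for x
  have am[measurable]: "a \<in> borel_measurable borel" unfolding a_def
    by (rule borel_measurable_continuous_on_indicator[OF _ continuous_on_adet[OF cont]]) simp
  have gm[measurable]: "g0 \<in> borel_measurable borel" unfolding g0_def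
    by (rule borel_measurable_continuous_on_indicator[OF _ cg]) simp
  have PV: "t \<in> P n \<Longrightarrow> t \<in> V" for t n using B(2) by (auto simp: P_def)
  have alt: "indicator (P n) t * (ennreal (adet (g' t)) * \<phi> (g t)) = indicator (P n) t * (ennreal (a t) * \<phi> (g0 t))" for n t
    using PV by (auto simp: indicator_def a_def g0_def)
  have "(\<integral>\<^sup>+x. \<phi> x * emeasure (count_space UNIV) {t\<in>B. g t = x} \<partial>lborel) = (\<integral>\<^sup>+x. (\<Sum>n. \<phi> x * indicator (g ` P n) x) \<partial>lborel)"
    by (rule nn_integral_cong_AE) (use ae in eventually_elim, simp add: cnt)
  also have "\<dots> = (\<Sum>n. \<integral>\<^sup>+x. \<phi> x * indicator (g ` P n) x \<partial>lborel)" by (rule nn_integral_suminf) measurable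
  also have "\<dots> = (\<Sum>n. \<integral>\<^sup>+t. indicator (P n) t * (ennreal (a t) * \<phi> (g0 t)) \<partial>lborel)" by (simp only: piece alt)
  also have "\<dots> = (\<integral>\<^sup>+t. (\<Sum>n. indicator (P n) t * (ennreal (a t) * \<phi> (g0 t))) \<partial>lborel)" by (rule nn_integral_suminf[symmetric]) measurable
  also have "\<dots> = (\<integral>\<^sup>+t. indicator B t * (ennreal (adet (g' t)) * \<phi> (g t)) \<partial>lborel)"
  proof (rule nn_integral_cong)
    fix t
    have "(\<Sum>n. indicator (P n) t * (ennreal (a t) * \<phi> (g0 t))) = (\<Sum>n. indicator (P n) t) * (ennreal (a t) * \<phi> (g0 t))"
      by (rule ennreal_suminf_multc)
    also have "(\<Sum>n. indicator (P n) t :: ennreal) = indicator (B \<inter> Q) t"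
      using suminf_indicator[OF disjP, of t] unfolding UP .
    also have "indicator (B \<inter> Q) t * (ennreal (a t) * \<phi> (g0 t)) = indicator B t * (ennreal (adet (g' t)) * \<phi> (g t))"
      using B(2) by (auto simp: indicator_def a_def g0_def Q_def)
    finally show "(\<Sum>n. indicator (P n) t * (ennreal (a t) * \<phi> (g0 t))) = indicator B t * (ennreal (adet (g' t)) * \<phi> (g t))" .
  qed
  finally show ?thesis .
qed

section \<open>Zeros of random functions\<close>

text \<open>On a compact set the norm of F attains its minimum, so a zero exists exactly if the norm
  is arbitrarily small on a countable dense subset. That is a countable condition.\<close>

lemma measurable_exists_zero_compact:
  fixes F :: "'a::euclidean_space \<Rightarrow> 'p \<Rightarrow> 'b::euclidean_space"
  assumes K: "compact K" and cont: "\<And>p. p \<in> space N \<Longrightarrow> continuous_on K (\<lambda>t. F t p)"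
    and meas: "\<And>t. t \<in> K \<Longrightarrow> F t \<in> borel_measurable N"
  shows "{p\<in>space N. \<exists>t\<in>K. F t p = 0} \<in> sets N"
proof -
  obtain D where D: "countable D" "D \<subseteq> K" "K \<subseteq> closure D" using separable[of K] by metis
  have Dm: "F t \<in> borel_measurable N" if "t \<in> D" for t using that D(2) meas by blast
  have "{p\<in>space N. \<exists>t\<in>K. F t p = 0} = (\<Inter>n. \<Union>d\<in>D. {p\<in>space N. norm (F d p) < 1 / real (Suc n)})"
  proof (intro equalityI subsetI)
    fix p assume "p \<in> {p\<in>space N. \<exists>t\<in>K. F t p = 0}"
    then obtain t where p: "p \<in> space N" and t: "t \<in> K" "F t p = 0" by blast
    have "\<exists>d\<in>D. norm (F d p) < 1 / real (Suc n)" for n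
    proof -
      have c: "continuous (at t within K) (\<lambda>t. F t p)" using cont[OF p] t(1) by (simp add: continuous_on_eq_continuous_within)
      have "0 < 1 / real (Suc n)" by simp
      then obtain \<delta> where \<delta>: "\<delta> > 0" "\<And>x. x \<in> K \<Longrightarrow> dist x t < \<delta> \<Longrightarrow> dist (F x p) (F t p) < 1 / real (Suc n)"
        using c unfolding continuous_within_eps_delta by metis
      obtain d where "d \<in> D" "dist d t < \<delta>" using D(3) t(1) \<delta>(1) closure_approachable by blast
      then show ?thesis using \<delta>(2)[of d] D(2) t(2) by auto
    qed
    then show "p \<in> (\<Inter>n. \<Union>d\<in>D. {p\<in>space N. norm (F d p) < 1 / real (Suc n)})" using p by blast
  next
    fix p assume p': "p \<in> (\<Inter>n. \<Union>d\<in>D. {p\<in>space N. norm (F d p) < 1 / real (Suc n)})"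
    then have p: "p \<in> space N" by blast
    have "\<exists>d\<in>D. norm (F d p) < 1 / real (Suc n)" for n using p' by blast
    then have small: "\<exists>d\<in>K. norm (F d p) < 1 / real (Suc n)" for n using D(2) by blast
    have "continuous_on K (\<lambda>t. norm (F t p))" by (intro continuous_intros cont p)
    moreover have "K \<noteq> {}" using small by blast
    ultimately obtain t where t: "t \<in> K" "\<And>s. s \<in> K \<Longrightarrow> norm (F t p) \<le> norm (F s p)"
      using continuous_attains_inf[OF K] by blast
    have "norm (F t p) < 1 / real (Suc n)" for n using small[of n] t(2) le_less_trans by blast
    then have "norm (F t p) \<le> 0" using nat_approx_posE[of "norm (F t p)"] by (metis linorder_not_less order_less_asym)
    then show "p \<in> {p\<in>space N. \<exists>t\<in>K. F t p = 0}" using p t(1) by auto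
  qed
  also have "\<dots> \<in> sets N"
  proof (intro sets.countable_INT' sets.countable_UN'[OF D(1)] image_subsetI)
    fix n d assume "d \<in> D"
    from Dm[OF this] have [measurable]: "F d \<in> borel_measurable N" .
    show "{p\<in>space N. norm (F d p) < 1 / real (Suc n)} \<in> sets N" by measurable
  qed auto
  finally show ?thesis .
qed

lemma measurable_exists_zero_fsigma:
  fixes F :: "'a::euclidean_space \<Rightarrow> 'p \<Rightarrow> 'b::euclidean_space"
  assumes B: "fsigma B" and cont: "\<And>p. p \<in> space N \<Longrightarrow> continuous_on B (\<lambda>t. F t p)"
    and meas: "\<And>t. t \<in> B \<Longrightarrow> F t \<in> borel_measurable N"
  shows "{p\<in>space N. \<exists>t\<in>B. F t p = 0} \<in> sets N"
proof -
  obtain K :: "nat \<Rightarrow> 'a set" where K: "\<And>n. compact (K n)" "B = (\<Union>n. K n)" using fsigmaE_compact[OF B] by metis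
  have KB: "K n \<subseteq> B" for n using K(2) by blast
  have mem: "{p\<in>space N. \<exists>t\<in>K n. F t p = 0} \<in> sets N" for n
  proof (rule measurable_exists_zero_compact[OF K(1)])
    show "continuous_on (K n) (\<lambda>t. F t p)" if "p \<in> space N" for p
      by (rule continuous_on_subset[OF cont[OF that] KB])
    show "F t \<in> borel_measurable N" if "t \<in> K n" for t
      by (rule meas) (use that KB[of n] in blast)
  qed
  have eq: "{p\<in>space N. \<exists>t\<in>B. F t p = 0} = (\<Union>n. {p\<in>space N. \<exists>t\<in>K n. F t p = 0})" unfolding K(2) by blast
  show ?thesis unfolding eq
    by (rule sets.countable_UN'') (simp, rule mem)
qed

lemma finite_points_separated:
  fixes S :: "'a::metric_space set"
  assumes "finite S" and \<B>: "topological_basis \<B>"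
  obtains U where "\<And>x. x \<in> S \<Longrightarrow> x \<in> U x" "\<And>x. x \<in> S \<Longrightarrow> U x \<in> \<B>"
    "\<And>x y. x \<in> S \<Longrightarrow> y \<in> S \<Longrightarrow> x \<noteq> y \<Longrightarrow> U x \<inter> U y = {}"
proof -
  \<comment> \<open>The inserted 1 keeps the minimum defined when S has at most one point.\<close>
  define e where "e = Min (insert 1 ((\<lambda>(x, y). dist x y) ` {(x, y). x \<in> S \<and> y \<in> S \<and> x \<noteq> y}))"
  have fin: "finite ((\<lambda>(x, y). dist x y) ` {(x, y). x \<in> S \<and> y \<in> S \<and> x \<noteq> y})"
    by (rule finite_imageI, rule finite_subset[of _ "S \<times> S"]) (use assms(1) in auto)
  have e0: "e > 0" unfolding e_def using fin by (subst Min_gr_iff) auto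
  have ed: "e \<le> dist x y" if "x \<in> S" "y \<in> S" "x \<noteq> y" for x y
    unfolding e_def using fin that by (intro Min_le) (auto intro!: image_eqI[of _ _ "(x, y)"])
  have "\<exists>U\<in>\<B>. x \<in> U \<and> U \<subseteq> ball x (e/2)" for x
    using topological_basisE[OF \<B> open_ball, of x x "e/2"] e0 by (metis centre_in_ball half_gt_zero)
  then obtain U where U: "\<And>x. U x \<in> \<B>" "\<And>x. x \<in> U x" "\<And>x. U x \<subseteq> ball x (e/2)" by metis
  have "U x \<inter> U y = {}" if "x \<in> S" "y \<in> S" "x \<noteq> y" for x y
  proof (rule ccontr)
    assume "U x \<inter> U y \<noteq> {}"
    then obtain z where "z \<in> U x" "z \<in> U y" by blast
    then have "dist x z < e/2" "dist y z < e/2" using U(3) by force+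
    then show False using ed[OF that] dist_triangle2[of x y z] by simp
  qed
  then show ?thesis using U(1,2) by (intro that[of U])
qed

text \<open>It reduces measurability of a random count, possibly infinite, to that of the events
  that at least m points exist.\<close>

lemma emeasure_count_space_SUP:
  "emeasure (count_space UNIV) A = (SUP m. if \<exists>S\<subseteq>A. finite S \<and> card S = m then of_nat m else 0)"
proof (cases "finite A")
  case True
  show ?thesis
  proof (rule antisym)
    show "emeasure (count_space UNIV) A \<le> (SUP m. if \<exists>S\<subseteq>A. finite S \<and> card S = m then of_nat m else 0)"
      using True by (intro SUP_upper2[of "card A"]) auto
    show "(SUP m. if \<exists>S\<subseteq>A. finite S \<and> card S = m then of_nat m else 0) \<le> emeasure (count_space UNIV) A"
      using True by (intro SUP_least) (auto intro!: card_mono)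
  qed
next
  case False
  then have "\<exists>S\<subseteq>A. finite S \<and> card S = m" for m using infinite_arbitrarily_large[of A m] by blast
  then show ?thesis using False by (simp add: ennreal_SUP_of_nat_eq_top)
qed

text \<open>There are at least m zeros exactly if m pairwise disjoint members of a countable basis
  each contain a zero, and there are only countably many finite families of basis sets.\<close>

lemma measurable_count_zeros:
  fixes F :: "'a::euclidean_space \<Rightarrow> 'p \<Rightarrow> 'b::euclidean_space"
  assumes B: "fsigma B" and cont: "\<And>p. p \<in> space N \<Longrightarrow> continuous_on B (\<lambda>t. F t p)"
    and meas: "\<And>t. t \<in> B \<Longrightarrow> F t \<in> borel_measurable N"
  shows "(\<lambda>p. emeasure (count_space UNIV) {t\<in>B. F t p = 0}) \<in> borel_measurable N"
proof -
  obtain \<B> :: "'a set set" where \<B>: "countable \<B>" "topological_basis \<B>" using ex_countable_basis by blast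
  define E where "E U = {p\<in>space N. \<exists>t\<in>B \<inter> U. F t p = 0}" for U
  have Em: "E U \<in> sets N" if "U \<in> \<B>" for U
    unfolding E_def
  proof (rule measurable_exists_zero_fsigma)
    show "fsigma (B \<inter> U)" using topological_basis_open[OF \<B>(2) that] by (intro fsigma_Int[OF B open_imp_fsigma])
  qed (auto intro: continuous_on_subset[OF cont] meas)
  define \<D> where "\<D> m = {\<U>. finite \<U> \<and> \<U> \<subseteq> \<B> \<and> card \<U> = m \<and> disjoint \<U>}" for m
  have cD: "countable (\<D> m)" for m
    by (rule countable_subset[OF _ countable_Collect_finite_subset[OF \<B>(1)]]) (auto simp: \<D>_def)
  have eq: "{p\<in>space N. \<exists>S\<subseteq>{t\<in>B. F t p = 0}. finite S \<and> card S = m} = (\<Union>\<U>\<in>\<D> m. {p\<in>space N. \<forall>U\<in>\<U>. p \<in> E U})" for m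
  proof (intro equalityI subsetI)
    fix p assume "p \<in> {p\<in>space N. \<exists>S\<subseteq>{t\<in>B. F t p = 0}. finite S \<and> card S = m}"
    then obtain S where p: "p \<in> space N" and S: "S \<subseteq> {t\<in>B. F t p = 0}" "finite S" "card S = m" by blast
    obtain U where U: "\<And>x. x \<in> S \<Longrightarrow> x \<in> U x" "\<And>x. x \<in> S \<Longrightarrow> U x \<in> \<B>"
      "\<And>x y. x \<in> S \<Longrightarrow> y \<in> S \<Longrightarrow> x \<noteq> y \<Longrightarrow> U x \<inter> U y = {}"
      using finite_points_separated[OF S(2) \<B>(2)] by blast
    have "inj_on U S"
    proof (rule inj_onI, rule ccontr)
      fix x y assume xy: "x \<in> S" "y \<in> S" "U x = U y" "x \<noteq> y"
      then show False using U(3)[OF xy(1,2,4)] U(1)[OF xy(1)] by simp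
    qed
    moreover have "V \<inter> W = {}" if VW: "V \<in> U ` S" "W \<in> U ` S" "V \<noteq> W" for V W
    proof -
      obtain x y where xy: "x \<in> S" "y \<in> S" "V = U x" "W = U y" using VW(1,2) by auto
      then have "x \<noteq> y" using VW(3) by auto
      then show ?thesis using U(3) xy by simp
    qed
    then have "disjoint (U ` S)" unfolding disjoint_def by blast
    ultimately have "U ` S \<in> \<D> m" using S(2,3) U(2) unfolding \<D>_def
      by (simp add: card_image image_subset_iff)
    moreover have "\<forall>V\<in>U ` S. p \<in> E V" unfolding E_def using S(1) U(1) p by blast
    ultimately show "p \<in> (\<Union>\<U>\<in>\<D> m. {p\<in>space N. \<forall>U\<in>\<U>. p \<in> E U})" using p by blast
  next
    fix p assume "p \<in> (\<Union>\<U>\<in>\<D> m. {p\<in>space N. \<forall>U\<in>\<U>. p \<in> E U})"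
    then obtain \<U> where p: "p \<in> space N" and U: "\<U> \<in> \<D> m" "\<forall>U\<in>\<U>. p \<in> E U" by blast
    have "\<forall>U\<in>\<U>. \<exists>t. t \<in> U \<and> t \<in> B \<and> F t p = 0" using U(2) unfolding E_def by blast
    then obtain s where s: "\<And>U. U \<in> \<U> \<Longrightarrow> s U \<in> U \<and> s U \<in> B \<and> F (s U) p = 0" by metis
    have "inj_on s \<U>"
    proof (rule inj_onI, rule ccontr)
      fix V W assume VW: "V \<in> \<U>" "W \<in> \<U>" "s V = s W" "V \<noteq> W"
      then have "V \<inter> W = {}" using U(1) unfolding \<D>_def disjoint_def by blast
      then show False using s[OF VW(1)] s[OF VW(2)] VW(3) by auto
    qed
    then have "s ` \<U> \<subseteq> {t\<in>B. F t p = 0} \<and> finite (s ` \<U>) \<and> card (s ` \<U>) = m"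
      using U(1) s unfolding \<D>_def by (auto simp: card_image)
    then show "p \<in> {p\<in>space N. \<exists>S\<subseteq>{t\<in>B. F t p = 0}. finite S \<and> card S = m}" using p by blast
  qed
  have ms: "{p\<in>space N. \<exists>S\<subseteq>{t\<in>B. F t p = 0}. finite S \<and> card S = m} \<in> sets N" for m
    unfolding eq
  proof (rule sets.countable_UN''[OF cD])
    fix \<U> assume U: "\<U> \<in> \<D> m"
    then have fin: "finite \<U>" and sub: "\<U> \<subseteq> \<B>" by (auto simp: \<D>_def)
    show "{p\<in>space N. \<forall>U\<in>\<U>. p \<in> E U} \<in> sets N"
    proof (rule sets.sets_Collect_finite_All[OF _ fin])
      fix U assume "U \<in> \<U>"
      then have "E U \<in> sets N" using Em sub by blast
      moreover have "{p\<in>space N. p \<in> E U} = E U" by (auto simp: E_def)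
      ultimately show "{p\<in>space N. p \<in> E U} \<in> sets N" by simp
    qed
  qed
  show ?thesis
    unfolding emeasure_count_space_SUP
    by (intro borel_measurable_SUP measurable_If ms) auto
qed

text \<open>Replacing t by the first point of a dense sequence at distance below 1/(n+1) gives
  jointly measurable functions, which converge by continuity in t.\<close>

lemma measurable_caratheodory:
  fixes Q :: "'a::euclidean_space \<Rightarrow> 'w \<Rightarrow> 'b::euclidean_space"
  assumes V: "V \<in> sets borel" and cont: "\<And>w. w \<in> space N \<Longrightarrow> continuous_on V (\<lambda>t. Q t w)"
    and meas: "\<And>t. t \<in> V \<Longrightarrow> Q t \<in> borel_measurable N"
  shows "(\<lambda>z. indicator V (fst z) *\<^sub>R Q (fst z) (snd z)) \<in> borel_measurable (borel \<Otimes>\<^sub>M N)"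
proof (cases "V = {}")
  case False
  obtain D where D: "countable D" "D \<subseteq> V" "V \<subseteq> closure D" using separable[of V] by metis
  have Dne: "D \<noteq> {}" using D(3) False by auto
  define d where "d = from_nat_into D"
  have dV: "d i \<in> V" for i using from_nat_into[OF Dne, of i] D(2) by (auto simp: d_def)
  have dD: "range d = D" using range_from_nat_into[OF Dne D(1)] by (simp add: d_def)
  note [measurable] = V
  have Qm[measurable]: "Q (d i) \<in> borel_measurable N" for i by (rule meas[OF dV])
  \<comment> \<open>Where no point of the sequence is close to t the value is arbitrary, but then t
    lies outside V and the indicator removes the term.\<close>
  define k where "k n t = (LEAST i. dist (d i) t < 1 / real (Suc n))" for n t
  have km[measurable]: "k n \<in> borel \<rightarrow>\<^sub>M count_space UNIV" for n unfolding k_def[abs_def] by measurable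
  show ?thesis
  proof (rule borel_measurable_LIMSEQ_metric[where f="\<lambda>n z. indicator V (fst z) *\<^sub>R Q (d (k n (fst z))) (snd z)"])
    fix n
    have "(\<lambda>z. Q (d (k n (fst z))) (snd z)) \<in> borel_measurable (borel \<Otimes>\<^sub>M N)"
      by (rule measurable_compose_countable[where f="\<lambda>i z. Q (d i) (snd z)"]) measurable
    then show "(\<lambda>z. indicator V (fst z) *\<^sub>R Q (d (k n (fst z))) (snd z)) \<in> borel_measurable (borel \<Otimes>\<^sub>M N)"
      by (intro borel_measurable_scaleR) measurable
  next
    fix z :: "'a \<times> 'w" assume "z \<in> space (borel \<Otimes>\<^sub>M N)"
    then have w: "snd z \<in> space N" by (auto simp: space_pair_measure)
    let ?t = "fst z"
    show "(\<lambda>n. indicator V ?t *\<^sub>R Q (d (k n ?t)) (snd z)) \<longlonglongrightarrow> indicator V ?t *\<^sub>R Q ?t (snd z)"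
    proof (cases "?t \<in> V")
      case True
      have dist: "dist (d (k n ?t)) ?t < 1 / real (Suc n)" for n
      proof -
        have "?t \<in> closure D" using D(3) True by blast
        then obtain x where "x \<in> D" "dist x ?t < 1 / real (Suc n)"
          using closure_approachable[of ?t D] by (metis divide_pos_pos of_nat_0_less_iff zero_less_Suc zero_less_one)
        then obtain i where "dist (d i) ?t < 1 / real (Suc n)" using dD by (metis imageE)
        then show ?thesis unfolding k_def by (rule LeastI)
      qed
      have "(\<lambda>n. d (k n ?t)) \<longlonglongrightarrow> ?t"
      proof (rule metric_LIMSEQ_I)
        fix r :: real assume "r > 0"
        then obtain n0 where n0: "1 / real (Suc n0) < r" using nat_approx_posE by blast
        have "dist (d (k n ?t)) ?t < r" if "n \<ge> n0" for n
        proof -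
          have "1 / real (Suc n) \<le> 1 / real (Suc n0)" using that by (intro divide_left_mono) auto
          then show ?thesis using dist[of n] n0 by linarith
        qed
        then show "\<exists>no. \<forall>n\<ge>no. dist (d (k n ?t)) ?t < r" by blast
      qed
      then have "(\<lambda>n. Q (d (k n ?t)) (snd z)) \<longlonglongrightarrow> Q ?t (snd z)"
        by (rule continuous_on_tendsto_compose[OF cont[OF w]]) (use True dV in auto)
      then show ?thesis by (intro tendsto_scaleR tendsto_const)
    qed simp
  qed
qed simp

section \<open>Lebesgue measure on tuples and determinants of block-diagonal maps\<close>

lemma Basis_vec_eq: "(Basis :: ('b::euclidean_space^'k) set) = (\<lambda>(j, b). axis j b) ` (UNIV \<times> Basis)"
  by (auto simp: Basis_vec_def)

lemma prod_Basis_vec: "(\<Prod>b\<in>(Basis :: ('b::euclidean_space^'k) set). f b) = (\<Prod>j\<in>UNIV. \<Prod>b\<in>Basis. f (axis j b))"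
proof -
  have "inj_on (\<lambda>(j, b). axis j b :: 'b^'k) (UNIV \<times> Basis)"
    by (auto simp: inj_on_def axis_eq_axis nonzero_Basis)
  then have "(\<Prod>b\<in>(Basis :: ('b^'k) set). f b) = (\<Prod>(j, b)\<in>UNIV \<times> Basis. f (axis j b))"
    unfolding Basis_vec_eq by (subst prod.reindex) (auto simp: comp_def case_prod_unfold)
  then show ?thesis by (simp add: prod.cartesian_product)
qed

text \<open>Lebesgue measure on tuples is the image of the product measure, since both give the same
  volume to boxes.\<close>

lemma emeasure_lborel_vec_product:
  fixes S :: "'k::finite \<Rightarrow> 'b::euclidean_space set"
  assumes S: "\<And>j. S j \<in> sets borel"
  shows "emeasure lborel {t :: 'b^'k. \<forall>j. t $ j \<in> S j} = (\<Prod>j\<in>UNIV. emeasure lborel (S j))"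
proof -
  let ?P = "PiM UNIV (\<lambda>_::'k. lborel :: 'b measure)"
  interpret P: product_sigma_finite "\<lambda>_::'k. lborel :: 'b measure" ..
  have vm: "vec_lambda \<in> ?P \<rightarrow>\<^sub>M (borel :: ('b^'k) measure)"
  proof (subst borel_measurable_euclidean_space, rule ballI)
    fix b :: "'b^'k" assume "b \<in> Basis"
    then obtain j c where "b = axis j c" by (auto simp: Basis_vec_def)
    then show "(\<lambda>x. vec_lambda x \<bullet> b) \<in> borel_measurable ?P" by (simp add: inner_axis)
  qed
  have L: "distr ?P borel vec_lambda = (lborel :: ('b^'k) measure)"
  proof (rule lborel_eqI[symmetric])
    fix l u :: "'b^'k" assume le: "\<And>b. b \<in> Basis \<Longrightarrow> l \<bullet> b \<le> u \<bullet> b"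
    have "vec_lambda -` box l u \<inter> space ?P = Pi\<^sub>E UNIV (\<lambda>j. box (l $ j) (u $ j))"
      by (auto simp: mem_box Basis_vec_def inner_axis space_PiM PiE_iff)
    then have "emeasure (distr ?P borel vec_lambda) (box l u) = emeasure ?P (Pi\<^sub>E UNIV (\<lambda>j. box (l $ j) (u $ j)))"
      using vm by (simp add: emeasure_distr)
    also have "\<dots> = (\<Prod>j\<in>UNIV. emeasure lborel (box (l $ j) (u $ j)))" by (rule P.emeasure_PiM) auto
    also have "\<dots> = (\<Prod>j\<in>UNIV. ennreal (\<Prod>b\<in>Basis. (u $ j - l $ j) \<bullet> b))"
    proof (intro prod.cong refl emeasure_lborel_box)
      fix j :: 'k and b :: 'b assume "b \<in> Basis"
      then have "axis j b \<in> Basis" by (auto simp: Basis_vec_def)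
      from le[OF this] show "l $ j \<bullet> b \<le> u $ j \<bullet> b" by (simp add: inner_axis)
    qed
    also have "\<dots> = ennreal (\<Prod>j\<in>UNIV. \<Prod>b\<in>Basis. (u $ j - l $ j) \<bullet> b)"
    proof (rule prod_ennreal, rule prod_nonneg)
      fix j :: 'k and b :: 'b assume "b \<in> Basis"
      then have "axis j b \<in> Basis" by (auto simp: Basis_vec_def)
      from le[OF this] show "0 \<le> (u $ j - l $ j) \<bullet> b" by (simp add: inner_axis inner_diff_left)
    qed
    also have "(\<Prod>j\<in>UNIV. \<Prod>b\<in>Basis. (u $ j - l $ j) \<bullet> b) = (\<Prod>b\<in>Basis. (u - l) \<bullet> b)"
      unfolding prod_Basis_vec by (simp add: inner_axis)
    finally show "emeasure (distr ?P borel vec_lambda) (box l u) = ennreal (\<Prod>b\<in>Basis. (u - l) \<bullet> b)" .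
  qed simp
  have nm: "(\<lambda>t :: 'b^'k. t $ j) \<in> borel_measurable borel" for j
    by (rule borel_measurable_continuous_onI) (intro continuous_intros)
  have m: "{t :: 'b^'k. \<forall>j. t $ j \<in> S j} \<in> sets borel"
  proof -
    have "{t :: 'b^'k. \<forall>j. t $ j \<in> S j} = (\<Inter>j. (\<lambda>t. t $ j) -` S j \<inter> space borel)" by auto
    then show ?thesis using measurable_sets[OF nm S] by auto
  qed
  have "emeasure lborel {t :: 'b^'k. \<forall>j. t $ j \<in> S j} = emeasure ?P (vec_lambda -` {t :: 'b^'k. \<forall>j. t $ j \<in> S j} \<inter> space ?P)"
    unfolding L[symmetric] by (rule emeasure_distr[OF vm m])
  also have "vec_lambda -` {t :: 'b^'k. \<forall>j. t $ j \<in> S j} \<inter> space ?P = Pi\<^sub>E UNIV S"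
    by (auto simp: space_PiM PiE_iff)
  also have "emeasure ?P (Pi\<^sub>E UNIV S) = (\<Prod>j\<in>UNIV. emeasure lborel (S j))"
    by (rule P.emeasure_PiM) (use S in auto)
  finally show ?thesis .
qed

text \<open>Conjugation by f maps the permutations of one index set bijectively to those of the
  other and preserves signs, so the Leibniz sums agree term by term.\<close>

lemma det_reindex:
  fixes A :: "real^'d^'d" and f :: "'n::finite \<Rightarrow> 'd"
  assumes f: "bij f" shows "det (\<chi> i j. A $ f i $ f j) = det A"
proof -
  have f': "bij_betw f UNIV UNIV" using f by (simp add: bij_betw_def bij_def)
  have r: "bij_betw (map_permutation UNIV f) {p. p permutes UNIV} {q. q permutes (UNIV :: 'd set)}"
  proof -
    have "(\<lambda>p x. if x \<in> UNIV then f (p (inv_into UNIV f x)) else x) = map_permutation UNIV f"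
      using f by (auto simp: fun_eq_iff map_permutation_def restrict_id_def bij_def)
    then show ?thesis using bij_betw_permutations[OF f'] by simp
  qed
  have e: "of_int (sign (map_permutation UNIV f p)) * (\<Prod>i\<in>UNIV. A $ i $ map_permutation UNIV f p i) =
      (of_int (sign p) * (\<Prod>i\<in>UNIV. A $ f i $ f (p i)) :: real)" if p: "p permutes (UNIV :: 'n set)" for p
  proof -
    have "sign (map_permutation UNIV f p) = sign p"
      by (rule sign_map_permutation[OF bij_is_inj[OF f] p finite_class.finite_UNIV])
    moreover have "map_permutation UNIV f p (f i) = f (p i)" for i
      using f by (simp add: map_permutation_def restrict_id_def bij_def inv_f_f)
    then have "(\<Prod>i\<in>UNIV. A $ f i $ f (p i)) = (\<Prod>i\<in>UNIV. A $ i $ map_permutation UNIV f p i)"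
      by (subst prod.reindex_bij_betw[OF f', symmetric]) simp
    ultimately show ?thesis by simp
  qed
  show ?thesis
    unfolding det_def by (subst sum.reindex_bij_betw[OF r, symmetric]) (simp add: e)
qed

text \<open>On this space \<open>coord_vec\<close> lists the axis vectors in some order f, and
  reindexing rows and columns by f leaves the determinant unchanged.\<close>

lemma adet_matrix_vector_mult:
  fixes A :: "real^'d^'d" shows "adet (\<lambda>h. A *v h) = \<bar>det A\<bar>"
proof -
  have "\<exists>k. coord_vec i = (axis k 1 :: real^'d)" for i
    using coord_vec_Basis[of i] unfolding Basis_cart by auto
  then obtain f where f: "\<And>i. coord_vec i = (axis (f i) 1 :: real^'d)" by metis
  have "bij f"
  proof (rule bijI)
    show "inj f" using inj_coord_vec[where 'a="real^'d"] unfolding inj_def f by (metis)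
    show "surj f" unfolding surj_def
    proof
      show "\<exists>i. k = f i" for k
      proof -
        have "axis k 1 \<in> range (coord_vec :: _ \<Rightarrow> real^'d)" unfolding Basis_eq_range_coord_vec[symmetric] by (simp add: Basis_cart)
        then show ?thesis unfolding f by (auto simp: axis_eq_axis)
      qed
    qed
  qed
  have "(A *v axis (f j) 1) \<bullet> axis (f i) 1 = A $ f i $ f j" for i j
    by (simp add: inner_axis matrix_vector_mul_component[of A] inner_commute[of "A $ _"] inner_axis')
  then show ?thesis unfolding adet_def f by (simp add: det_reindex[OF \<open>bij f\<close>])
qed

text \<open>The block-diagonal linear map with blocks Y_j; it is the form of the derivative of (t_j)
  -> (Z(t_j)).\<close>

definition block_mult :: "real^'d^'d^'k \<Rightarrow> real^'d^'k \<Rightarrow> real^'d^'k" where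
  "block_mult Y h = (\<chi> j. Y $ j *v h $ j)"

lemma linear_block_mult: "linear (block_mult Y)"
  by (rule linearI) (simp_all add: block_mult_def vec_eq_iff matrix_vector_right_distrib vector_scaleR_matrix_ac
     matrix_vector_mult_scaleR)

lemma emeasure_linear_image_unit_box:
  fixes A :: "'a::euclidean_space \<Rightarrow> 'a"
  assumes "linear A" "inj A"
  shows "A ` box 0 One \<in> sets borel" "emeasure lborel (A ` box 0 One) = ennreal (adet A)"
proof -
  have bl: "bounded_linear A" using assms(1) by (simp add: linear_conv_bounded_linear)
  have fs: "fsigma (box 0 One :: 'a set)" by (rule open_imp_fsigma[OF open_box])
  show "A ` box 0 One \<in> sets borel"
    by (rule fsigma_borel[OF fsigma_continuous_image[OF fs linear_continuous_on[OF bl]]])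
  have "emeasure lborel (UNIV \<inter> A ` box 0 One) = (\<integral>\<^sup>+x. ennreal (indicator (box 0 One) x * (adet A * indicator UNIV (A x))) \<partial>lborel)"
    by (rule emeasure_image_euclidean[OF fs box_subset_cbox compact_cbox subset_UNIV open_UNIV])
      (use assms(2) bl in \<open>auto intro: bounded_linear_imp_has_derivative inj_on_subset\<close>)
  also have "\<dots> = (\<integral>\<^sup>+x. ennreal (adet A) * indicator (box 0 One) x \<partial>(lborel :: 'a measure))"
    by (intro nn_integral_cong) (simp add: indicator_def)
  also have "\<dots> = ennreal (adet A)" by (simp add: nn_integral_cmult)
  finally show "emeasure lborel (A ` box 0 One) = ennreal (adet A)" by simp
qed

lemma inner_One_Basis: "b \<in> Basis \<Longrightarrow> One \<bullet> b = 1"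
  by (simp add: inner_sum_left inner_Basis if_distrib cong: if_cong)

text \<open>A volume argument replaces the permutation expansion: the image of the unit box is the
  product of the images under the blocks, and volumes multiply. If some block is singular, then both
  sides are 0.\<close>

lemma adet_block_mult:
  fixes Y :: "real^'d^'d^'k" shows "adet (block_mult Y) = (\<Prod>j\<in>UNIV. \<bar>det (Y $ j)\<bar>)"
proof (cases "\<forall>j. inj (\<lambda>h. Y $ j *v h)")
  case False
  then obtain j where j: "\<not> inj (\<lambda>h. Y $ j *v h)" by blast
  have linj: "linear (\<lambda>h. Y $ j *v h)" by (rule matrix_vector_mul_linear)
  have "det (Y $ j) = 0" using adet_eq_0_iff[OF linj] j by (simp add: adet_matrix_vector_mult)
  obtain x where x: "Y $ j *v x = 0" "x \<noteq> 0" using j unfolding linear_injective_0[OF linj] by blast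
  have "block_mult Y (axis j x) = 0"
    unfolding block_mult_def vec_eq_iff using x(1) by (auto simp: axis_def)
  moreover have "axis j x \<noteq> 0" using x(2) by (simp add: axis_eq_0_iff)
  ultimately have "\<not> inj (block_mult Y)" unfolding linear_injective_0[OF linear_block_mult] by blast
  then have "adet (block_mult Y) = 0" using adet_eq_0_iff[OF linear_block_mult] by blast
  also have "0 = (\<Prod>j\<in>UNIV. \<bar>det (Y $ j)\<bar>)" using \<open>det (Y $ j) = 0\<close> by (intro prod_zero[symmetric]) auto
  finally show ?thesis .
next
  case True
  have inj: "inj (block_mult Y)"
  proof (rule injI)
    fix x y assume "block_mult Y x = block_mult Y y"
    then have "Y $ j *v x $ j = Y $ j *v y $ j" for j by (simp add: block_mult_def vec_eq_iff)
    then have "x $ j = y $ j" for j using True by (metis injD)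
    then show "x = y" by (simp add: vec_eq_iff)
  qed
  have box: "x \<in> box 0 One \<longleftrightarrow> (\<forall>j. x $ j \<in> box 0 One)" for x :: "real^'d^'k"
  proof -
    have "x \<in> box 0 One \<longleftrightarrow> (\<forall>y\<in>Basis. 0 < x \<bullet> y \<and> x \<bullet> y < 1)"
      by (simp add: mem_box inner_One_Basis)
    also have "\<dots> \<longleftrightarrow> (\<forall>j. \<forall>b\<in>Basis. 0 < x \<bullet> axis j b \<and> x \<bullet> axis j b < 1)"
      unfolding Basis_vec_eq by auto
    also have "\<dots> \<longleftrightarrow> (\<forall>j. x $ j \<in> box 0 One)"
      by (simp add: mem_box inner_One_Basis inner_axis)
    finally show ?thesis .
  qed
  have "block_mult Y ` box 0 One = {t. \<forall>j. t $ j \<in> (\<lambda>h. Y $ j *v h) ` box 0 One}"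
  proof (intro equalityI subsetI)
    fix t assume "t \<in> {t. \<forall>j. t $ j \<in> (\<lambda>h. Y $ j *v h) ` box 0 One}"
    then have "\<forall>j. \<exists>h. h \<in> box 0 One \<and> t $ j = Y $ j *v h" by auto
    then obtain h where h: "\<And>j. h j \<in> box 0 One \<and> t $ j = Y $ j *v h j" by metis
    then have "t = block_mult Y (\<chi> j. h j)" "(\<chi> j. h j) \<in> box 0 One" by (auto simp: block_mult_def vec_eq_iff box)
    then show "t \<in> block_mult Y ` box 0 One" by blast
  qed (auto simp: block_mult_def box)
  then have "ennreal (adet (block_mult Y)) = emeasure lborel {t. \<forall>j. t $ j \<in> (\<lambda>h. Y $ j *v h) ` box 0 One}"
    using emeasure_linear_image_unit_box(2)[OF linear_block_mult inj] by simp
  also have "\<dots> = (\<Prod>j\<in>UNIV. emeasure lborel ((\<lambda>h. Y $ j *v h) ` box 0 One))"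
    by (rule emeasure_lborel_vec_product) (use True in \<open>auto intro!: emeasure_linear_image_unit_box matrix_vector_mul_linear\<close>)
  also have "\<dots> = (\<Prod>j\<in>UNIV. ennreal \<bar>det (Y $ j)\<bar>)"
    using True by (intro prod.cong refl) (simp add: emeasure_linear_image_unit_box matrix_vector_mul_linear adet_matrix_vector_mult)
  also have "\<dots> = ennreal (\<Prod>j\<in>UNIV. \<bar>det (Y $ j)\<bar>)" by (rule prod_ennreal) simp
  finally show ?thesis by (simp add: adet_nonneg prod_nonneg)
qed

section \<open>Expected numbers of roots\<close>

context gaussian_space begin

lemma cov_tendsto_0:
  assumes q: "q \<in> H" and f: "\<And>n. f n \<in> H" and lim: "\<And>w. (\<lambda>n. f n w) \<longlonglongrightarrow> 0"
  shows "(\<lambda>n. cov q (f n)) \<longlonglongrightarrow> 0"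
proof (rule Lim_null_comparison[OF always_eventually])
  let ?s = "\<lambda>g. sqrt (expectation (\<lambda>w. (g w)\<^sup>2))"
  let ?K = "?s q + \<bar>expectation q\<bar>"
  show "\<forall>n. norm (cov q (f n)) \<le> ?K * ?s (f n)"
  proof
    fix n
    have "(expectation (f n))\<^sup>2 \<le> expectation (\<lambda>w. (f n w)\<^sup>2)"
      unfolding second_moment_eq[OF f] using cov_nonneg[of "f n"] by simp
    then have e: "\<bar>expectation (f n)\<bar> \<le> ?s (f n)" by (rule real_le_rsqrt[of "\<bar>_\<bar>", unfolded power2_abs])
    have "norm (cov q (f n)) \<le> \<bar>expectation (\<lambda>w. q w * f n w)\<bar> + \<bar>expectation q * expectation (f n)\<bar>"
      unfolding cov_eq[OF q f] real_norm_def by (rule abs_triangle_ineq4)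
    also have "\<dots> \<le> ?s q * ?s (f n) + \<bar>expectation q\<bar> * ?s (f n)"
      unfolding abs_mult by (intro add_mono expectation_mult_le q f mult_left_mono e) simp
    also have "\<dots> = ?K * ?s (f n)" by (rule distrib_right[symmetric])
    finally show "norm (cov q (f n)) \<le> ?K * ?s (f n)" .
  qed
  have "(\<lambda>n. ?K * ?s (f n)) \<longlonglongrightarrow> ?K * sqrt 0"
    by (intro tendsto_mult_left tendsto_real_sqrt second_moment_tendsto_0 f lim)
  then show "(\<lambda>n. ?K * ?s (f n)) \<longlonglongrightarrow> 0" by simp
qed

lemma inner_regression_map:
  assumes "gvec X" "gvec Y"
  shows "regression_map M X Y x \<bullet> b = cov (\<lambda>w. inv (covariance_map M X X) x \<bullet> X w) (\<lambda>w. b \<bullet> Y w)"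
  unfolding regression_map_def comp_def by (rule covariance_map_inner'[OF assms])

text \<open>For fixed x each coordinate of the coefficient is a covariance with one fixed member of
  H. Hence pointwise convergence of Y suffices, without a dominating function; continuity,
  differentiability and Lipschitz bounds of coefficients in t all come from this.\<close>

lemma regression_map_tendsto_0:
  fixes Y :: "nat \<Rightarrow> 'w \<Rightarrow> 'b::euclidean_space"
  assumes X: "gvec X" and Y: "\<And>n. gvec (Y n)" and lim: "\<And>w. (\<lambda>n. Y n w) \<longlonglongrightarrow> 0"
  shows "(\<lambda>n. regression_map M X (Y n) x) \<longlonglongrightarrow> 0"
  unfolding tendsto_componentwise_iff[of _ "0::'b"]
proof
  fix b :: 'b
  have "(\<lambda>n. b \<bullet> Y n w) \<longlonglongrightarrow> b \<bullet> 0" for w by (intro tendsto_inner tendsto_const lim)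
  then show "(\<lambda>n. regression_map M X (Y n) x \<bullet> b) \<longlonglongrightarrow> 0 \<bullet> b"
    unfolding inner_regression_map[OF X Y] by (simp, intro cov_tendsto_0 gvecD X Y) simp
qed

lemma regression_map_diff:
  assumes X: "gvec X" and Y: "gvec Y" "gvec Z"
  shows "regression_map M X (\<lambda>w. Y w - Z w) x = regression_map M X Y x - regression_map M X Z x"
proof (rule euclidean_eqI)
  fix b :: 'b
  note h = gvecD[OF X] gvecD[OF Y(1)] gvecD[OF Y(2)]
  show "regression_map M X (\<lambda>w. Y w - Z w) x \<bullet> b = (regression_map M X Y x - regression_map M X Z x) \<bullet> b"
    unfolding inner_diff_left inner_regression_map[OF X Y(1)] inner_regression_map[OF X Y(2)]
      inner_regression_map[OF X gvec_diff[OF Y]] inner_diff_right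
    by (subst (1 2 3) cov_commute) (rule cov_diff[OF h(2,3,1)])
qed

lemma gvec_scaleR: "gvec X \<Longrightarrow> gvec (\<lambda>w. c *\<^sub>R X w)"
  by (rule gvec_linear) (auto intro: linear_scaleR)

lemma regression_map_scaleR:
  assumes X: "gvec X" and Y: "gvec Y"
  shows "regression_map M X (\<lambda>w. c *\<^sub>R Y w) x = c *\<^sub>R regression_map M X Y x"
  by (rule regression_map_linear[OF X Y]) (rule linear_scaleR)

lemma continuous_on_regression_map:
  fixes Y :: "'a::euclidean_space \<Rightarrow> 'w \<Rightarrow> 'b::euclidean_space"
  assumes X: "gvec X" and Y: "\<And>t. t \<in> T \<Longrightarrow> gvec (Y t)" and cont: "\<And>w. continuous_on T (\<lambda>t. Y t w)"
  shows "continuous_on T (\<lambda>t. regression_map M X (Y t) x)"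
  unfolding continuous_on_sequentially comp_def
proof safe
  fix s a assume a: "a \<in> T" and s: "\<forall>n. s n \<in> T" "s \<longlonglongrightarrow> a"
  have "(\<lambda>n. regression_map M X (\<lambda>w. Y (s n) w - Y a w) x) \<longlonglongrightarrow> 0"
  proof (rule regression_map_tendsto_0[OF X])
    show "gvec (\<lambda>w. Y (s n) w - Y a w)" for n using s a by (intro gvec_diff Y) auto
    show "(\<lambda>n. Y (s n) w - Y a w) \<longlonglongrightarrow> 0" for w
      by (rule LIM_zero, rule continuous_on_tendsto_compose[OF cont s(2) a]) (use s(1) in auto)
  qed
  then have "(\<lambda>n. regression_map M X (Y (s n)) x - regression_map M X (Y a) x) \<longlonglongrightarrow> 0"
    using regression_map_diff[OF X Y Y] s(1) a by simp
  then show "(\<lambda>n. regression_map M X (Y (s n)) x) \<longlonglongrightarrow> regression_map M X (Y a) x"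
    by (rule LIM_zero_cancel)
qed

text \<open>Regression is linear in Y, so the normalised Taylor remainder of the coefficient is the
  coefficient of the normalised Taylor remainder of the paths, which tends to 0 pointwise.\<close>

lemma has_derivative_regression_map:
  fixes X :: "'a::euclidean_space \<Rightarrow> 'w \<Rightarrow> 'b::euclidean_space"
  assumes \<xi>: "gvec \<xi>" and T: "open T" "t \<in> T" and X: "\<And>s. s \<in> T \<Longrightarrow> gvec (X s)"
    and D: "\<And>h. gvec (\<lambda>w. D w h)" and der: "\<And>w. ((\<lambda>s. X s w) has_derivative D w) (at t)"
    and bl: "bounded_linear (\<lambda>h. regression_map M \<xi> (\<lambda>w. D w h) x)"
  shows "((\<lambda>s. regression_map M \<xi> (X s) x) has_derivative (\<lambda>h. regression_map M \<xi> (\<lambda>w. D w h) x)) (at t)"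
  unfolding has_derivative_def
proof (intro conjI bl)
  let ?r = "\<lambda>Y. regression_map M \<xi> Y x"
  have "((\<lambda>y. (?r (X y) - ?r (X t) - ?r (\<lambda>w. D w (y - t))) /\<^sub>R norm (y - t)) \<longlongrightarrow> 0) (at t within T)"
    unfolding tendsto_at_iff_sequentially comp_def
  proof (intro allI impI)
    fix s assume s: "\<forall>i. s i \<in> T - {t}" "s \<longlonglongrightarrow> t"
    let ?Y = "\<lambda>n w. (1 / norm (s n - t)) *\<^sub>R (X (s n) w - X t w - D w (s n - t))"
    have gY: "gvec (?Y n)" for n using s T by (intro gvec_scaleR gvec_diff X D) auto
    have "(\<lambda>n. ?r (?Y n)) \<longlonglongrightarrow> 0"
    proof (rule regression_map_tendsto_0[OF \<xi> gY])
      fix w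
      have "((\<lambda>y. (X y w - X t w - D w (y - t)) /\<^sub>R norm (y - t)) \<longlongrightarrow> 0) (at t within T)"
        using der[of w] unfolding at_within_open[OF T(2,1)] has_derivative_def by (simp add: netlimit_at)
      then show "(\<lambda>n. ?Y n w) \<longlonglongrightarrow> 0"
        unfolding tendsto_at_iff_sequentially comp_def using s by (simp add: divide_inverse)
    qed
    moreover have "?r (?Y n) = (?r (X (s n)) - ?r (X t) - ?r (\<lambda>w. D w (s n - t))) /\<^sub>R norm (s n - t)" for n
    proof -
      have g: "gvec (X (s n))" "gvec (X t)" "gvec (\<lambda>w. X (s n) w - X t w)" "gvec (\<lambda>w. X (s n) w - X t w - D w (s n - t))"
        using s T by (auto intro!: gvec_diff X D)
      show ?thesis
        by (simp add: regression_map_scaleR[OF \<xi> g(4)] regression_map_diff[OF \<xi> g(3) D]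
          regression_map_diff[OF \<xi> g(1,2)] divide_inverse)
    qed
    ultimately show "(\<lambda>i. (?r (X (s i)) - ?r (X t) - ?r (\<lambda>w. D w (s i - t))) /\<^sub>R norm (s i - t)) \<longlonglongrightarrow> 0" by simp
  qed
  then show "((\<lambda>y. (?r (X y) - ?r (X (Lim (at t) (\<lambda>x. x))) - ?r (\<lambda>w. D w (y - Lim (at t) (\<lambda>x. x)))) /\<^sub>R norm (y - Lim (at t) (\<lambda>x. x))) \<longlongrightarrow> 0) (at t)"
    unfolding at_within_open[OF T(2,1)] by (simp add: Lim_ident_at)
qed

end

text \<open>The set T is left general since it plays two parts: the open set of tuples of distinct
  interior points for the root formula, and the compact set I for the absence of roots on a null
  set.\<close>

locale gaussian_path = gaussian_space M H for M :: "'w measure" and H +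
  fixes X :: "'a::euclidean_space \<Rightarrow> 'w \<Rightarrow> 'b::euclidean_space" and T :: "'a set" and t\<^sub>0 :: 'a and u :: 'b
  assumes gX: "\<And>t. t \<in> T \<Longrightarrow> gvec (X t)" and contX: "\<And>w. continuous_on T (\<lambda>t. X t w)"
    and t0: "t\<^sub>0 \<in> T" and nd0: "nondegenerate M (X t\<^sub>0)"
begin

definition "C t = regression_map M (X t\<^sub>0) (X t)"
definition "R t w = X t w - C t (X t\<^sub>0 w)"
text \<open>The sum bounds the operator norm of C t - id. Below 1/2 it makes C t invertible with an
  inverse of norm at most 2, the constant in all estimates for J.\<close>

definition "V = {t\<in>T. (\<Sum>b\<in>Basis. norm (C t b - b)) < 1/2}"
definition "J t = inv (C t)"
definition "G t w = J t (u - R t w)"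

abbreviation "N \<equiv> gen_algebra M (residuals (X t\<^sub>0))"

lemma VT: "t \<in> V \<Longrightarrow> t \<in> T" by (simp add: V_def)

lemma linC: "t \<in> T \<Longrightarrow> linear (C t)"
  unfolding C_def by (rule linear_regression_map[OF gX[OF t0] nd0 gX])

lemma contC: "continuous_on T (\<lambda>t. C t x)"
  unfolding C_def by (rule continuous_on_regression_map[OF gX[OF t0] gX contX])

lemma t0V: "t\<^sub>0 \<in> V"
  using t0 regression_map_self[OF gX[OF t0] nd0] by (simp add: V_def C_def)

lemma contS: "continuous_on T (\<lambda>t. \<Sum>b\<in>Basis. norm (C t b - b))"
  by (intro continuous_intros contC)

lemma openV: "open T \<Longrightarrow> open V"
proof -
  assume T: "open T"
  have "V = T \<inter> (\<lambda>t. \<Sum>b\<in>Basis. norm (C t b - b)) -` {..<1/2}" by (auto simp: V_def)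
  then show "open V" using continuous_open_preimage[OF contS T open_lessThan] by simp
qed

lemma near: assumes "t \<in> V" shows "norm (C t x - x) \<le> norm x / 2"
proof -
  have lin: "linear (C t)" by (rule linC[OF VT[OF assms]])
  have "C t x - x = (\<Sum>b\<in>Basis. (x \<bullet> b) *\<^sub>R (C t b - b))"
  proof -
    have "C t x = C t (\<Sum>b\<in>Basis. (x \<bullet> b) *\<^sub>R b)" by (simp add: euclidean_representation)
    also have "\<dots> = (\<Sum>b\<in>Basis. (x \<bullet> b) *\<^sub>R C t b)" by (simp add: linear_sum[OF lin] linear_cmul[OF lin])
    finally have "C t x - (\<Sum>b\<in>Basis. (x \<bullet> b) *\<^sub>R b) = (\<Sum>b\<in>Basis. (x \<bullet> b) *\<^sub>R (C t b - b))"
      by (simp add: scaleR_diff_right sum_subtractf)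
    then show ?thesis by (simp add: euclidean_representation)
  qed
  also have "norm \<dots> \<le> (\<Sum>b\<in>Basis. norm x * norm (C t b - b))"
    by (rule sum_norm_le) (auto simp: intro!: mult_right_mono Basis_le_norm)
  also have "\<dots> = norm x * (\<Sum>b\<in>Basis. norm (C t b - b))" by (rule sum_distrib_left[symmetric])
  also have "\<dots> \<le> norm x * (1/2)" using assms by (intro mult_left_mono) (auto simp: V_def)
  finally show ?thesis by simp
qed

lemma norm_C: "t \<in> V \<Longrightarrow> norm x \<le> 2 * norm (C t x)"
  using near[of t x] norm_triangle_sub[of x "C t x"] by (simp add: norm_minus_commute)

lemma injC: assumes "t \<in> V" shows "inj (C t)"
  unfolding linear_injective_0[OF linC[OF VT[OF assms]]]
proof (intro allI impI)
  fix x assume "C t x = 0"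
  then show "x = 0" using norm_C[OF assms, of x] by simp
qed

lemma JC: "t \<in> V \<Longrightarrow> J t (C t x) = x"
  and CJ: "t \<in> V \<Longrightarrow> C t (J t x) = x"
  and linJ: "t \<in> V \<Longrightarrow> linear (J t)"
proof -
  assume t: "t \<in> V"
  note i = injC[OF t] and l = linC[OF VT[OF t]]
  have s: "surj (C t)" using linear_injective_imp_surjective[OF l i] by simp
  show "J t (C t x) = x" unfolding J_def by (rule inv_f_f[OF i])
  show "C t (J t x) = x" unfolding J_def by (rule surj_f_inv_f[OF s])
  show "linear (J t)" unfolding J_def by (rule inj_linear_imp_inv_linear[OF l i])
qed

lemma norm_J: "t \<in> V \<Longrightarrow> norm (J t y) \<le> 2 * norm y"
  using norm_C[of t "J t y"] CJ[of t y] by simp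

text \<open>The resolvent identity J t - J s = J t (C s - C t) J s, through which J inherits
  continuity from C.\<close>

lemma J_diff:
  assumes "t \<in> V" "s \<in> V" shows "norm (J t y - J s y) \<le> 2 * norm (C t (J s y) - C s (J s y))"
proof -
  have "J t y - J s y = J t (C s (J s y)) - J t (C t (J s y))" using assms by (simp add: JC CJ)
  also have "\<dots> = J t (C s (J s y) - C t (J s y))" by (simp add: linear_diff[OF linJ[OF assms(1)]])
  finally show ?thesis using norm_J[OF assms(1), of "C s (J s y) - C t (J s y)"] by (simp add: norm_minus_commute)
qed

lemma contJ:
  assumes y: "continuous_on V y" shows "continuous_on V (\<lambda>t. J t (y t))"
  unfolding continuous_on_def
proof
  fix s assume s: "s \<in> V"
  let ?b = "\<lambda>t. 2 * norm (y t - y s) + 2 * norm (C t (J s (y s)) - C s (J s (y s)))"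
  have "continuous_on V (\<lambda>t. C t (J s (y s)))" by (rule continuous_on_subset[OF contC]) (auto simp: VT)
  then have c: "((\<lambda>t. C t (J s (y s))) \<longlongrightarrow> C s (J s (y s))) (at s within V)" using s by (simp add: continuous_on_def)
  have y': "(y \<longlongrightarrow> y s) (at s within V)" using y s by (simp add: continuous_on_def)
  have "(?b \<longlongrightarrow> 2 * norm (y s - y s) + 2 * norm (C s (J s (y s)) - C s (J s (y s)))) (at s within V)"
    by (intro tendsto_intros c y')
  then have b0: "(?b \<longlongrightarrow> 0) (at s within V)" by simp
  have "\<forall>\<^sub>F t in at s within V. norm (J t (y t) - J s (y s)) \<le> ?b t"
    unfolding eventually_at_filter
  proof (intro always_eventually allI impI)
    fix t assume t: "t \<in> V"
    have "J t (y t) - J s (y s) = J t (y t - y s) + (J t (y s) - J s (y s))" by (simp add: linear_diff[OF linJ[OF t]])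
    then have "norm (J t (y t) - J s (y s)) \<le> norm (J t (y t - y s)) + norm (J t (y s) - J s (y s))"
      by (metis norm_triangle_ineq)
    then show "norm (J t (y t) - J s (y s)) \<le> ?b t" using norm_J[OF t, of "y t - y s"] J_diff[OF t s, of "y s"] by linarith
  qed
  then show "((\<lambda>t. J t (y t)) \<longlongrightarrow> J s (y s)) (at s within V)"
    by (intro LIM_zero_cancel[OF Lim_null_comparison[OF _ b0]])
qed

lemma R_measurable: "t \<in> T \<Longrightarrow> R t \<in> borel_measurable N"
  unfolding R_def[abs_def] C_def by (rule residual_measurable[OF gX[OF t0] nd0 gX])

lemma G_measurable: "t \<in> V \<Longrightarrow> G t \<in> borel_measurable N"
  unfolding G_def[abs_def]
  by (rule measurable_compose[OF _ linear_borel_measurable[OF linJ]])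
    (intro borel_measurable_diff borel_measurable_const R_measurable VT)

lemma X_eq_iff: "t \<in> V \<Longrightarrow> X t w = u \<longleftrightarrow> G t w = X t\<^sub>0 w"
proof -
  assume t: "t \<in> V"
  have "G t w = X t\<^sub>0 w \<longleftrightarrow> C t (G t w) = C t (X t\<^sub>0 w)" using injC[OF t] by (simp add: inj_eq)
  also have "\<dots> \<longleftrightarrow> X t w = u" unfolding G_def CJ[OF t] R_def by (auto simp: algebra_simps)
  finally show ?thesis by simp
qed

text \<open>Put z = G s - X t_0, frozen at the point s, and f(t) = X t + C t z; then f(s) = u and G
  t - G s = - J t (f(t) - f(s)). Increments of G are thus reduced to those of X and C, with J t as a
  bounded factor that never has to be differentiated.\<close>

lemma G_diff:
  assumes t: "t \<in> V" and s: "s \<in> V"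
  shows "G t w - G s w = - J t ((X t w + C t (G s w - X t\<^sub>0 w)) - (X s w + C s (G s w - X t\<^sub>0 w)))"
proof -
  note lt = linC[OF VT[OF t]] and ls = linC[OF VT[OF s]]
  have "C s (G s w) = u - R s w" unfolding G_def CJ[OF s] ..
  then have u: "X s w + C s (G s w - X t\<^sub>0 w) = u" by (simp add: R_def linear_diff[OF ls])
  have "G t w - G s w = J t (u - R t w) - J t (C t (G s w))" unfolding JC[OF t] G_def ..
  also have "\<dots> = J t (u - R t w - C t (G s w))" by (simp add: linear_diff[OF linJ[OF t]])
  also have "u - R t w - C t (G s w) = - ((X t w + C t (G s w - X t\<^sub>0 w)) - u)" by (simp add: R_def linear_diff[OF lt])
  finally show ?thesis unfolding u by (simp only: linear_neg[OF linJ[OF t]])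
qed

lemma contG: "continuous_on V (\<lambda>t. G t w)"
  unfolding G_def R_def
proof (rule contJ)
  have cX: "continuous_on V (\<lambda>t. X t w)" and cC: "continuous_on V (\<lambda>t. C t z)" for z
    by (rule continuous_on_subset[OF contX], force simp: VT, rule continuous_on_subset[OF contC], force simp: VT)
  show "continuous_on V (\<lambda>t. u - (X t w - C t (X t\<^sub>0 w)))" by (intro continuous_intros cX cC)
qed

lemma nn_integral_path:
  assumes "\<Psi> \<in> borel_measurable (borel \<Otimes>\<^sub>M N)"
  shows "(\<integral>\<^sup>+w. \<Psi> (X t\<^sub>0 w, w) \<partial>M) = (\<integral>\<^sup>+w. \<integral>\<^sup>+x. ennreal (continuous_density M (X t\<^sub>0) x) * \<Psi> (x, w) \<partial>lborel \<partial>M)"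
proof -
  have "(\<integral>\<^sup>+w. \<Psi> (X t\<^sub>0 w, w) \<partial>M) = (\<integral>\<^sup>+w. \<integral>\<^sup>+w'. \<Psi> (X t\<^sub>0 w', w) \<partial>M \<partial>M)"
    by (rule nn_integral_residuals[OF gX[OF t0] assms])
  also have "\<dots> = (\<integral>\<^sup>+w. \<integral>\<^sup>+x. ennreal (continuous_density M (X t\<^sub>0) x) * \<Psi> (x, w) \<partial>lborel \<partial>M)"
  proof (rule nn_integral_cong)
    fix w assume w: "w \<in> space M"
    have "(\<lambda>x. \<Psi> (x, w)) \<in> borel_measurable borel"
      by (rule measurable_compose[OF measurable_Pair2' assms]) (simp add: w)
    then have "(\<lambda>x. \<Psi> (x, w)) \<in> borel_measurable lborel" by simp
    from distributed_nn_integral[OF continuous_density_props(4)[OF gX[OF t0] nd0] this]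
    show "(\<integral>\<^sup>+w'. \<Psi> (X t\<^sub>0 w', w) \<partial>M) = (\<integral>\<^sup>+x. ennreal (continuous_density M (X t\<^sub>0) x) * \<Psi> (x, w) \<partial>lborel)" by (rule sym)
  qed
  finally show ?thesis .
qed

text \<open>A uniform boundedness argument. If points t_n -> s had difference quotients above n + 1,
  scale X(t_n) - X(s) by 1 / ((n + 1) |t_n - s|). The Lipschitz bounds of the paths, whose constants
  may vary with w, make these vectors tend to 0 pointwise; so do their regression coefficients at x,
  although these have norm above 1.\<close>

lemma C_pointwise_Lipschitz:
  assumes lip: "\<And>w. \<exists>L \<delta>. 0 < \<delta> \<and> (\<forall>t\<in>T. dist t s < \<delta> \<longrightarrow> norm (X t w - X s w) \<le> L * norm (t - s))" and s: "s \<in> T"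
  shows "\<exists>L \<delta>. 0 < \<delta> \<and> (\<forall>t\<in>T. dist t s < \<delta> \<longrightarrow> norm (C t x - C s x) \<le> L * norm (t - s))"
proof (rule ccontr)
  assume neg: "\<not> ?thesis"
  have "\<exists>t\<in>T. dist t s < 1 / real (Suc n) \<and> norm (C t x - C s x) > real (Suc n) * norm (t - s)" for n
  proof (rule ccontr)
    assume "\<not> ?thesis"
    then have "\<forall>t\<in>T. dist t s < 1 / real (Suc n) \<longrightarrow> norm (C t x - C s x) \<le> real (Suc n) * norm (t - s)"
      by (meson linorder_not_le)
    moreover have "0 < 1 / real (Suc n)" by simp
    ultimately show False using neg by blast
  qed
  then obtain t where t: "\<And>n. t n \<in> T" "\<And>n. dist (t n) s < 1 / real (Suc n)"
    "\<And>n. norm (C (t n) x - C s x) > real (Suc n) * norm (t n - s)" by metis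
  have ne: "norm (t n - s) > 0" for n using t(3)[of n] by (cases "t n = s") auto
  define a where "a n = 1 / (real (Suc n) * norm (t n - s))" for n
  have a0: "a n > 0" for n unfolding a_def using ne[of n] by simp
  let ?Y = "\<lambda>n w. a n *\<^sub>R (X (t n) w - X s w)"
  have "(\<lambda>n. regression_map M (X t\<^sub>0) (?Y n) x) \<longlonglongrightarrow> 0"
  proof (rule regression_map_tendsto_0[OF gX[OF t0]])
    show "gvec (?Y n)" for n by (intro gvec_scaleR gvec_diff gX t(1) s)
    fix w
    obtain L \<delta> where L: "0 < \<delta>" "\<And>t. t \<in> T \<Longrightarrow> dist t s < \<delta> \<Longrightarrow> norm (X t w - X s w) \<le> L * norm (t - s)" using lip by metis
    obtain n0 where n0: "1 / real (Suc n0) < \<delta>" using L(1) nat_approx_posE by blast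
    have "\<forall>\<^sub>F n in sequentially. norm (?Y n w) \<le> L * (1 / real (Suc n))"
      using eventually_ge_at_top[of n0]
    proof eventually_elim
      case (elim n)
      have "1 / real (Suc n) \<le> 1 / real (Suc n0)" using elim by (intro divide_left_mono) auto
      then have "dist (t n) s < \<delta>" using t(2)[of n] n0 by linarith
      then have "norm (X (t n) w - X s w) \<le> L * norm (t n - s)" by (intro L(2) t(1))
      then have "norm (?Y n w) \<le> a n * (L * norm (t n - s))" using a0[of n] by simp
      also have "\<dots> = L * (1 / real (Suc n))" using ne[of n] by (simp add: a_def)
      finally show ?case .
    qed
    moreover have "(\<lambda>n. L * (1 / real (Suc n))) \<longlonglongrightarrow> L * 0"
      using LIMSEQ_inverse_real_of_nat by (intro tendsto_mult_left) (simp add: inverse_eq_divide)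
    then have "(\<lambda>n. L * (1 / real (Suc n))) \<longlonglongrightarrow> 0" by simp
    ultimately show "(\<lambda>n. ?Y n w) \<longlonglongrightarrow> 0" by (rule Lim_null_comparison)
  qed
  then have "\<forall>\<^sub>F n in sequentially. norm (regression_map M (X t\<^sub>0) (?Y n) x) < 1"
    by (intro order_tendstoD(2)[OF tendsto_norm_zero]) auto
  then obtain n where n: "norm (regression_map M (X t\<^sub>0) (?Y n) x) < 1" by (meson eventually_happens sequentially_bot)
  have "regression_map M (X t\<^sub>0) (?Y n) x = a n *\<^sub>R (C (t n) x - C s x)"
    unfolding regression_map_scaleR[OF gX[OF t0] gvec_diff[OF gX[OF t(1)] gX[OF s]]]
      regression_map_diff[OF gX[OF t0] gX[OF t(1)] gX[OF s]] C_def ..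
  then have "a n * norm (C (t n) x - C s x) < 1" using n a0[of n] by simp
  moreover have "a n * norm (C (t n) x - C s x) \<ge> a n * (real (Suc n) * norm (t n - s))"
    using t(3)[of n] a0[of n] by (intro mult_left_mono) auto
  moreover have "a n * (real (Suc n) * norm (t n - s)) = 1" unfolding a_def using ne[of n] by simp
  ultimately show False by simp
qed

text \<open>For each w the map t -> G t w is Lipschitz at every point of K, with constants depending
  on point and w. The dimension condition lets such a map send null sets to null sets, and X t_0,
  independent of G and with a density, avoids the image.\<close>

lemma AE_no_root_negligible:
  assumes lip: "\<And>w s. s \<in> T \<Longrightarrow> \<exists>L \<delta>. 0 < \<delta> \<and> (\<forall>t\<in>T. dist t s < \<delta> \<longrightarrow> norm (X t w - X s w) \<le> L * norm (t - s))"
    and K: "compact K" "K \<subseteq> V" "negligible K" and dim: "DIM('a) \<le> DIM('b)"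
  shows "AE w in M. \<not> (\<exists>t\<in>K. X t w = u)"
proof -
  let ?F = "\<lambda>t p. G t (snd p) - fst p"
  define E where "E = {p\<in>space (borel \<Otimes>\<^sub>M N). \<exists>t\<in>K. ?F t p = 0}"
  have E[measurable]: "E \<in> sets (borel \<Otimes>\<^sub>M N)"
    unfolding E_def
  proof (rule measurable_exists_zero_compact[OF K(1)])
    show "continuous_on K (\<lambda>t. ?F t p)" for p
      by (intro continuous_intros continuous_on_subset[OF contG K(2)])
    show "?F t \<in> borel_measurable (borel \<Otimes>\<^sub>M N)" if "t \<in> K" for t
      using G_measurable[of t] that K(2) by (intro borel_measurable_diff measurable_fst measurable_compose[OF measurable_snd]) auto
  qed
  have Gneg: "negligible ((\<lambda>t. G t w) ` K)" for w
  proof (rule negligible_locally_Lipschitz_image[OF dim K(3)])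
    fix s assume sK: "s \<in> K"
    then have s: "s \<in> V" using K(2) by blast
    let ?z = "G s w - X t\<^sub>0 w"
    obtain L1 d1 where 1: "0 < d1" "\<And>t. t \<in> T \<Longrightarrow> dist t s < d1 \<Longrightarrow> norm (X t w - X s w) \<le> L1 * norm (t - s)"
      using lip[OF VT[OF s]] by metis
    obtain L2 d2 where 2: "0 < d2" "\<And>t. t \<in> T \<Longrightarrow> dist t s < d2 \<Longrightarrow> norm (C t ?z - C s ?z) \<le> L2 * norm (t - s)"
      using C_pointwise_Lipschitz[OF lip[OF VT[OF s]] VT[OF s], of ?z] by metis
    have "norm (G t w - G s w) \<le> (2 * (L1 + L2)) * norm (t - s)" if t: "t \<in> K \<inter> ball s (min d1 d2)" for t
    proof -
      have tV: "t \<in> V" and td: "dist t s < d1" "dist t s < d2" using t K(2) by (auto simp: dist_commute)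
      have "norm (G t w - G s w) \<le> 2 * norm ((X t w + C t ?z) - (X s w + C s ?z))"
        unfolding G_diff[OF tV s] norm_minus_cancel by (rule norm_J[OF tV])
      also have "\<dots> \<le> 2 * (norm (X t w - X s w) + norm (C t ?z - C s ?z))"
        by (intro mult_left_mono norm_diff_triangle_ineq) simp
      also have "\<dots> \<le> 2 * (L1 * norm (t - s) + L2 * norm (t - s))"
        by (intro mult_left_mono add_mono 1(2) 2(2) VT[OF tV] td) simp
      finally show ?thesis by (simp add: algebra_simps)
    qed
    then show "\<exists>U B. open U \<and> s \<in> U \<and> (\<forall>y\<in>K \<inter> U. norm (G y w - G s w) \<le> B * norm (y - s))"
      using 1(1) 2(1) by (intro exI[of _ "ball s (min d1 d2)"] exI[of _ "2 * (L1 + L2)"]) auto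
  qed
  have iE: "(\<lambda>p. indicator E p :: ennreal) \<in> borel_measurable (borel \<Otimes>\<^sub>M N)" by measurable
  have "(\<integral>\<^sup>+w. indicator E (X t\<^sub>0 w, w) \<partial>M) = (\<integral>\<^sup>+w. \<integral>\<^sup>+x. ennreal (continuous_density M (X t\<^sub>0) x) * indicator E (x, w) \<partial>lborel \<partial>M)"
    by (rule nn_integral_path[OF iE])
  also have "\<dots> = (\<integral>\<^sup>+w. 0 \<partial>M)"
  proof (rule nn_integral_cong)
    fix w
    have "AE x in lborel. x \<notin> (\<lambda>t. G t w) ` K"
      using AE_not_in[of "(\<lambda>t. G t w) ` K" lebesgue] Gneg[of w] by (simp add: negligible_iff_null_sets AE_completion_iff)
    then have "AE x in lborel. ennreal (continuous_density M (X t\<^sub>0) x) * indicator E (x, w) = 0"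
      by eventually_elim (auto simp: E_def indicator_def)
    then have "(\<integral>\<^sup>+x. ennreal (continuous_density M (X t\<^sub>0) x) * indicator E (x, w) \<partial>lborel) = (\<integral>\<^sup>+x. 0 \<partial>(lborel :: 'b measure))"
      by (rule nn_integral_cong_AE)
    then show "(\<integral>\<^sup>+x. ennreal (continuous_density M (X t\<^sub>0) x) * indicator E (x, w) \<partial>lborel) = 0" by simp
  qed
  finally have z: "(\<integral>\<^sup>+w. indicator E (X t\<^sub>0 w, w) \<partial>M) = 0" by simp
  have "(\<lambda>w. (X t\<^sub>0 w, w)) \<in> M \<rightarrow>\<^sub>M borel \<Otimes>\<^sub>M N"
    using gvec_measurable[OF gX[OF t0]] residuals_subalgebra[of "X t\<^sub>0"]
    by (intro measurable_Pair) (auto simp: subalgebra_def intro!: measurableI)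
  from measurable_compose[OF this iE] z have "AE w in M. indicator E (X t\<^sub>0 w, w) = (0::ennreal)"
    by (subst (asm) nn_integral_0_iff_AE) auto
  then show ?thesis
  proof (rule AE_mp, intro AE_I2 impI notI)
    fix w assume w: "w \<in> space M" "indicator E (X t\<^sub>0 w, w) = (0::ennreal)" "\<exists>t\<in>K. X t w = u"
    then obtain t where t: "t \<in> K" "X t w = u" by blast
    then have "G t w = X t\<^sub>0 w" using X_eq_iff[of t w] K(2) by blast
    then have "(X t\<^sub>0 w, w) \<in> E" unfolding E_def using t(1) w(1) by (auto simp: space_pair_measure)
    then show False using w(2) by simp
  qed
qed

end

section \<open>The expected number of roots near a base point and globally\<close>

lemma adet_uminus: "adet (\<lambda>x. - x :: 'a::euclidean_space) = 1"
proof -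
  have "(to_coords \<circ> (\<lambda>x. - x :: 'a) \<circ> of_coords) = (*\<^sub>R) (-1)"
    by (rule ext) (simp add: linear_neg[OF linear_to_coords])
  then show ?thesis unfolding adet_matrix by (simp only: det_matrix_scaleR) (simp add: power_abs)
qed

lemma adet_ident: "adet (\<lambda>x. x :: 'a::euclidean_space) = 1"
  using adet_compose[of "\<lambda>x. - x :: 'a" "\<lambda>x. - x"] by (simp add: adet_uminus linear_uminus)

text \<open>The area formula for a bijective linear map, all of whose fibres are singletons; it
  identifies the constant of the linear change of variables as the absolute determinant.\<close>

lemma nn_integral_linear_adet:
  fixes A :: "'a::euclidean_space \<Rightarrow> 'a"
  assumes lin: "linear A" and "inj A" and f: "f \<in> borel_measurable borel"
  shows "(\<integral>\<^sup>+x. f x \<partial>lborel) = ennreal (adet A) * (\<integral>\<^sup>+x. f (A x) \<partial>lborel)"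
proof -
  have bl: "bounded_linear A" using lin by (simp add: linear_conv_bounded_linear)
  have s: "surj A" using linear_injective_imp_surjective[OF lin \<open>inj A\<close>] by simp
  have "{t\<in>UNIV. A t = x} = {inv A x}" for x
    using s \<open>inj A\<close> by (auto simp: surj_f_inv_f inv_f_f)
  then have "(\<integral>\<^sup>+x. f x \<partial>lborel) = (\<integral>\<^sup>+x. f x * emeasure (count_space UNIV) {t\<in>UNIV. A t = x} \<partial>lborel)" by simp
  also have "\<dots> = (\<integral>\<^sup>+t. indicator UNIV t * (ennreal (adet A) * f (A t)) \<partial>lborel)"
    by (rule area_formula[OF open_UNIV _ _ fsigma_UNIV subset_UNIV f])
      (auto intro: bounded_linear_imp_has_derivative[OF bl])
  also have "\<dots> = ennreal (adet A) * (\<integral>\<^sup>+x. f (A x) \<partial>lborel)"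
    by (simp, rule nn_integral_cmult) (simp add: measurable_compose[OF linear_borel_measurable[OF lin] f])
  finally show ?thesis .
qed

text \<open>The derivative of X at t is the linear map \<Phi> (Y t w), with Y a vector in a
  Euclidean space so that Gaussian regression applies to it. In the application Y is the tuple of
  Jacobian matrices and \<Phi> is \<open>block_mult\<close>.\<close>

locale gaussian_path_deriv = gaussian_path M H X T t\<^sub>0 u
  for M :: "'w measure" and H and X :: "'a::euclidean_space \<Rightarrow> 'w \<Rightarrow> 'a" and T t\<^sub>0 u +
  fixes Y :: "'a \<Rightarrow> 'w \<Rightarrow> 'c::euclidean_space" and \<Phi> :: "'c \<Rightarrow> 'a \<Rightarrow> 'a"
  assumes openT: "open T" and gY: "\<And>t. t \<in> T \<Longrightarrow> gvec (Y t)" and contY: "\<And>w. continuous_on T (\<lambda>t. Y t w)"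
    and derX: "\<And>t w. t \<in> T \<Longrightarrow> ((\<lambda>s. X s w) has_derivative \<Phi> (Y t w)) (at t)"
    and \<Phi>: "bounded_bilinear \<Phi>" and contF: "continuous_on UNIV (\<lambda>y. adet (\<Phi> y))"
    and nd: "\<And>t. t \<in> T \<Longrightarrow> nondegenerate M (X t)"
begin

definition "D t = regression_map M (X t\<^sub>0) (Y t)"
text \<open>The value of Y t after replacing X t_0 by G t in the decomposition into residual and
  regression part. It coincides with Y t when X t = u.\<close>

definition "P t w = Y t w + D t (G t w - X t\<^sub>0 w)"
definition "G' t w h = - J t (\<Phi> (P t w) h)"

lemma linear_\<Phi>: "linear (\<Phi> y)" "linear (\<lambda>y. \<Phi> y h)"
  using bounded_bilinear.bounded_linear_right[OF \<Phi>] bounded_bilinear.bounded_linear_left[OF \<Phi>]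
  by (simp_all add: linear_conv_bounded_linear)

lemma linD: "t \<in> T \<Longrightarrow> linear (D t)"
  unfolding D_def by (rule linear_regression_map[OF gX[OF t0] nd0 gY])

lemma contD: "continuous_on T (\<lambda>t. D t x)"
  unfolding D_def by (rule continuous_on_regression_map[OF gX[OF t0] gY contY])

lemma regression_\<Phi>: "t \<in> T \<Longrightarrow> regression_map M (X t\<^sub>0) (\<lambda>w. \<Phi> (Y t w) h) x = \<Phi> (D t x) h"
  unfolding D_def by (rule regression_map_linear[OF gX[OF t0] gY linear_\<Phi>(2)])

lemma derC:
  assumes t: "t \<in> T" shows "((\<lambda>s. C s x) has_derivative \<Phi> (D t x)) (at t)"
proof -
  have "((\<lambda>s. regression_map M (X t\<^sub>0) (X s) x) has_derivative (\<lambda>h. regression_map M (X t\<^sub>0) (\<lambda>w. \<Phi> (Y t w) h) x)) (at t)"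
  proof (rule has_derivative_regression_map[OF gX[OF t0] openT t gX])
    show "gvec (\<lambda>w. \<Phi> (Y t w) h)" for h by (rule gvec_linear[OF gY[OF t] linear_\<Phi>(2)])
    show "((\<lambda>s. X s w) has_derivative \<Phi> (Y t w)) (at t)" for w by (rule derX[OF t])
    show "bounded_linear (\<lambda>h. regression_map M (X t\<^sub>0) (\<lambda>w. \<Phi> (Y t w) h) x)"
      unfolding regression_\<Phi>[OF t] by (rule bounded_bilinear.bounded_linear_right[OF \<Phi>])
  qed
  then show ?thesis unfolding regression_\<Phi>[OF t] C_def .
qed

lemma openVT: "open V" by (rule openV[OF openT])

text \<open>By \<open>G_diff\<close> the increment is - J t (f t - f s) with a differentiable f, so
  continuity of J at s is enough. The derivative of f is \<Phi> (Y s) + \<Phi> (D s z) = \<Phi> (P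
  s), because C has the derivative \<Phi> (D).\<close>

lemma derG:
  assumes s: "s \<in> V" shows "((\<lambda>t. G t w) has_derivative G' s w) (at s)"
proof -
  let ?z = "G s w - X t\<^sub>0 w"
  define f where "f t = X t w + C t ?z" for t
  let ?f' = "\<Phi> (P s w)"
  have f': "?f' = (\<lambda>h. \<Phi> (Y s w) h + \<Phi> (D s ?z) h)"
    unfolding P_def by (rule ext) (rule bounded_bilinear.add_left[OF \<Phi>])
  have df: "(f has_derivative ?f') (at s)"
    unfolding f' f_def by (intro has_derivative_add derX derC VT s)
  have blf: "bounded_linear ?f'" by (rule bounded_bilinear.bounded_linear_right[OF \<Phi>])
  have linG': "bounded_linear (G' s w)"
    unfolding G'_def using linear_compose[OF linear_compose[OF linear_\<Phi>(1) linJ[OF s]] linear_uminus]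
    by (simp add: linear_conv_bounded_linear comp_def)
  let ?rem = "\<lambda>t. norm (f t - f s - ?f' (t - s)) / norm (t - s)"
  let ?j = "\<lambda>t. \<Sum>b\<in>Basis. norm (J t (?f' b) - J s (?f' b))"
  have remz: "(?rem \<longlongrightarrow> 0) (at s)" using df unfolding has_derivative_iff_norm by simp
  have Jc: "((\<lambda>t. J t y) \<longlongrightarrow> J s y) (at s)" for y
    using contJ[OF continuous_on_const, of y] s openVT by (simp add: continuous_on_eq_continuous_at isCont_def)
  have "(?j \<longlongrightarrow> (\<Sum>b\<in>Basis. norm (J s (?f' b) - J s (?f' b)))) (at s)" by (intro tendsto_intros Jc)
  then have jz: "(?j \<longlongrightarrow> 0) (at s)" by simp
  have "((\<lambda>t. 2 * ?rem t + ?j t) \<longlongrightarrow> 2 * 0 + 0) (at s)" by (intro tendsto_intros remz jz)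
  then have bz: "((\<lambda>t. 2 * ?rem t + ?j t) \<longlongrightarrow> 0) (at s)" by simp
  have "\<forall>\<^sub>F t in at s. norm (norm (G t w - G s w - G' s w (t - s)) / norm (t - s)) \<le> 2 * ?rem t + ?j t"
    using eventually_at_in_open'[OF openVT s]
  proof eventually_elim
    case t: (elim t)
    let ?h = "t - s"
    note lt = linJ[OF t]
    have "G t w - G s w - G' s w ?h = - J t (f t - f s) + J s (?f' ?h)"
      unfolding G_diff[OF t s] G'_def f_def by simp
    also have "\<dots> = - J t (f t - f s - ?f' ?h) - (J t (?f' ?h) - J s (?f' ?h))"
      by (simp add: linear_diff[OF lt])
    finally have e: "norm (G t w - G s w - G' s w ?h) \<le> norm (J t (f t - f s - ?f' ?h)) + norm (J t (?f' ?h) - J s (?f' ?h))"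
      using norm_triangle_ineq4[of "- J t (f t - f s - ?f' ?h)" "J t (?f' ?h) - J s (?f' ?h)"] by simp
    have fh: "?f' ?h = (\<Sum>b\<in>Basis. (?h \<bullet> b) *\<^sub>R ?f' b)"
      using linear_sum[OF linear_\<Phi>(1)[of "P s w"], of "\<lambda>b. (?h \<bullet> b) *\<^sub>R b" Basis]
      by (simp add: euclidean_representation linear_cmul[OF linear_\<Phi>(1)])
    have e2: "J t (?f' ?h) - J s (?f' ?h) = (\<Sum>b\<in>Basis. (?h \<bullet> b) *\<^sub>R (J t (?f' b) - J s (?f' b)))"
      unfolding fh linear_sum[OF lt] linear_sum[OF linJ[OF s]]
      by (simp only: linear_cmul[OF lt] linear_cmul[OF linJ[OF s]] scaleR_diff_right sum_subtractf)
    have "norm (J t (?f' ?h) - J s (?f' ?h)) \<le> (\<Sum>b\<in>Basis. norm ?h * norm (J t (?f' b) - J s (?f' b)))"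
      unfolding e2
    proof (rule sum_norm_le)
      fix b :: 'a assume b: "b \<in> Basis"
      show "norm ((?h \<bullet> b) *\<^sub>R (J t (?f' b) - J s (?f' b))) \<le> norm ?h * norm (J t (?f' b) - J s (?f' b))"
        unfolding norm_scaleR by (rule mult_right_mono[OF Basis_le_norm[OF b] norm_ge_zero])
    qed
    then have "norm (J t (?f' ?h) - J s (?f' ?h)) \<le> norm ?h * ?j t" by (simp only: sum_distrib_left)
    then have "norm (G t w - G s w - G' s w ?h) \<le> 2 * norm (f t - f s - ?f' ?h) + norm ?h * ?j t"
      using e norm_J[OF t, of "f t - f s - ?f' ?h"] by linarith
    then have "norm (G t w - G s w - G' s w ?h) / norm ?h \<le> (2 * norm (f t - f s - ?f' ?h) + norm ?h * ?j t) / norm ?h"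
      by (rule divide_right_mono) simp
    also have "\<dots> \<le> 2 * ?rem t + ?j t"
      by (cases "?h = 0") (simp_all add: add_divide_distrib sum_nonneg)
    finally show ?case by simp
  qed
  then have "((\<lambda>t. norm (G t w - G s w - G' s w (t - s)) / norm (t - s)) \<longlongrightarrow> 0) (at s)"
    by (rule Lim_null_comparison[OF _ bz])
  then show ?thesis unfolding has_derivative_iff_norm using linG' by simp
qed

lemma contP: "continuous_on V (\<lambda>t. P t w)"
proof -
  have e: "P t w = Y t w + (\<Sum>b\<in>Basis. ((G t w - X t\<^sub>0 w) \<bullet> b) *\<^sub>R D t b)" if "t \<in> V" for t
    using linear_sum[OF linD[OF VT[OF that]], of "\<lambda>b. ((G t w - X t\<^sub>0 w) \<bullet> b) *\<^sub>R b" Basis]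
    by (simp add: P_def euclidean_representation linear_cmul[OF linD[OF VT[OF that]]])
  have sub: "V \<subseteq> T" by (auto simp: VT)
  have "continuous_on V (\<lambda>t. Y t w + (\<Sum>b\<in>Basis. ((G t w - X t\<^sub>0 w) \<bullet> b) *\<^sub>R D t b))"
    by (intro continuous_intros contG continuous_on_subset[OF contY sub] continuous_on_subset[OF contD sub])
  then show ?thesis by (rule continuous_on_eq) (simp add: e)
qed

lemma contG': "continuous_on V (\<lambda>t. G' t w h)"
  unfolding G'_def
  by (intro continuous_on_minus contJ bounded_bilinear.continuous_on[OF \<Phi> contP continuous_on_const])

lemma adet_G': "t \<in> V \<Longrightarrow> adet (G' t w) = adet (J t) * adet (\<Phi> (P t w))"
proof -
  assume t: "t \<in> V"
  have "adet (G' t w) = adet (\<lambda>x. - x :: 'a) * adet (\<lambda>h. J t (\<Phi> (P t w) h))"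
    unfolding G'_def[abs_def] by (rule adet_compose[OF linear_uminus linear_compose[OF linear_\<Phi>(1) linJ[OF t], unfolded comp_def]])
  also have "\<dots> = adet (J t) * adet (\<Phi> (P t w))"
    by (simp add: adet_uminus adet_compose[OF linJ[OF t] linear_\<Phi>(1)])
  finally show ?thesis .
qed

definition rice_density where
  "rice_density t = gaussian_cond_exp M (\<lambda>y. ennreal (adet (\<Phi> y))) (Y t) (X t) u * ennreal (continuous_density M (X t) u)"

text \<open>The integrand that the area formula produces for one sample point: the density of X t_0
  at G t times the Jacobian of G.\<close>

definition Q where "Q t w = continuous_density M (X t\<^sub>0) (G t w) * adet (G' t w)"

lemma P_measurable: "t \<in> V \<Longrightarrow> P t \<in> borel_measurable M"
proof -
  assume t: "t \<in> V"
  have [measurable]: "G t \<in> borel_measurable M" by (rule measurable_from_subalg[OF residuals_subalgebra G_measurable[OF t]])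
  have [measurable]: "Y t \<in> borel_measurable M" "X t\<^sub>0 \<in> borel_measurable M"
    by (rule gvec_measurable[OF gY[OF VT[OF t]]], rule gvec_measurable[OF gX[OF t0]])
  have [measurable]: "D t \<in> borel_measurable borel" by (rule linear_borel_measurable[OF linD[OF VT[OF t]]])
  show ?thesis unfolding P_def[abs_def] by measurable
qed

lemma Q_measurable: "t \<in> V \<Longrightarrow> Q t \<in> borel_measurable M"
proof -
  assume t: "t \<in> V"
  have 1: "(\<lambda>w. continuous_density M (X t\<^sub>0) (G t w)) \<in> borel_measurable M"
    by (rule measurable_compose[OF measurable_from_subalg[OF residuals_subalgebra G_measurable[OF t]]
        borel_measurable_continuous_onI[OF continuous_density_props(1)[OF gX[OF t0] nd0]]])
  have 2: "(\<lambda>w. adet (\<Phi> (P t w))) \<in> borel_measurable M"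
    by (rule measurable_compose[OF P_measurable[OF t] borel_measurable_continuous_onI[OF contF]])
  show ?thesis unfolding Q_def[abs_def] adet_G'[OF t] by (intro borel_measurable_times 1 borel_measurable_const 2)
qed

lemma contQ: "continuous_on V (\<lambda>t. Q t w)"
  unfolding Q_def
  by (intro continuous_on_mult continuous_on_adet contG'
    continuous_on_compose2[OF continuous_density_props(1)[OF gX[OF t0] nd0] contG]) auto

lemma VB[measurable]: "V \<in> sets borel" using openVT by simp

lemma Q_joint: "(\<lambda>z. indicator V (fst z) *\<^sub>R Q (fst z) (snd z)) \<in> borel_measurable (borel \<Otimes>\<^sub>M M)"
  by (rule measurable_caratheodory[OF VB contQ Q_measurable])

lemma rice_density_eq: "t \<in> V \<Longrightarrow> rice_density t = (\<integral>\<^sup>+w. ennreal (Q t w) \<partial>M)"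
proof -
  assume t: "t \<in> V"
  note T = VT[OF t]
  \<comment> \<open>The Jacobian of J is the reciprocal of that of C, which is the factor 1/c in the
    regression identity.\<close>
  have c: "adet (C t) * adet (J t) = 1"
    using adet_compose[OF linC[OF T] linJ[OF t]] by (simp add: CJ[OF t] adet_ident)
  have c0: "adet (C t) > 0" using c adet_nonneg[of "C t"] by (cases "adet (C t) = 0") auto
  have Jc: "adet (J t) = 1 / adet (C t)" using c c0 by (simp add: field_simps)
  have "(\<integral>\<^sup>+w. ennreal (continuous_density M (X t\<^sub>0) (J t (u - (X t w - regression_map M (X t\<^sub>0) (X t) (X t\<^sub>0 w)))) *
            (adet (\<Phi> ((Y t w - regression_map M (X t\<^sub>0) (Y t) (X t\<^sub>0 w)) + regression_map M (X t\<^sub>0) (Y t) (J t (u - (X t w - regression_map M (X t\<^sub>0) (X t) (X t\<^sub>0 w)))))) / adet (C t))) \<partial>M) = rice_density t"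
    unfolding rice_density_def
  proof (rule regression_identity[OF gX[OF t0] nd0 gX[OF T] nd[OF T] gY[OF T] linJ[OF t] _ _ c0 _ contF adet_nonneg])
    show "J t (regression_map M (X t\<^sub>0) (X t) x) = x" for x using JC[OF t] by (simp add: C_def)
    show "regression_map M (X t\<^sub>0) (X t) (J t x) = x" for x using CJ[OF t] by (simp add: C_def)
    show "(\<integral>\<^sup>+x. f x \<partial>lborel) = ennreal (adet (C t)) * (\<integral>\<^sup>+x. f (regression_map M (X t\<^sub>0) (X t) x) \<partial>lborel)"
      if "f \<in> borel_measurable borel" for f
      using nn_integral_linear_adet[OF linC[OF T] injC[OF t] that] by (simp add: C_def)
  qed
  moreover have "continuous_density M (X t\<^sub>0) (J t (u - (X t w - regression_map M (X t\<^sub>0) (X t) (X t\<^sub>0 w)))) *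
            (adet (\<Phi> ((Y t w - regression_map M (X t\<^sub>0) (Y t) (X t\<^sub>0 w)) + regression_map M (X t\<^sub>0) (Y t) (J t (u - (X t w - regression_map M (X t\<^sub>0) (X t) (X t\<^sub>0 w)))))) / adet (C t)) = Q t w" for w
    unfolding Q_def adet_G'[OF t] Jc P_def G_def R_def D_def[symmetric] C_def[symmetric]
    by (simp add: linear_diff[OF linD[OF T]] add_diff_eq diff_add_eq)
  ultimately show ?thesis by simp
qed

lemma rice_density_measurable: "(\<lambda>t. indicator V t * rice_density t) \<in> borel_measurable borel"
proof -
  have "(\<lambda>t. \<integral>\<^sup>+w. ennreal (indicator V t *\<^sub>R Q t w) \<partial>M) \<in> borel_measurable borel"
    by (rule borel_measurable_nn_integral) (use Q_joint in \<open>simp add: case_prod_unfold\<close>)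
  moreover have "(\<integral>\<^sup>+w. ennreal (indicator V t *\<^sub>R Q t w) \<partial>M) = indicator V t * rice_density t" for t
    by (cases "t \<in> V") (auto simp: rice_density_eq)
  ultimately show ?thesis by simp
qed

lemma rice_local:
  assumes B: "fsigma B" "B \<subseteq> V"
  shows "(\<integral>\<^sup>+w. emeasure (count_space UNIV) {t\<in>B. X t w = u} \<partial>M) = (\<integral>\<^sup>+t. indicator B t * rice_density t \<partial>lborel)"
proof -
  have Bb[measurable]: "B \<in> sets borel" by (rule fsigma_borel[OF B(1)])
  define \<Psi> where "\<Psi> p = emeasure (count_space UNIV) {t\<in>B. G t (snd p) - fst p = 0}" for p
  have \<Psi>m: "\<Psi> \<in> borel_measurable (borel \<Otimes>\<^sub>M N)"
    unfolding \<Psi>_def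
  proof (rule measurable_count_zeros[OF B(1)])
    show "continuous_on B (\<lambda>t. G t (snd p) - fst p)" for p
      by (intro continuous_intros continuous_on_subset[OF contG B(2)])
    show "(\<lambda>p. G t (snd p) - fst p) \<in> borel_measurable (borel \<Otimes>\<^sub>M N)" if "t \<in> B" for t
      using G_measurable[of t] that B(2) by (intro borel_measurable_diff measurable_fst measurable_compose[OF measurable_snd]) auto
  qed
  have pm: "(\<lambda>x. ennreal (continuous_density M (X t\<^sub>0) x)) \<in> borel_measurable borel"
    by (rule measurable_compose[OF borel_measurable_continuous_onI[OF continuous_density_props(1)[OF gX[OF t0] nd0]] measurable_ennreal])
  have "(\<integral>\<^sup>+w. emeasure (count_space UNIV) {t\<in>B. X t w = u} \<partial>M) = (\<integral>\<^sup>+w. \<Psi> (X t\<^sub>0 w, w) \<partial>M)"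
  proof (rule nn_integral_cong)
    fix w
    have "{t\<in>B. X t w = u} = {t\<in>B. G t w - X t\<^sub>0 w = 0}" using X_eq_iff B(2) by auto
    then show "emeasure (count_space UNIV) {t\<in>B. X t w = u} = \<Psi> (X t\<^sub>0 w, w)" by (simp add: \<Psi>_def)
  qed
  also have "\<dots> = (\<integral>\<^sup>+w. \<integral>\<^sup>+x. ennreal (continuous_density M (X t\<^sub>0) x) * \<Psi> (x, w) \<partial>lborel \<partial>M)"
    by (rule nn_integral_path[OF \<Psi>m])
  also have "\<dots> = (\<integral>\<^sup>+w. \<integral>\<^sup>+t. indicator B t * ennreal (indicator V t *\<^sub>R Q t w) \<partial>lborel \<partial>M)"
  proof (rule nn_integral_cong)
    fix w
    have "(\<integral>\<^sup>+x. ennreal (continuous_density M (X t\<^sub>0) x) * \<Psi> (x, w) \<partial>lborel) =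
      (\<integral>\<^sup>+x. ennreal (continuous_density M (X t\<^sub>0) x) * emeasure (count_space UNIV) {t\<in>B. G t w = x} \<partial>lborel)"
      by (simp add: \<Psi>_def)
    also have "\<dots> = (\<integral>\<^sup>+t. indicator B t * (ennreal (adet (G' t w)) * ennreal (continuous_density M (X t\<^sub>0) (G t w))) \<partial>lborel)"
      by (rule area_formula[OF openVT derG contG' B pm])
    also have "\<dots> = (\<integral>\<^sup>+t. indicator B t * ennreal (indicator V t *\<^sub>R Q t w) \<partial>lborel)"
      by (rule nn_integral_cong)
        (use B(2) in \<open>auto simp: indicator_def Q_def ennreal_mult adet_nonneg continuous_density_props(2)[OF gX[OF t0] nd0] mult.commute\<close>)
    finally show "(\<integral>\<^sup>+x. ennreal (continuous_density M (X t\<^sub>0) x) * \<Psi> (x, w) \<partial>lborel) = \<dots>" .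
  qed
  also have "\<dots> = (\<integral>\<^sup>+t. \<integral>\<^sup>+w. indicator B t * ennreal (indicator V t *\<^sub>R Q t w) \<partial>M \<partial>lborel)"
  proof -
    interpret LM: pair_sigma_finite lborel M ..
    have "(\<lambda>z. indicator V (fst z) *\<^sub>R Q (fst z) (snd z)) \<in> borel_measurable (lborel \<Otimes>\<^sub>M M)"
      using Q_joint by (simp cong: measurable_cong_sets sets_pair_measure_cong)
    then have "(\<lambda>z. indicator B (fst z) * ennreal (indicator V (fst z) *\<^sub>R Q (fst z) (snd z))) \<in> borel_measurable (lborel \<Otimes>\<^sub>M M)"
      by measurable
    then show ?thesis by (intro LM.Fubini') (simp add: case_prod_unfold)
  qed
  also have "\<dots> = (\<integral>\<^sup>+t. indicator B t * rice_density t \<partial>lborel)"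
  proof (rule nn_integral_cong)
    fix t
    show "(\<integral>\<^sup>+w. indicator B t * ennreal (indicator V t *\<^sub>R Q t w) \<partial>M) = indicator B t * rice_density t"
      using B(2) by (cases "t \<in> B") (auto simp: rice_density_eq)
  qed
  finally show ?thesis .
qed

end

text \<open>A countable subcover is made disjoint; each piece is an open set minus finitely many
  open sets, hence F-sigma. A piece that is empty has no centre, which accounts for the alternative
  in the last clause.\<close>

lemma fsigma_partition:
  fixes T :: "'a::euclidean_space set"
  assumes V: "\<And>t. t \<in> T \<Longrightarrow> open (V t) \<and> t \<in> V t \<and> V t \<subseteq> T"
  shows "\<exists>(s :: nat \<Rightarrow> 'a) B. (\<forall>n. fsigma (B n)) \<and> disjoint_family B \<and> (\<Union>n. B n) = T \<and>
    (\<forall>n. B n = {} \<or> (s n \<in> T \<and> B n \<subseteq> V (s n)))"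
proof -
  have "open S" if "S \<in> V ` T" for S using that V by blast
  from Lindelof[OF this] obtain F where F: "F \<subseteq> V ` T" "countable F" "\<Union>F = \<Union>(V ` T)" by blast
  have UT: "\<Union>(V ` T) = T" using V by blast
  define D where "D n = (if F = {} then {} else from_nat_into F n)" for n
  have D: "D n = {} \<or> (\<exists>s. s \<in> T \<and> D n = V s)" for n
  proof (cases "F = {}")
    case False
    then have "D n \<in> V ` T" using from_nat_into[OF False, of n] F(1) by (auto simp: D_def)
    then show ?thesis by blast
  qed (simp add: D_def)
  define s where "s n = (SOME s. s \<in> T \<and> D n = V s)" for n
  have s: "D n = {} \<or> (s n \<in> T \<and> D n = V (s n))" for n
    unfolding s_def using D[of n] someI_ex[of "\<lambda>s. s \<in> T \<and> D n = V s"] by blast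
  have oD: "open (D n)" for n
  proof (cases "D n = {}")
    case False
    then show ?thesis using s[of n] V[of "s n"] by simp
  qed simp
  have UD: "(\<Union>n. D n) = T"
  proof (cases "F = {}")
    case False
    then have "range D = F" using range_from_nat_into[OF False F(2)] by (simp add: D_def[abs_def])
    then show ?thesis using F(3) UT by simp
  next
    case True
    then have "T = {}" using F(3) UT by simp
    then show ?thesis using True by (simp add: D_def)
  qed
  show ?thesis
  proof (rule exI[of _ s], rule exI[of _ "disjointed D"], intro conjI allI)
    show "fsigma (disjointed D n)" for n
    proof -
      have "disjointed D n = D n \<inter> - (\<Union>i<n. D i)" by (auto simp: disjointed_def)
      moreover have "closed (- (\<Union>i<n. D i))" using oD by (intro closed_Compl open_UN) auto
      ultimately show ?thesis by (simp only: fsigma_Int[OF open_imp_fsigma[OF oD] closed_imp_fsigma])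
    qed
    show "disjoint_family (disjointed D)" by (rule disjoint_family_disjointed)
    show "(\<Union>n. disjointed D n) = T" unfolding UN_disjointed_eq by (rule UD)
    show "disjointed D n = {} \<or> (s n \<in> T \<and> disjointed D n \<subseteq> V (s n))" for n
      using s[of n] disjointed_subset[of D n] by auto
  qed
qed

lemma (in gaussian_space) rice_formula:
  fixes X :: "'a::euclidean_space \<Rightarrow> 'w \<Rightarrow> 'a" and Y :: "'a \<Rightarrow> 'w \<Rightarrow> 'c::euclidean_space"
  assumes openT: "open T" and gX: "\<And>t. t \<in> T \<Longrightarrow> gvec (X t)" and contX: "\<And>w. continuous_on T (\<lambda>t. X t w)"
    and gY: "\<And>t. t \<in> T \<Longrightarrow> gvec (Y t)" and contY: "\<And>w. continuous_on T (\<lambda>t. Y t w)"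
    and derX: "\<And>t w. t \<in> T \<Longrightarrow> ((\<lambda>s. X s w) has_derivative \<Phi> (Y t w)) (at t)"
    and \<Phi>: "bounded_bilinear \<Phi>" and contF: "continuous_on UNIV (\<lambda>y. adet (\<Phi> y))"
    and nd: "\<And>t. t \<in> T \<Longrightarrow> nondegenerate M (X t)"
  shows "(\<integral>\<^sup>+w. emeasure (count_space UNIV) {t\<in>T. X t w = u} \<partial>M) =
    (\<integral>\<^sup>+t. indicator T t * (gaussian_cond_exp M (\<lambda>y. ennreal (adet (\<Phi> y))) (Y t) (X t) u
      * ennreal (continuous_density M (X t) u)) \<partial>lborel)"
proof -
  define \<rho> where "\<rho> t = gaussian_cond_exp M (\<lambda>y. ennreal (adet (\<Phi> y))) (Y t) (X t) u
      * ennreal (continuous_density M (X t) u)" for t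
  have gp: "gaussian_path_deriv M H X T t\<^sub>0 Y \<Phi>" if "t\<^sub>0 \<in> T" for t\<^sub>0
    by (intro gaussian_path_deriv.intro gaussian_path.intro gaussian_path_axioms.intro
      gaussian_path_deriv_axioms.intro gaussian_space_axioms openT gX contX gY contY derX \<Phi> contF nd that)
  have gp': "gaussian_path M H X T t\<^sub>0" if "t\<^sub>0 \<in> T" for t\<^sub>0
    by (rule gaussian_path_deriv.axioms(1)[OF gp[OF that]])
  define V where "V = gaussian_path.V M X T"
  have cov: "open (V t) \<and> t \<in> V t \<and> V t \<subseteq> T" if "t \<in> T" for t
    unfolding V_def using gaussian_path_deriv.openVT[OF gp[OF that]] gaussian_path.t0V[OF gp'[OF that]]
      gaussian_path.VT[OF gp'[OF that]] by blast
  have "\<exists>(s :: nat \<Rightarrow> 'a) B. (\<forall>n. fsigma (B n)) \<and> disjoint_family B \<and> (\<Union>n. B n) = T \<and>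
    (\<forall>n. B n = {} \<or> (s n \<in> T \<and> B n \<subseteq> V (s n)))"
    by (rule fsigma_partition) (rule cov)
  then obtain s :: "nat \<Rightarrow> 'a" and B where sB: "(\<forall>n. fsigma (B n)) \<and> disjoint_family B \<and> (\<Union>n. B n) = T \<and>
    (\<forall>n. B n = {} \<or> (s n \<in> T \<and> B n \<subseteq> V (s n)))"
    by (elim exE)
  have B: "fsigma (B n)" "disjoint_family B" "(\<Union>n. B n) = T" and s: "B n = {} \<or> (s n \<in> T \<and> B n \<subseteq> V (s n))" for n
    using sB by simp_all
  have BT: "B n \<subseteq> T" for n using B(3) by blast
  have Bb: "B n \<in> sets borel" for n by (rule fsigma_borel[OF B(1)])
  have piece: "(\<integral>\<^sup>+w. emeasure (count_space UNIV) {t\<in>B n. X t w = u} \<partial>M) = (\<integral>\<^sup>+t. indicator (B n) t * \<rho> t \<partial>lborel)"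
    and m: "(\<lambda>t. indicator (B n) t * \<rho> t) \<in> borel_measurable borel" for n
  proof -
    have "(\<integral>\<^sup>+w. emeasure (count_space UNIV) {t\<in>B n. X t w = u} \<partial>M) = (\<integral>\<^sup>+t. indicator (B n) t * \<rho> t \<partial>lborel) \<and>
      (\<lambda>t. indicator (B n) t * \<rho> t) \<in> borel_measurable borel"
    proof (cases "B n = {}")
      case False
      then have sn: "s n \<in> T" "B n \<subseteq> V (s n)" using s[of n] by auto
      note g = gp[OF sn(1)]
      have r: "gaussian_path_deriv.rice_density M X u Y \<Phi> = \<rho>"
        unfolding gaussian_path_deriv.rice_density_def[OF g] \<rho>_def by (rule refl)
      have "(\<lambda>t. indicator (B n) t * (indicator (V (s n)) t * \<rho> t)) \<in> borel_measurable borel"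
        by (rule borel_measurable_times_ennreal[OF borel_measurable_indicator[OF Bb]])
          (use gaussian_path_deriv.rice_density_measurable[OF g, of u] in \<open>simp only: r V_def\<close>)
      moreover have "indicator (B n) t * (indicator (V (s n)) t * \<rho> t) = indicator (B n) t * \<rho> t" for t
        using sn(2) by (auto simp: indicator_def)
      ultimately show ?thesis
        using gaussian_path_deriv.rice_local[OF g B(1)[of n] sn(2)[unfolded V_def], of u] unfolding r by simp
    qed simp
    then show "(\<integral>\<^sup>+w. emeasure (count_space UNIV) {t\<in>B n. X t w = u} \<partial>M) = (\<integral>\<^sup>+t. indicator (B n) t * \<rho> t \<partial>lborel)"
      "(\<lambda>t. indicator (B n) t * \<rho> t) \<in> borel_measurable borel" by auto
  qed
  have cm: "(\<lambda>w. emeasure (count_space UNIV) {t\<in>B n. X t w = u}) \<in> borel_measurable M" for n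
  proof -
    have "(\<lambda>w. emeasure (count_space UNIV) {t\<in>B n. X t w - u = 0}) \<in> borel_measurable M"
    proof (rule measurable_count_zeros[OF B(1)])
      show "continuous_on (B n) (\<lambda>t. X t w - u)" for w
        by (intro continuous_intros continuous_on_subset[OF contX BT])
      show "(\<lambda>w. X t w - u) \<in> borel_measurable M" if "t \<in> B n" for t
        using gvec_measurable[OF gX] that BT[of n] by auto
    qed
    then show ?thesis by simp
  qed
  have "(\<integral>\<^sup>+w. emeasure (count_space UNIV) {t\<in>T. X t w = u} \<partial>M) =
    (\<integral>\<^sup>+w. (\<Sum>n. emeasure (count_space UNIV) {t\<in>B n. X t w = u}) \<partial>M)"
  proof (rule nn_integral_cong)
    fix w
    have "{t\<in>T. X t w = u} = (\<Union>n. {t\<in>B n. X t w = u})" using B(3) by blast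
    moreover have "disjoint_family (\<lambda>n. {t\<in>B n. X t w = u})" using B(2) unfolding disjoint_family_on_def by blast
    ultimately show "emeasure (count_space UNIV) {t\<in>T. X t w = u} = (\<Sum>n. emeasure (count_space UNIV) {t\<in>B n. X t w = u})"
      by (subst suminf_emeasure) auto
  qed
  also have "\<dots> = (\<Sum>n. \<integral>\<^sup>+t. indicator (B n) t * \<rho> t \<partial>lborel)"
    unfolding piece[symmetric] by (rule nn_integral_suminf[OF cm])
  also have "\<dots> = (\<integral>\<^sup>+t. (\<Sum>n. indicator (B n) t * \<rho> t) \<partial>lborel)"
    by (rule nn_integral_suminf[symmetric]) (simp add: m)
  also have "\<dots> = (\<integral>\<^sup>+t. indicator T t * \<rho> t \<partial>lborel)"
  proof (rule nn_integral_cong)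
    fix t
    have "(\<Sum>n. indicator (B n) t * \<rho> t) = (\<Sum>n. indicator (B n) t) * \<rho> t" by (rule ennreal_suminf_multc)
    also have "(\<Sum>n. indicator (B n) t :: ennreal) = indicator T t"
      using suminf_indicator[OF B(2), of t] unfolding B(3) .
    finally show "(\<Sum>n. indicator (B n) t * \<rho> t) = indicator T t * \<rho> t" .
  qed
  finally show ?thesis unfolding \<rho>_def .
qed

section \<open>Factorial moments\<close>

text \<open>Both subtractions are truncated at 0, so for fewer than k roots the falling factorial
  has a vanishing factor.\<close>

lemma ennreal_of_nat_diff: "(of_nat (n - i) :: ennreal) = of_nat n - of_nat i"
proof (cases "i \<le> n")
  case True
  then obtain m where "n = i + m" by (metis le_add_diff_inverse)
  then show ?thesis by (simp add: ennreal_add_diff_cancel_left)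
next
  case False
  then have "(of_nat n :: ennreal) \<le> of_nat i" by simp
  then show ?thesis using False by (simp add: diff_eq_0_iff_ennreal of_nat_less_top)
qed

text \<open>For finite A the falling factorial counts injections. For infinite A every factor is
  infinite, and there are infinitely many injective tuples.\<close>

lemma emeasure_injective_tuples:
  fixes A :: "'b set"
  shows "emeasure (count_space UNIV) {t :: 'b^'k::finite. (\<forall>j. t $ j \<in> A) \<and> inj (\<lambda>j. t $ j)} =
    (\<Prod>i<CARD('k). emeasure (count_space UNIV) A - of_nat i)" (is "emeasure _ ?S = _")
proof (cases "finite A")
  case True
  let ?F = "{f \<in> (UNIV :: 'k set) \<rightarrow>\<^sub>E A. inj_on f UNIV}"
  have bij: "bij_betw vec_nth ?S ?F"
    by (rule bij_betw_byWitness[where f' = vec_lambda]) (auto simp: vec_lambda_inverse eta_contract_eq)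
  have fin: "finite ?F" using True by (intro finite_subset[OF _ finite_PiE[of UNIV "\<lambda>_. A"]]) auto
  then have finS: "finite ?S" using bij bij_betw_finite by blast
  have "card ?S = card ?F" by (rule bij_betw_same_card[OF bij])
  also have "\<dots> = prod ((-) (card A)) {0..<CARD('k)}"
    using card_inj_on_subset_funcset[where A = "UNIV :: 'k set" and B = UNIV, OF finite True] by simp
  finally have "emeasure (count_space UNIV) ?S = of_nat (\<Prod>i<CARD('k). card A - i)"
    using finS by (simp add: atLeast0LessThan)
  then show ?thesis using True by (simp add: ennreal_of_nat_diff)
next
  case False
  obtain g :: "nat \<Rightarrow> 'b" where g: "inj g" "range g \<subseteq> A" using infinite_countable_subset[OF False] by blast
  define e where "e = (to_nat_on UNIV :: 'k \<Rightarrow> nat)"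
  have e: "inj e" unfolding e_def using inj_on_to_nat_on[of "UNIV :: 'k set"] by (simp add: countable_finite)
  \<comment> \<open>Reading an injective sequence in A at positions shifted by n gives a different
    injective tuple for each n.\<close>
  define h where "h n = (\<chi> j. g (e j + n) :: 'b^'k)" for n
  have injh: "inj h"
  proof (rule injI)
    fix m n assume "h m = h n"
    then have "h m $ undefined = h n $ undefined" by simp
    then show "m = n" using g(1) by (simp add: h_def inj_eq)
  qed
  have hS: "range h \<subseteq> ?S"
    using g e by (auto simp: h_def inj_eq intro!: injI)
  have "infinite ?S"
    by (rule infinite_super[OF hS range_inj_infinite[OF injh]])
  moreover have "(\<Prod>i<CARD('k). emeasure (count_space UNIV) A - of_nat i) = \<top>"
    using False by (simp add: power_top_ennreal)
  ultimately show ?thesis by simp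
qed

text \<open>It serves to derive nondegeneracy of a single Z(s) from that of a tuple in which s is an
  entry.\<close>

lemma extend_to_injective_tuple:
  assumes s: "s \<in> A" and A: "infinite A \<or> CARD('k::finite) \<le> card A"
  shows "\<exists>(t :: 'b^'k) j. (\<forall>i. t $ i \<in> A) \<and> inj (\<lambda>i. t $ i) \<and> t $ j = s"
proof -
  have "infinite (A - {s}) \<or> CARD('k) - 1 \<le> card (A - {s})" using A s by (cases "finite A") auto
  then obtain C where C: "C \<subseteq> A - {s}" "finite C" "card C = CARD('k) - 1"
  proof
    assume "infinite (A - {s})"
    then have "\<exists>C. finite C \<and> card C = CARD('k) - 1 \<and> C \<subseteq> A - {s}" by (rule infinite_arbitrarily_large)
    then show ?thesis using that by (elim exE conjE)
  next
    assume "CARD('k) - 1 \<le> card (A - {s})"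
    then show ?thesis by (rule obtain_subset_with_card_n) (rule that)
  qed
  then have "card (insert s C) = CARD('k)" using zero_less_card_finite[where 'a='k] by (subst card_insert_disjoint) auto
  then obtain h :: "'k \<Rightarrow> 'b" where h: "bij_betw h UNIV (insert s C)"
    using finite_same_card_bij[of "UNIV :: 'k set" "insert s C"] C(2) by auto
  then obtain j where "h j = s" by (metis bij_betw_imp_surj_on insertI1 rangeE)
  moreover have "h i \<in> A" for i using h C(1) s by (auto simp: bij_betw_def)
  moreover have "inj h" using h by (simp add: bij_betw_def)
  ultimately show ?thesis by (intro exI[of _ "vec_lambda h"] exI[of _ j]) simp
qed

text \<open>The bound comes from the derivative of the extension, so it also holds at boundary
  points of S, where a derivative within S need not be unique.\<close>

lemma C1_on_lipschitz_at:
  assumes "C1_on S f" "s \<in> S"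
  shows "\<exists>L \<delta>. 0 < \<delta> \<and> (\<forall>t\<in>S. dist t s < \<delta> \<longrightarrow> norm (f t - f s) \<le> L * norm (t - s))"
proof -
  obtain U g g' where g: "S \<subseteq> U" "\<And>x. x \<in> S \<Longrightarrow> g x = f x"
    "\<And>x. x \<in> U \<Longrightarrow> (g has_derivative blinfun_apply (g' x)) (at x)"
    using assms(1) unfolding C1_on_def by blast
  have "(g has_derivative blinfun_apply (g' s)) (at s)" using g(1,3) assms(2) by blast
  then obtain d where d: "0 < d" "\<And>y. norm (y - s) < d \<Longrightarrow> norm (g y - g s - blinfun_apply (g' s) (y - s)) \<le> 1 * norm (y - s)"
    unfolding has_derivative_at_alt by (metis zero_less_one)
  show ?thesis
  proof (rule exI[of _ "norm (g' s) + 1"], rule exI[of _ d], intro conjI d(1) ballI impI)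
    fix t assume t: "t \<in> S" "dist t s < d"
    have "norm (g t - g s) \<le> norm (blinfun_apply (g' s) (t - s)) + norm (g t - g s - blinfun_apply (g' s) (t - s))"
      using norm_triangle_sub by blast
    also have "\<dots> \<le> norm (g' s) * norm (t - s) + 1 * norm (t - s)"
      by (intro add_mono norm_blinfun d(2)) (use t in \<open>simp add: dist_norm\<close>)
    finally show "norm (f t - f s) \<le> (norm (g' s) + 1) * norm (t - s)"
      using g(2) t(1) assms(2) by (simp add: distrib_right)
  qed
qed

lemma C1_on_imp_continuous_on:
  assumes "C1_on S f" shows "continuous_on S f"
proof -
  obtain U g g' where g: "S \<subseteq> U" "\<And>x. x \<in> S \<Longrightarrow> g x = f x"
    "\<And>x. x \<in> U \<Longrightarrow> (g has_derivative blinfun_apply (g' x)) (at x)"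
    using assms(1) unfolding C1_on_def by blast
  have "continuous_on S g"
    by (rule continuous_at_imp_continuous_on) (use g(1,3) has_derivative_continuous in blast)
  then show ?thesis using g(2) by (rule continuous_on_eq)
qed

lemma C1_on_jacobian:
  fixes f :: "real^'n \<Rightarrow> real^'m"
  assumes "C1_on S f"
  shows "t \<in> interior S \<Longrightarrow> (f has_derivative (\<lambda>h. jacobian f (at t within S) *v h)) (at t)"
    and "continuous_on (interior S) (\<lambda>t. jacobian f (at t within S))"
proof -
  obtain U g g' where g: "S \<subseteq> U" "\<And>x. x \<in> S \<Longrightarrow> g x = f x"
    "\<And>x. x \<in> U \<Longrightarrow> (g has_derivative blinfun_apply (g' x)) (at x)" "continuous_on U g'"
    using assms(1) unfolding C1_on_def by blast
  have der: "(f has_derivative blinfun_apply (g' t)) (at t)" if t: "t \<in> interior S" for t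
  proof (rule has_derivative_transform_within_open[OF g(3) open_interior t])
    show "t \<in> U" using t g(1) interior_subset by blast
    show "g x = f x" if "x \<in> interior S" for x using g(2) that interior_subset by blast
  qed
  have jac: "jacobian f (at t within S) = matrix (blinfun_apply (g' t))" if t: "t \<in> interior S" for t
    unfolding jacobian_def at_within_interior[OF t] frechet_derivative_at[OF der[OF t]] ..
  show "(f has_derivative (\<lambda>h. jacobian f (at t within S) *v h)) (at t)" if t: "t \<in> interior S" for t
    using der[OF t] unfolding jac[OF t] by (simp add: matrix_works blinfun.bounded_linear_right bounded_linear.linear)
  have c: "continuous_on (interior S) g'"
    by (rule continuous_on_subset[OF g(4) subset_trans[OF interior_subset g(1)]])
  have "continuous_on (interior S) (\<lambda>t. matrix (blinfun_apply (g' t)))"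

    unfolding matrix_def by (intro continuous_on_vec_lambda continuous_on_component blinfun.continuous_on c continuous_on_const)
  then show "continuous_on (interior S) (\<lambda>t. jacobian f (at t within S))"
    by (rule continuous_on_eq) (simp add: jac)
qed

text \<open>Each base point has a closed ball whose trace on I lies in its neighbourhood V, which is
  open relative to I. Compactness of F leaves finitely many balls and hence a finite union of
  exceptional null sets.\<close>

lemma (in gaussian_space) AE_no_root_null_set:
  fixes X :: "'a::euclidean_space \<Rightarrow> 'w \<Rightarrow> 'b::euclidean_space"
  assumes gX: "\<And>t. t \<in> I \<Longrightarrow> gvec (X t)" and contX: "\<And>w. continuous_on I (\<lambda>t. X t w)"
    and nd: "\<And>t. t \<in> I \<Longrightarrow> nondegenerate M (X t)"
    and lip: "\<And>w s. s \<in> I \<Longrightarrow> \<exists>L \<delta>. 0 < \<delta> \<and> (\<forall>t\<in>I. dist t s < \<delta> \<longrightarrow> norm (X t w - X s w) \<le> L * norm (t - s))"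
    and F: "compact F" "F \<subseteq> I" "negligible F" and dim: "DIM('a) \<le> DIM('b)"
  shows "AE w in M. \<not> (\<exists>t\<in>F. X t w = u)"
proof -
  have gp: "gaussian_path M H X I t\<^sub>0" if "t\<^sub>0 \<in> I" for t\<^sub>0
    by (intro gaussian_path.intro gaussian_path_axioms.intro gaussian_space_axioms gX contX nd that)
  have "\<exists>r>0. AE w in M. \<not> (\<exists>t\<in>F \<inter> cball t\<^sub>0 r. X t w = u)" if t0: "t\<^sub>0 \<in> I" for t\<^sub>0
  proof -
    let ?V = "gaussian_path.V M X I t\<^sub>0"
    let ?S = "\<lambda>t. \<Sum>b\<in>Basis. norm (gaussian_path.C M X t\<^sub>0 t b - b)"
    have "?V = I \<inter> ?S -` {..<1/2}" unfolding gaussian_path.V_def[OF gp[OF t0]] by auto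
    moreover have "openin (top_of_set I) (I \<inter> ?S -` {..<1/2})"
      by (rule continuous_openin_preimage_gen[OF gaussian_path.contS[OF gp[OF t0]] open_lessThan])
    ultimately have "openin (top_of_set I) ?V" by simp
    then obtain r where r: "r > 0" "cball t\<^sub>0 r \<inter> I \<subseteq> ?V"
      unfolding openin_contains_cball using gaussian_path.t0V[OF gp[OF t0]] by blast
    have "AE w in M. \<not> (\<exists>t\<in>F \<inter> cball t\<^sub>0 r. X t w = u)"
    proof (rule gaussian_path.AE_no_root_negligible[OF gp[OF t0] lip _ _ _ dim])
      show "compact (F \<inter> cball t\<^sub>0 r)" by (intro compact_Int_closed F(1) closed_cball)
      show "F \<inter> cball t\<^sub>0 r \<subseteq> ?V" using r(2) F(2) by blast
      show "negligible (F \<inter> cball t\<^sub>0 r)" by (rule negligible_subset[OF F(3) Int_lower1])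
    qed
    then show ?thesis using r(1) by blast
  qed
  then have "\<forall>t\<in>I. \<exists>r. 0 < r \<and> (AE w in M. \<not> (\<exists>s\<in>F \<inter> cball t r. X s w = u))" by (intro ballI) auto
  from bchoice[OF this] obtain r where r: "\<forall>t\<in>I. 0 < r t \<and> (AE w in M. \<not> (\<exists>s\<in>F \<inter> cball t (r t). X s w = u))"
    by (elim exE)
  have "F \<subseteq> (\<Union>t\<in>F. ball t (r t))" using r F(2) by (intro subsetI UN_I) auto
  then obtain C where C: "C \<subseteq> F" "finite C" "F \<subseteq> (\<Union>t\<in>C. ball t (r t))"
    using compactE_image[OF F(1), of F "\<lambda>t. ball t (r t)"] by blast
  have "AE w in M. \<forall>t\<in>C. \<not> (\<exists>s\<in>F \<inter> cball t (r t). X s w = u)"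
    using C F(2) r by (intro AE_finite_allI) auto
  then show ?thesis
  proof eventually_elim
    case (elim w)
    show ?case
    proof
      assume "\<exists>t\<in>F. X t w = u"
      then obtain s where s: "s \<in> F" "X s w = u" by blast
      then obtain t where "t \<in> C" "s \<in> ball t (r t)" using C(3) by blast
      then have "s \<in> F \<inter> cball t (r t)" using s(1) ball_subset_cball by blast
      then show False using elim \<open>t \<in> C\<close> s(2) by blast
    qed
  qed
qed

section \<open>Gaussian tuples, their derivatives and null sets of tuples\<close>

context gaussian_space begin

lemma gvec_vec:
  fixes X :: "'k::finite \<Rightarrow> 'w \<Rightarrow> 'b::euclidean_space"
  assumes "\<And>j. gvec (X j)" shows "gvec (\<lambda>w. \<chi> j. X j w)"
  unfolding gvec_def inner_vec_def by (auto intro!: sum gvecD[OF assms])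

lemma gvec_real: "f \<in> H \<Longrightarrow> gvec f"
  unfolding gvec_def inner_real_def by (auto intro: scale)

lemma gvec_matrix:
  fixes Y :: "'w \<Rightarrow> real^'n^'m"
  assumes "\<And>i j. (\<lambda>w. Y w $ i $ j) \<in> H" shows "gvec Y"
proof -
  have "gvec (\<lambda>w. \<chi> i. \<chi> j. Y w $ i $ j)" by (intro gvec_vec gvec_real assms)
  then show ?thesis by simp
qed

end

lemma gaussian_field_space:
  assumes "prob_space M" "gaussian_field M I Z"
  shows "gaussian_space M {\<lambda>w. \<Sum>t\<in>F. a t \<bullet> Z t w | F a. finite F \<and> F \<subseteq> I}" (is "gaussian_space M ?H")
proof -
  interpret prob_space M by fact
  show ?thesis
  proof
    show "(\<lambda>w. 0) \<in> ?H" by (intro CollectI exI[of _ "{}"]) simp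
    show "(\<lambda>w. f w + g w) \<in> ?H" if fg: "f \<in> ?H" "g \<in> ?H" for f g
    proof -
      obtain F a where F: "finite F" "F \<subseteq> I" "f = (\<lambda>w. \<Sum>t\<in>F. a t \<bullet> Z t w)" using fg(1) by blast
      obtain G b where G: "finite G" "G \<subseteq> I" "g = (\<lambda>w. \<Sum>t\<in>G. b t \<bullet> Z t w)" using fg(2) by blast
      let ?c = "\<lambda>t. (if t \<in> F then a t else 0) + (if t \<in> G then b t else 0)"
      have "f w + g w = (\<Sum>t\<in>F \<union> G. ?c t \<bullet> Z t w)" for w
      proof -
        have "f w = (\<Sum>t\<in>F \<union> G. (if t \<in> F then a t else 0) \<bullet> Z t w)"
          unfolding F(3) by (rule sum.mono_neutral_cong_left) (use F G in auto)
        moreover have "g w = (\<Sum>t\<in>F \<union> G. (if t \<in> G then b t else 0) \<bullet> Z t w)"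
          unfolding G(3) by (rule sum.mono_neutral_cong_left) (use F G in auto)
        ultimately show ?thesis by (simp only: inner_add_left sum.distrib)
      qed
      then show ?thesis using F G by (intro CollectI exI[of _ "F \<union> G"] exI[of _ ?c]) auto
    qed
    show "(\<lambda>w. c * f w) \<in> ?H" if f: "f \<in> ?H" for f c
    proof -
      obtain F a where F: "finite F" "F \<subseteq> I" "f = (\<lambda>w. \<Sum>t\<in>F. a t \<bullet> Z t w)" using f by blast
      then show ?thesis by (intro CollectI exI[of _ F] exI[of _ "\<lambda>t. c *\<^sub>R a t"]) (simp add: sum_distrib_left)
    qed
    show "gaussian_char M f" if "f \<in> ?H" for f
      using that assms unfolding gaussian_field_def by (auto intro: gaussian_rv_imp_gaussian_char)
  qed
qed

lemma bounded_bilinear_block_mult: "bounded_bilinear (block_mult :: real^'d^'d^'k \<Rightarrow> _)"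
proof -
  have "linear (\<lambda>Y :: real^'d^'d^'k. block_mult Y h)" for h
    by (rule linearI) (auto simp: block_mult_def vec_eq_iff matrix_vector_mult_add_rdistrib scaleR_matrix_vector_assoc)
  then have "bilinear (block_mult :: real^'d^'d^'k \<Rightarrow> _)" by (simp add: bilinear_def linear_block_mult)
  then show ?thesis by (simp add: bilinear_conv_bounded_bilinear)
qed

lemma has_derivative_vec_lambda:
  fixes f :: "'k::finite \<Rightarrow> 'a::real_normed_vector \<Rightarrow> 'b::euclidean_space"
  assumes "\<And>j. (f j has_derivative f' j) (at a within S)"
  shows "((\<lambda>x. \<chi> j. f j x) has_derivative (\<lambda>h. \<chi> j. f' j h)) (at a within S)"
proof -
  have "((\<lambda>x. (\<chi> j. f j x) \<bullet> b) has_derivative (\<lambda>h. (\<chi> j. f' j h) \<bullet> b)) (at a within S)" for b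
    unfolding inner_vec_def vec_lambda_beta by (intro has_derivative_sum has_derivative_inner_left assms)
  then show ?thesis unfolding has_derivative_componentwise_within[of "\<lambda>x. \<chi> j. f j x"] by blast
qed

lemma open_injective_tuples:
  fixes S :: "'b::euclidean_space set"
  assumes "open S" shows "open {t :: 'b^'k::finite. (\<forall>j. t $ j \<in> S) \<and> inj (\<lambda>j. t $ j)}"
proof -
  have "{t :: 'b^'k. (\<forall>j. t $ j \<in> S) \<and> inj (\<lambda>j. t $ j)} =
    (\<Inter>j. (\<lambda>t. t $ j) -` S) \<inter> (\<Inter>p\<in>{(i, j). i \<noteq> j}. {t. t $ fst p \<noteq> t $ snd p})"
    by (auto simp: inj_def) metis
  moreover have "open ((\<lambda>t :: 'b^'k. t $ j) -` S)" for j
    by (rule open_vimage[OF assms]) (intro continuous_intros)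
  moreover have "open {t :: 'b^'k. t $ i \<noteq> t $ j}" for i j
    by (rule open_Collect_neq) (intro continuous_intros)+
  ultimately show ?thesis by (simp add: open_INT open_Int)
qed

lemma AE_vec_notin_null:
  fixes S :: "'b::euclidean_space set"
  assumes S: "S \<in> sets borel" "emeasure lborel S = 0"
  shows "AE t :: 'b^'k::finite in lborel. t $ j \<notin> S"
proof -
  have e: "{t :: 'b^'k. t $ j \<in> S} = {t. \<forall>i. t $ i \<in> (if i = j then S else UNIV)}" by auto
  have "emeasure lborel {t :: 'b^'k. t $ j \<in> S} = (\<Prod>i\<in>UNIV. emeasure lborel (if i = j then S else UNIV))"
    unfolding e by (rule emeasure_lborel_vec_product) (use S in auto)
  also have "\<dots> = 0" by (rule prod_zero) (use S in auto)
  finally have "emeasure lborel {t :: 'b^'k. t $ j \<in> S} = 0" .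
  moreover have "{t :: 'b^'k. t $ j \<in> S} \<in> sets borel"
    using measurable_sets_borel[OF borel_measurable_continuous_onI S(1), of "\<lambda>t :: 'b^'k. t $ j"]
    by (simp add: vimage_def continuous_on_component)
  ultimately show ?thesis by (intro AE_I'[of "{t. t $ j \<in> S}"]) (auto simp: null_sets_def)
qed

lemma AE_lborel_notin_negligible: "negligible S \<Longrightarrow> AE x in lborel. x \<notin> S"
  using AE_not_in[of S lebesgue] by (simp add: negligible_iff_null_sets AE_completion_iff)

text \<open>Equality of two entries confines t to the hyperplane orthogonal to
  \<open>axis i b - axis j b\<close>.\<close>

lemma AE_vec_components_distinct:
  fixes i j :: "'k::finite"
  assumes "i \<noteq> j" shows "AE t :: 'b::euclidean_space^'k in lborel. t $ i \<noteq> t $ j"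
proof -
  obtain b :: 'b where b: "b \<in> Basis" using nonempty_Basis by blast
  let ?a = "axis i b - axis j b :: 'b^'k"
  have "?a $ i \<noteq> 0" using assms b by (simp add: axis_def nonzero_Basis)
  then have "?a \<noteq> 0" by (metis zero_index)
  then have "negligible {t. ?a \<bullet> t = 0}" by (intro negligible_hyperplane) simp
  from AE_lborel_notin_negligible[OF this] show ?thesis
    by eventually_elim (auto simp: inner_diff_left inner_axis')
qed

lemma nondegenerate_component:
  fixes X :: "'k::finite \<Rightarrow> 'w \<Rightarrow> 'b::euclidean_space"
  assumes "nondegenerate M (\<lambda>w. \<chi> j. X j w)" shows "nondegenerate M (X j)"
  unfolding nondegenerate_def
proof (rule notI, elim exE conjE)
  fix S assume S: "affine S" "S \<noteq> UNIV" "AE w in M. X j w \<in> S"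
  have "affine {x :: 'b^'k. x $ j \<in> S}" using S(1) by (auto simp: affine_def)
  moreover have "{x :: 'b^'k. x $ j \<in> S} \<noteq> UNIV"
  proof
    assume u: "{x :: 'b^'k. x $ j \<in> S} = UNIV"
    have "y \<in> S" for y
    proof -
      have "(\<chi> i. y) \<in> {x :: 'b^'k. x $ j \<in> S}" unfolding u ..
      then show ?thesis by simp
    qed
    then show False using S(2) by auto
  qed
  moreover have "AE w in M. (\<chi> j. X j w) \<in> {x :: 'b^'k. x $ j \<in> S}" using S(3) by simp
  ultimately show False using assms unfolding nondegenerate_def by blast
qed

lemma has_derivative_matrix_entry_limit:
  fixes f :: "real^'n \<Rightarrow> real^'m"
  assumes der: "(f has_derivative (\<lambda>h. A *v h)) (at t)" and h: "h \<longlonglongrightarrow> 0" "\<And>n. h n \<noteq> 0"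
  shows "(\<lambda>n. (1 / h n) * (f (t + h n *\<^sub>R axis l 1) $ i - f t $ i)) \<longlonglongrightarrow> A $ i $ l"
proof -
  have d1: "((\<lambda>s. t + s *\<^sub>R axis l 1) has_derivative (\<lambda>s. s *\<^sub>R axis l 1)) (at 0)"
    by (auto intro!: derivative_eq_intros)
  have d2: "(f has_derivative (\<lambda>h. A *v h)) (at (t + 0 *\<^sub>R axis l 1))" using der by simp
  have "((\<lambda>s. f (t + s *\<^sub>R axis l 1) $ i) has_derivative (\<lambda>s. (A *v (s *\<^sub>R axis l 1)) $ i)) (at 0)"
    by (rule bounded_linear.has_derivative[OF bounded_linear_vec_nth has_derivative_compose[OF d1 d2]])
  moreover have "(A *v (s *\<^sub>R axis l 1)) $ i = A $ i $ l * s" for s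
    by (simp add: matrix_vector_mult_scaleR matrix_vector_mult_basis column_def)
  ultimately have "((\<lambda>s. f (t + s *\<^sub>R axis l 1) $ i) has_field_derivative A $ i $ l) (at 0)"
    by (simp add: has_field_derivative_def)
  then have "((\<lambda>s. (f (t + s *\<^sub>R axis l 1) $ i - f t $ i) / s) \<longlongrightarrow> A $ i $ l) (at 0)"
    by (simp add: DERIV_def)
  moreover have "filterlim h (at 0) sequentially" using h by (intro filterlim_atI) auto
  ultimately have "(\<lambda>n. (f (t + h n *\<^sub>R axis l 1) $ i - f t $ i) / h n) \<longlonglongrightarrow> A $ i $ l"
    by (rule filterlim_compose)
  then show ?thesis by simp
qed

text \<open>The case of paths that are C1 for every w, so that all pointwise limits and derivatives
  exist without exceptional sets. The root formula gives the claim over tuples of distinct interior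
  points; the frontier is removed almost surely on the left and as a null set on the right.\<close>

lemma factorial_moment_formula_C1:
  fixes M :: "'w measure" and I :: "(real^'d) set" and Z :: "real^'d \<Rightarrow> 'w \<Rightarrow> real^'d" and u :: "real^'d"
  assumes M: "prob_space M" and I: "compact I" and Z: "gaussian_field M I Z"
    and C1: "\<And>w. C1_on I (\<lambda>t. Z t w)"
    and nd: "\<And>t :: (real^'d)^'k::finite. (\<forall>j. t $ j \<in> I) \<Longrightarrow> inj (\<lambda>j. t $ j) \<Longrightarrow>
      nondegenerate M (\<lambda>w. \<chi> j. Z (t $ j) w)"
    and A4: "emeasure lborel (frontier I) = 0"
  shows "(\<integral>\<^sup>+ w. (\<Prod>i<CARD('k). num_roots I Z u w - of_nat i) \<partial>M) =
    (\<integral>\<^sup>+ t \<in> {t :: (real^'d)^'k. \<forall>j. t $ j \<in> I}.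
        gaussian_cond_exp M (\<lambda>Y :: real^'d^'d^'k. ennreal (\<Prod>j\<in>UNIV. \<bar>det (Y $ j)\<bar>))
          (\<lambda>w. \<chi> j. field_deriv I Z (t $ j) w) (\<lambda>w. \<chi> j. Z (t $ j) w) (\<chi> j. u)
        * ennreal (continuous_density M (\<lambda>w. \<chi> j. Z (t $ j) w) (\<chi> j. u)) \<partial>lborel)"
proof -
  define H\<^sub>0 where "H\<^sub>0 = {\<lambda>w. \<Sum>t\<in>F. a t \<bullet> Z t w | F a. finite F \<and> F \<subseteq> I}"
  interpret G\<^sub>0: gaussian_space M H\<^sub>0 unfolding H\<^sub>0_def by (rule gaussian_field_space[OF M Z])
  \<comment> \<open>Entries of the derivative are limits of difference quotients of the field, so
    the field and its derivative are jointly Gaussian in this closure.\<close>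
  interpret G: gaussian_space M G\<^sub>0.closure by (rule G\<^sub>0.gaussian_space_closure)
  have Z0: "(\<lambda>w. a \<bullet> Z t w) \<in> H\<^sub>0" if "t \<in> I" for t a
    unfolding H\<^sub>0_def using that by (intro CollectI exI[of _ "{t}"] exI[of _ "\<lambda>_. a"]) simp
  have gZ: "G.gvec (Z t)" if "t \<in> I" for t
    unfolding G.gvec_def using Z0[OF that] G\<^sub>0.subset_closure by blast
  have int: "t \<in> I" if "t \<in> interior I" for t using that interior_subset by blast
  note der = C1_on_jacobian(1)[OF C1, folded field_deriv_def]
  note contD = C1_on_jacobian(2)[OF C1, folded field_deriv_def]
  have gD: "G.gvec (field_deriv I Z t)" if t: "t \<in> interior I" for t
  proof (rule G.gvec_matrix)
    fix i l
    obtain e where e: "e > 0" "ball t e \<subseteq> I" using t unfolding mem_interior by blast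
    \<comment> \<open>A null sequence strictly between 0 and e, so that the difference quotients use
      only values of the field inside the ball.\<close>
    define h where "h n = e / (real n + 2)" for n
    have h: "h n \<noteq> 0" "0 < h n" "h n < e" for n using e(1) by (auto simp: h_def divide_less_eq less_divide_eq distrib_left intro!: add_pos_nonneg mult_nonneg_nonneg)
    have h0: "h \<longlonglongrightarrow> 0" unfolding h_def by real_asymp
    have s: "t + h n *\<^sub>R axis l 1 \<in> I" for n
      using e(2) h(2,3)[of n] by (intro subsetD[OF e(2)]) (simp add: dist_norm)
    have "(\<lambda>w. (1 / h n) * (axis i 1 \<bullet> Z (t + h n *\<^sub>R axis l 1) w - axis i 1 \<bullet> Z t w)) \<in> H\<^sub>0" for n
      by (intro G\<^sub>0.scale G\<^sub>0.diff Z0 s int[OF t])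
    then have "(\<lambda>w. (1 / h n) * (Z (t + h n *\<^sub>R axis l 1) w $ i - Z t w $ i)) \<in> H\<^sub>0" for n
      by (simp add: inner_axis')
    moreover have "(\<lambda>n. (1 / h n) * (Z (t + h n *\<^sub>R axis l 1) w $ i - Z t w $ i)) \<longlonglongrightarrow> field_deriv I Z t w $ i $ l" for w
      by (rule has_derivative_matrix_entry_limit[OF der[OF t] h0 h(1)])
    ultimately show "(\<lambda>w. field_deriv I Z t w $ i $ l) \<in> G\<^sub>0.closure"
      unfolding G\<^sub>0.closure_def
      by (intro CollectI exI[of _ "\<lambda>n w. (1 / h n) * (Z (t + h n *\<^sub>R axis l 1) w $ i - Z t w $ i)"]) auto
  qed
  define T where "T = {t :: (real^'d)^'k. (\<forall>j. t $ j \<in> interior I) \<and> inj (\<lambda>j. t $ j)}"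
  define X where "X t w = (\<chi> j. Z (t $ j) w)" for t :: "(real^'d)^'k" and w
  define Y where "Y t w = (\<chi> j. field_deriv I Z (t $ j) w)" for t :: "(real^'d)^'k" and w
  define v where "v = (\<chi> j::'k. u)"
  define \<rho> where "\<rho> t = gaussian_cond_exp M (\<lambda>y. ennreal (adet (block_mult y))) (Y t) (X t) v
      * ennreal (continuous_density M (X t) v)" for t
  have Tint: "t $ j \<in> interior I" if "t \<in> T" for t j using that by (simp add: T_def)
  have derX: "((\<lambda>s. X s w) has_derivative block_mult (Y t w)) (at t)" if t: "t \<in> T" for t w
  proof -
    have "((\<lambda>s. Z (s $ j) w) has_derivative (\<lambda>h. field_deriv I Z (t $ j) w *v (h $ j))) (at t)" for j
      by (rule has_derivative_compose[OF bounded_linear_imp_has_derivative[OF bounded_linear_vec_nth] der[OF Tint[OF t]]])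
    then have "((\<lambda>s. \<chi> j. Z (s $ j) w) has_derivative (\<lambda>h. \<chi> j. field_deriv I Z (t $ j) w *v (h $ j))) (at t)"
      by (rule has_derivative_vec_lambda)
    then show ?thesis unfolding X_def Y_def block_mult_def[abs_def] by simp
  qed
  have rice: "(\<integral>\<^sup>+w. emeasure (count_space UNIV) {t\<in>T. X t w = v} \<partial>M) = (\<integral>\<^sup>+t. indicator T t * \<rho> t \<partial>lborel)"
    unfolding \<rho>_def
  proof (rule G.rice_formula)
    show "open T" unfolding T_def by (rule open_injective_tuples[OF open_interior])
    show "G.gvec (X t)" if "t \<in> T" for t
      unfolding X_def[abs_def] by (intro G.gvec_vec gZ int Tint that)
    show "continuous_on T (\<lambda>t. X t w)" for w
      by (rule continuous_at_imp_continuous_on) (use derX has_derivative_continuous in blast)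
    show "G.gvec (Y t)" if "t \<in> T" for t
      unfolding Y_def[abs_def] by (intro G.gvec_vec gD Tint that)
    show "continuous_on T (\<lambda>t. Y t w)" for w
      unfolding Y_def
      by (intro continuous_on_vec_lambda continuous_on_compose2[OF contD] continuous_on_component continuous_on_id)
        (auto simp: Tint)
    show "((\<lambda>s. X s w) has_derivative block_mult (Y t w)) (at t)" if "t \<in> T" for t w by (rule derX[OF that])
    show "bounded_bilinear (block_mult :: real^'d^'d^'k \<Rightarrow> _)" by (rule bounded_bilinear_block_mult)
    show "continuous_on UNIV (\<lambda>y :: real^'d^'d^'k. adet (block_mult y))"
      by (intro continuous_on_adet bounded_bilinear.continuous_on[OF bounded_bilinear_block_mult] continuous_on_id continuous_on_const)
    show "nondegenerate M (X t)" if "t \<in> T" for t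
      unfolding X_def[abs_def] by (rule nd) (use that int in \<open>auto simp: T_def\<close>)
  qed
  have Ic: "closed I" using I by (rule compact_imp_closed)
  have fr: "frontier I \<subseteq> I" using frontier_subset_closed[OF Ic] .
  have dec: "t \<in> interior I" if "t \<in> I" "t \<notin> frontier I" for t
    using that closure_closed[OF Ic] by (simp add: frontier_def)
  have frb: "frontier I \<in> sets borel" by (intro borel_closed frontier_closed)
  have frn: "negligible (frontier I)"
    unfolding negligible_iff_null_sets using A4 frb by (intro null_sets_completionI) (simp add: null_sets_def)
  have roots: "AE w in M. {t :: (real^'d)^'k. (\<forall>j. t $ j \<in> {s\<in>I. Z s w = u}) \<and> inj (\<lambda>j. t $ j)} = {t\<in>T. X t w = v}"
  \<comment> \<open>If I has at least k points, each of them is an entry of an injective tuple, and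
    so every single Z(s) is nondegenerate. With fewer points there is no injective tuple in I, and
    both sets are empty.\<close>
  proof (cases "infinite I \<or> CARD('k) \<le> card I")
    case True
    have nd1: "nondegenerate M (Z s)" if s: "s \<in> I" for s
    proof -
      obtain t :: "(real^'d)^'k" and j where t: "\<forall>i. t $ i \<in> I" "inj (\<lambda>i. t $ i)" "t $ j = s"
        using extend_to_injective_tuple[OF s True] by blast
      show ?thesis using nondegenerate_component[OF nd[OF t(1,2)], of j] t(3) by simp
    qed
    have "AE w in M. \<not> (\<exists>t\<in>frontier I. Z t w = u)"
    proof (rule G.AE_no_root_null_set[OF gZ C1_on_imp_continuous_on[OF C1] nd1 C1_on_lipschitz_at[OF C1]])
      show "compact (frontier I)" by (rule compact_frontier[OF I])
    qed (use fr frn in auto)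
    then show ?thesis
    proof eventually_elim
      case (elim w)
      then have "s \<in> interior I" if "s \<in> I" "Z s w = u" for s using dec[OF that(1)] that(2) by blast
      then show ?case using int by (auto simp: T_def X_def v_def vec_eq_iff)
    qed
  next
    case False
    have "\<not> inj (\<lambda>j. t $ j)" if "\<forall>j. t $ j \<in> I" for t :: "(real^'d)^'k"
    proof
      assume "inj (\<lambda>j. t $ j)"
      then have "CARD('k) \<le> card I" using that False by (intro card_inj_on_le) auto
      then show False using False by simp
    qed
    then show ?thesis using int by (auto simp: T_def)
  qed
  have "(\<integral>\<^sup>+ w. (\<Prod>i<CARD('k). num_roots I Z u w - of_nat i) \<partial>M) =
    (\<integral>\<^sup>+ w. emeasure (count_space UNIV) {t :: (real^'d)^'k. (\<forall>j. t $ j \<in> {s\<in>I. Z s w = u}) \<and> inj (\<lambda>j. t $ j)} \<partial>M)"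
    unfolding emeasure_injective_tuples num_roots_def by (rule refl)
  also have "\<dots> = (\<integral>\<^sup>+w. emeasure (count_space UNIV) {t\<in>T. X t w = v} \<partial>M)"
    by (rule nn_integral_cong_AE) (use roots in eventually_elim, simp)
  also have "\<dots> = (\<integral>\<^sup>+t. indicator T t * \<rho> t \<partial>lborel)" by (rule rice)
  also have "\<dots> = (\<integral>\<^sup>+t. \<rho> t * indicator {t. \<forall>j. t $ j \<in> I} t \<partial>lborel)"
  \<comment> \<open>The two integrands differ only at tuples with an entry on the frontier or with
    two equal entries.\<close>
  proof (rule nn_integral_cong_AE)
    have "AE t :: (real^'d)^'k in lborel. \<forall>j\<in>UNIV. t $ j \<notin> frontier I"
      by (intro AE_finite_allI AE_vec_notin_null frb A4) simp
    moreover have "AE t :: (real^'d)^'k in lborel. \<forall>p\<in>{(i, j). i \<noteq> j}. t $ fst p \<noteq> t $ snd p"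
      by (intro AE_finite_allI) (auto intro: AE_vec_components_distinct)
    ultimately show "AE t in lborel. indicator T t * \<rho> t = \<rho> t * indicator {t. \<forall>j. t $ j \<in> I} t"
    proof eventually_elim
      case (elim t)
      have "inj (\<lambda>j. t $ j)" using elim(2) by (auto simp: inj_def)
      then have "t \<in> T \<longleftrightarrow> t \<in> {t. \<forall>j. t $ j \<in> I}" using elim(1) dec int unfolding T_def by blast
      then show ?case by (simp add: indicator_def)
    qed
  qed
  finally show ?thesis
    unfolding \<rho>_def X_def[abs_def] Y_def[abs_def] v_def adet_block_mult .
qed

section \<open>Changing the field on a null set\<close>

lemma measurable_completion_cong_AE:
  fixes f g :: "'w \<Rightarrow> 'b::topological_space"
  assumes eq: "AE w in completion M. f w = g w" and f: "f \<in> borel_measurable (completion M)"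
  shows "g \<in> borel_measurable (completion M)"
proof (rule measurableI)
  fix A :: "'b set" assume A: "A \<in> sets borel"
  obtain N where N: "{w \<in> space (completion M). f w \<noteq> g w} \<subseteq> N" "N \<in> null_sets (completion M)"
    using eq by (auto simp: eventually_ae_filter)
  let ?S = "space (completion M)"
  have e: "g -` A \<inter> ?S = (f -` A \<inter> ?S - N) \<union> (g -` A \<inter> ?S \<inter> N)" using N(1) by auto
  have a: "g -` A \<inter> ?S \<inter> N \<in> sets (completion M)"
    by (rule null_setsD2[OF null_sets_completion_subset[OF Int_lower2 N(2)]])
  have b: "f -` A \<inter> ?S - N \<in> sets (completion M)"
    by (rule sets.Diff[OF measurable_sets[OF f A] null_setsD2[OF N(2)]])
  show "g -` A \<inter> ?S \<in> sets (completion M)" by (rule sets.Un[OF b a, folded e])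
qed simp

text \<open>On the completion, functions that agree almost everywhere are both measurable or both
  not; in the second case both Bochner integrals have the default value 0. This lets the derivative
  be changed freely on null sets.\<close>

lemma integral_completion_cong_AE:
  fixes f g :: "'w \<Rightarrow> 'b::{banach, second_countable_topology}"
  assumes eq: "AE w in M. f w = g w"
  shows "(\<integral>w. f w \<partial>completion M) = (\<integral>w. g w \<partial>completion M)"
proof -
  have e: "AE w in completion M. f w = g w" using eq by (rule AE_completion)
  then have e': "AE w in completion M. g w = f w" by eventually_elim simp
  show ?thesis
  proof (cases "f \<in> borel_measurable (completion M)")
    case True
    show ?thesis by (rule integral_cong_AE[OF True measurable_completion_cong_AE[OF e True] e])
  next
    case False
    moreover have "g \<notin> borel_measurable (completion M)" using False measurable_completion_cong_AE[OF e'] by blast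
    ultimately show ?thesis
      using not_integrable_integral_eq[of "completion M" f] not_integrable_integral_eq[of "completion M" g]
        borel_measurable_integrable by metis
  qed
qed

lemma covariance_map_cong_AE:
  assumes "AE w in M. X w = X' w" "AE w in M. Y w = Y' w"
  shows "covariance_map M X Y = covariance_map M X' Y'"
proof
  fix a
  note m = integral_completion_cong_AE[OF assms(1)] integral_completion_cong_AE[OF assms(2)]
  show "covariance_map M X Y a = covariance_map M X' Y' a"
    unfolding covariance_map_def Let_def m
    by (rule integral_completion_cong_AE) (use assms in eventually_elim, simp)
qed

lemma gaussian_cond_exp_cong_AE:
  assumes X: "AE w in M. X w = X' w" and Y: "AE w in M. Y w = Y' w"
  shows "gaussian_cond_exp M f Y X x = gaussian_cond_exp M f Y' X' x"
  unfolding gaussian_cond_exp_def regression_map_def Let_def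
    covariance_map_cong_AE[OF X Y] covariance_map_cong_AE[OF X X]
  by (rule nn_integral_cong_AE) (use X Y in eventually_elim, simp)

lemma distributed_cong_AE:
  assumes "AE w in M. X w = X' w" "X \<in> measurable M N" "X' \<in> measurable M N"
  shows "distributed M N X f \<longleftrightarrow> distributed M N X' f"
  using assms distr_cong_AE[OF refl refl assms] by (simp add: distributed_def)

lemma continuous_density_cong_AE:
  assumes "AE w in M. X w = X' w" "X \<in> borel_measurable M" "X' \<in> borel_measurable M"
  shows "continuous_density M X = continuous_density M X'"
  unfolding continuous_density_def using distributed_cong_AE[OF assms(1), of lborel] assms(2,3) by simp

lemma nondegenerate_cong_AE:
  assumes "AE w in M. X w = X' w" and "nondegenerate M X"
  shows "nondegenerate M X'"
proof -
  have "AE w in M. X w \<in> S" if "AE w in M. X' w \<in> S" for S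
    using assms(1) that by eventually_elim simp
  then show ?thesis using assms(2) unfolding nondegenerate_def by blast
qed

lemma gaussian_rv_cong_AE:
  assumes eq: "AE w in M. X w = Y w" and Y: "Y \<in> borel_measurable M" and X: "gaussian_rv M X"
  shows "gaussian_rv M Y"
proof -
  have Xm: "X \<in> borel_measurable M" using X by (simp add: gaussian_rv_def)
  have "AE w in M. Y w = m" if "AE w in M. X w = m" for m
    using eq that by eventually_elim simp
  then show ?thesis
    using X Y distributed_cong_AE[OF eq, of lborel] Xm unfolding gaussian_rv_def by simp blast
qed

lemma borel_measurable_vec:
  fixes X :: "'k::finite \<Rightarrow> 'w \<Rightarrow> 'b::euclidean_space"
  assumes "\<And>j. X j \<in> borel_measurable M" shows "(\<lambda>w. \<chi> j. X j w) \<in> borel_measurable M"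
  by (rule borel_measurable_inner_BasisI)
    (use assms in \<open>auto simp: inner_vec_def intro!: borel_measurable_sum borel_measurable_inner\<close>)

theorem theorem2p2:
  fixes M :: "'w measure"
    and I :: "(real^'d) set"
    and Z :: "real^'d \<Rightarrow> 'w \<Rightarrow> real^'d"
    and u :: "real^'d"
    and k :: nat
  assumes "prob_space M"
    and "k = CARD('k::finite)" and "k \<ge> 2"
    and "compact I"
    and A0: "gaussian_field M I Z"
    and A1: "AE w in M. C1_on I (\<lambda>t. Z t w)"
    and A'2: "\<And>t :: (real^'d)^'k. (\<forall>j. t $ j \<in> I) \<Longrightarrow> inj (\<lambda>j. t $ j) \<Longrightarrow>
                nondegenerate M (\<lambda>w. \<chi> j. Z (t $ j) w)"
    and A3: "AE w in M. \<not> (\<exists>t \<in> interior I. Z t w = u \<and> det (field_deriv I Z t w) = 0)"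
    and A4: "emeasure lborel (frontier I) = 0"
  shows "(\<integral>\<^sup>+ w. (\<Prod>i<k. num_roots I Z u w - of_nat i) \<partial>M) =
    (\<integral>\<^sup>+ t \<in> {t :: (real^'d)^'k. \<forall>j. t $ j \<in> I}.
        gaussian_cond_exp M
          (\<lambda>Y :: real^'d^'d^'k. ennreal (\<Prod>j\<in>UNIV. \<bar>det (Y $ j)\<bar>))
          (\<lambda>w. \<chi> j. field_deriv I Z (t $ j) w)
          (\<lambda>w. \<chi> j. Z (t $ j) w)
          (\<chi> j. u)
        * ennreal (continuous_density M (\<lambda>w. \<chi> j. Z (t $ j) w) (\<chi> j. u)) \<partial>lborel)"
proof -
  obtain N where N: "{w \<in> space M. \<not> C1_on I (\<lambda>t. Z t w)} \<subseteq> N" "emeasure M N = 0" "N \<in> sets M"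
    using AE_E[OF A1] by blast
  \<comment> \<open>On a measurable null set containing the bad sample points the path becomes
    identically 0, which is C1. Root counts, conditional expectations and densities are then
    unchanged up to null sets.\<close>
  define Z' where "Z' t w = (if w \<in> space M - N then Z t w else 0)" for t w
  have Nn: "N \<in> null_sets M" using N(2,3) by (simp add: null_sets_def)
  have good: "AE w in M. w \<in> space M - N"
    using AE_not_in[OF Nn] AE_space by eventually_elim simp
  have eq: "Z' t w = Z t w" "num_roots I Z' u w = num_roots I Z u w" "field_deriv I Z' t w = field_deriv I Z t w"
    if "w \<in> space M - N" for t w
    using that by (simp_all add: Z'_def num_roots_def field_deriv_def)
  have Zm: "Z t \<in> borel_measurable M" if "t \<in> I" for t using A0 that by (simp add: gaussian_field_def)
  have Z'm: "Z' t \<in> borel_measurable M" if "t \<in> I" for t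
    unfolding Z'_def[abs_def] by (rule measurable_If_set) (use Zm[OF that] N(3) in auto)
  have tuple_eq: "AE w in M. (\<chi> j. Z' (t $ j) w) = (\<chi> j. Z (t $ j) w)"
    and deriv_eq: "AE w in M. (\<chi> j. field_deriv I Z' (t $ j) w) = (\<chi> j. field_deriv I Z (t $ j) w)" for t :: "(real^'d)^'k"
    using good by (eventually_elim, simp only: eq)+
  have field: "gaussian_field M I Z'"
    unfolding gaussian_field_def
  proof (intro conjI ballI allI impI Z'm)
    fix F :: "(real^'d) set" and a :: "real^'d \<Rightarrow> real^'d" assume F: "finite F \<and> F \<subseteq> I"
    show "gaussian_rv M (\<lambda>w. \<Sum>t\<in>F. a t \<bullet> Z' t w)"
    proof (rule gaussian_rv_cong_AE)
      show "AE w in M. (\<Sum>t\<in>F. a t \<bullet> Z t w) = (\<Sum>t\<in>F. a t \<bullet> Z' t w)"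
        using good by eventually_elim (simp only: eq)
      show "(\<lambda>w. \<Sum>t\<in>F. a t \<bullet> Z' t w) \<in> borel_measurable M"
        using F by (intro borel_measurable_sum borel_measurable_inner borel_measurable_const Z'm) auto
      show "gaussian_rv M (\<lambda>w. \<Sum>t\<in>F. a t \<bullet> Z t w)" using A0 F by (simp add: gaussian_field_def)
    qed
  qed
  have C1: "C1_on I (\<lambda>t. Z' t w)" for w
  proof (cases "w \<in> space M - N")
    case True
    then show ?thesis using N(1) by (auto simp: Z'_def)
  next
    case False
    show ?thesis unfolding C1_on_def
      by (rule exI[of _ UNIV], rule exI[of _ "\<lambda>_. 0"], rule exI[of _ "\<lambda>_. 0"])
        (use False in \<open>auto simp: Z'_def zero_blinfun.rep_eq\<close>)
  qed
  have nd: "nondegenerate M (\<lambda>w. \<chi> j. Z' (t $ j) w)" if t: "\<forall>j. t $ j \<in> I" "inj (\<lambda>j. t $ j)" for t :: "(real^'d)^'k"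
  proof (rule nondegenerate_cong_AE[OF _ A'2[OF t]])
    show "AE w in M. (\<chi> j. Z (t $ j) w) = (\<chi> j. Z' (t $ j) w)" using good by eventually_elim (simp only: eq)
  qed
  have "(\<integral>\<^sup>+ w. (\<Prod>i<k. num_roots I Z u w - of_nat i) \<partial>M) = (\<integral>\<^sup>+ w. (\<Prod>i<CARD('k). num_roots I Z' u w - of_nat i) \<partial>M)"
    unfolding \<open>k = CARD('k)\<close> by (rule nn_integral_cong_AE) (use good in eventually_elim, simp only: eq)
  also note factorial_moment_formula_C1[OF \<open>prob_space M\<close> \<open>compact I\<close> field C1 nd A4]
  also have "(\<integral>\<^sup>+ t \<in> {t :: (real^'d)^'k. \<forall>j. t $ j \<in> I}.
        gaussian_cond_exp M (\<lambda>Y :: real^'d^'d^'k. ennreal (\<Prod>j\<in>UNIV. \<bar>det (Y $ j)\<bar>))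
          (\<lambda>w. \<chi> j. field_deriv I Z' (t $ j) w) (\<lambda>w. \<chi> j. Z' (t $ j) w) (\<chi> j. u)
        * ennreal (continuous_density M (\<lambda>w. \<chi> j. Z' (t $ j) w) (\<chi> j. u)) \<partial>lborel) =
      (\<integral>\<^sup>+ t \<in> {t :: (real^'d)^'k. \<forall>j. t $ j \<in> I}.
        gaussian_cond_exp M (\<lambda>Y :: real^'d^'d^'k. ennreal (\<Prod>j\<in>UNIV. \<bar>det (Y $ j)\<bar>))
          (\<lambda>w. \<chi> j. field_deriv I Z (t $ j) w) (\<lambda>w. \<chi> j. Z (t $ j) w) (\<chi> j. u)
        * ennreal (continuous_density M (\<lambda>w. \<chi> j. Z (t $ j) w) (\<chi> j. u)) \<partial>lborel)"
  proof (rule nn_integral_cong)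
    fix t :: "(real^'d)^'k"
    have "continuous_density M (\<lambda>w. \<chi> j. Z' (t $ j) w) = continuous_density M (\<lambda>w. \<chi> j. Z (t $ j) w)" if "\<forall>j. t $ j \<in> I"
      by (rule continuous_density_cong_AE[OF tuple_eq]) (use that in \<open>auto intro!: borel_measurable_vec Zm Z'm\<close>)
    then show "gaussian_cond_exp M (\<lambda>Y :: real^'d^'d^'k. ennreal (\<Prod>j\<in>UNIV. \<bar>det (Y $ j)\<bar>))
          (\<lambda>w. \<chi> j. field_deriv I Z' (t $ j) w) (\<lambda>w. \<chi> j. Z' (t $ j) w) (\<chi> j. u)
        * ennreal (continuous_density M (\<lambda>w. \<chi> j. Z' (t $ j) w) (\<chi> j. u)) * indicator {t. \<forall>j. t $ j \<in> I} t =
      gaussian_cond_exp M (\<lambda>Y :: real^'d^'d^'k. ennreal (\<Prod>j\<in>UNIV. \<bar>det (Y $ j)\<bar>))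
          (\<lambda>w. \<chi> j. field_deriv I Z (t $ j) w) (\<lambda>w. \<chi> j. Z (t $ j) w) (\<chi> j. u)
        * ennreal (continuous_density M (\<lambda>w. \<chi> j. Z (t $ j) w) (\<chi> j. u)) * indicator {t. \<forall>j. t $ j \<in> I} t"
      unfolding gaussian_cond_exp_cong_AE[OF tuple_eq deriv_eq] by (cases "\<forall>j. t $ j \<in> I") simp_all
  qed
  finally show ?thesis .
qed

end
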